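(* The limit sketch $(\mathcal{E},\mathcal{S})$ of frames embedded into complete atomic boolean algebras (defined in the context) is realized and satisfies $$\mathrm{Mod}(\mathcal{S}) \simeq \mathsf{Top}^{\mathrm{op}}.$$
   Context: A limit sketch consists of a category and a class of distinguished (small) cones in it. A model is a functor to $\mathsf{Set}$ mapping the distinguished cones to limit cones; $\mathrm{Mod}(\mathcal{S})$ is the category of models and natural transformations. The sketch is realized if all functors $\mathrm{Hom}(A,-)$ are models, i.e. all distinguished cones are limit cones. The monomorphism cone of a morphism $f:A\to B$ is the cone $(\mathrm{id}_A,\mathrm{id}_A)$ from $A$ to the cospan $A\xrightarrow{f}B\xleftarrow{f}A$ (it is a limit cone iff $f$ is a monomorphism). An infinitary Lawvere theory is a category with a distinguished object $X$ such that all powers $X^I$ ($I$ a set) exist and every object is isomorphic to such a power; its models are the functors to $\mathsf{Set}$ preserving these powers. The categories $\mathsf{Frm}$ of frames and $\mathsf{CABA}$ of complete atomic boolean algebras are monadic over $\mathsf{Set}$, so there are infinitary Lawvere theories $(\mathcal{L}_F,X)$ and $(\mathcal{L}_B,Y)$ (the opposites of the categories of free frames, resp. free CABAs, on sets) with $\mathsf{Frm}\simeq\mathrm{Mod}(\mathcal{L}_F)$, $\mathsf{CABA}\simeq\mathrm{Mod}(\mathcal{L}_B)$, and a product-preserving functor $V:\mathcal{L}_F\to\mathcal{L}_B$, $X\mapsto Y$, inducing the forgetful functor $\mathsf{CABA}\to\mathsf{Frm}$. The category $\mathcal{E}$: start with the coproduct (disjoint union) category $\mathcal{L}_F\sqcup\mathcal{L}_B$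 and add the morphisms $$\mathrm{Hom}_{\mathcal{E}}(X^I,Y^J):=\mathrm{Hom}_{\mathcal{L}_B}(Y^I,Y^J),\qquad \mathrm{Hom}_{\mathcal{E}}(Y^J,X^I):=\mathrm{Hom}_{\mathcal{L}_F}(X^0,X^I).$$ Compositions are defined using $V$ and the unique morphisms to $X^0$, $Y^0$: for $X^K\to X^I\to Y^J$ one applies $V$ to the first morphism and composes in $\mathcal{L}_B$; for $X^I\to Y^J\to Y^K$ one composes in $\mathcal{L}_B$; for $Y^J\to X^I\to X^K$ one composes in $\mathcal{L}_F$; for $Y^K\to Y^J\to X^I$ the composite is given by the same element of $\mathrm{Hom}_{\mathcal{L}_F}(X^0,X^I)$ as the second morphism; for $Y^J\to X^I\to Y^K$ the first morphism $X^0\to X^I$ is mapped by $V$ to $Y^0\to Y^I$, composed with $Y^I\to Y^K$, and precomposed with $Y^J\to Y^0$; for $X^I\to Y^J\to X^K$ the composite is $X^I\to X^0\to X^K$. Let $\varphi:X\to Y$ be the morphism in $\mathcal{E}$ corresponding to $\mathrm{id}_Y\in\mathrm{Hom}_{\mathcal{L}_B}(Y,Y)$. The class $\mathcal{S}$ consists of the cones $(\mathrm{pr}_i:X^I\to X)_{i\in I}$ and $(\mathrm{pr}_j:Y^J\to Y)_{j\in J}$ for all sets $I,J$, together with the monomorphism cone of $\varphi$. *)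

theory Defs
  imports
    "HOL-Library.FuncSet"
    "HOL-Library.Equipollence"
    "HOL-Algebra.Complete_Lattice"
    "HOL-Analysis.Abstract_Topology"
begin

section \<open>Small sets\<close>

text \<open>
  The role of the class of all sets is played by a type \<open>'u\<close>, the universe. A set, over whatever
  type, counts as small if it has strictly fewer elements than \<open>'u\<close>; up to bijection the small
  sets are then the small subsets of \<open>'u\<close>. The universe is required to be closed under power sets.
  This makes \<open>'u\<close> infinite, and small sets are then closed under subsets, images, binary
  products and function sets. A Grothendieck universe, i.e. a type \<open>'u\<close> of strongly inaccessible
  cardinality, is a special case.
\<close>

definition small :: "'u itself \<Rightarrow> 'a set \<Rightarrow> bool" where
  "small U A \<longleftrightarrow> A \<prec> (UNIV :: 'u set)"

definition set_universe :: "'u itself \<Rightarrow> bool" where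
  "set_universe U \<longleftrightarrow> (\<forall>A :: 'u set. small U A \<longrightarrow> small U (Pow A))"


section \<open>Categories\<close>

text \<open>
  Hom-sets are indexed by source and target and need not be disjoint, so the remaining operations
  carry their objects as arguments: \<open>Comp C a b c g f\<close> is \<open>g \<circ> f\<close> for \<open>f : a \<rightarrow> b\<close>, \<open>g : b \<rightarrow> c\<close>.
\<close>

record ('o, 'm) cat =
  Obj :: "'o set"
  Hom :: "'o \<Rightarrow> 'o \<Rightarrow> 'm set"
  Iden :: "'o \<Rightarrow> 'm"
  Comp :: "'o \<Rightarrow> 'o \<Rightarrow> 'o \<Rightarrow> 'm \<Rightarrow> 'm \<Rightarrow> 'm"

definition category :: "('o, 'm) cat \<Rightarrow> bool" where
  "category C \<longleftrightarrow>
     (\<forall>a\<in>Obj C. Iden C a \<in> Hom C a a) \<and>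
     (\<forall>a\<in>Obj C. \<forall>b\<in>Obj C. \<forall>c\<in>Obj C. \<forall>f\<in>Hom C a b. \<forall>g\<in>Hom C b c.
        Comp C a b c g f \<in> Hom C a c) \<and>
     (\<forall>a\<in>Obj C. \<forall>b\<in>Obj C. \<forall>f\<in>Hom C a b.
        Comp C a a b f (Iden C a) = f \<and> Comp C a b b (Iden C b) f = f) \<and>
     (\<forall>a\<in>Obj C. \<forall>b\<in>Obj C. \<forall>c\<in>Obj C. \<forall>d\<in>Obj C.
        \<forall>f\<in>Hom C a b. \<forall>g\<in>Hom C b c. \<forall>h\<in>Hom C c d.
        Comp C a c d h (Comp C a b c g f) = Comp C a b d (Comp C b c d h g) f)"

definition op_cat :: "('o, 'm) cat \<Rightarrow> ('o, 'm) cat" where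
  "op_cat C = \<lparr> Obj = Obj C, Hom = (\<lambda>a b. Hom C b a), Iden = Iden C,
                Comp = (\<lambda>a b c g f. Comp C c b a f g) \<rparr>"

definition is_iso :: "('o, 'm) cat \<Rightarrow> 'o \<Rightarrow> 'o \<Rightarrow> 'm \<Rightarrow> bool" where
  "is_iso C a b f \<longleftrightarrow> f \<in> Hom C a b \<and>
     (\<exists>g\<in>Hom C b a. Comp C a b a g f = Iden C a \<and> Comp C b a b f g = Iden C b)"

record ('o, 'm, 'p, 'n) funct =
  fobj :: "'o \<Rightarrow> 'p"
  fmap :: "'o \<Rightarrow> 'o \<Rightarrow> 'm \<Rightarrow> 'n"

definition is_functor :: "('o, 'm) cat \<Rightarrow> ('p, 'n) cat \<Rightarrow> ('o, 'm, 'p, 'n) funct \<Rightarrow> bool" where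
  "is_functor C D F \<longleftrightarrow>
     (\<forall>a\<in>Obj C. fobj F a \<in> Obj D) \<and>
     (\<forall>a\<in>Obj C. \<forall>b\<in>Obj C. \<forall>f\<in>Hom C a b. fmap F a b f \<in> Hom D (fobj F a) (fobj F b)) \<and>
     (\<forall>a\<in>Obj C. fmap F a a (Iden C a) = Iden D (fobj F a)) \<and>
     (\<forall>a\<in>Obj C. \<forall>b\<in>Obj C. \<forall>c\<in>Obj C. \<forall>f\<in>Hom C a b. \<forall>g\<in>Hom C b c.
        fmap F a c (Comp C a b c g f) =
        Comp D (fobj F a) (fobj F b) (fobj F c) (fmap F b c g) (fmap F a b f))"

definition id_functor :: "('o, 'm, 'o, 'm) funct" where
  "id_functor = \<lparr> fobj = (\<lambda>a. a), fmap = (\<lambda>a b f. f) \<rparr>"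

definition comp_functor ::
  "('p, 'n, 'q, 'l) funct \<Rightarrow> ('o, 'm, 'p, 'n) funct \<Rightarrow> ('o, 'm, 'q, 'l) funct" where
  "comp_functor G F = \<lparr> fobj = (\<lambda>a. fobj G (fobj F a)),
                        fmap = (\<lambda>a b f. fmap G (fobj F a) (fobj F b) (fmap F a b f)) \<rparr>"

definition nat_trans ::
  "('o, 'm) cat \<Rightarrow> ('p, 'n) cat \<Rightarrow> ('o, 'm, 'p, 'n) funct \<Rightarrow> ('o, 'm, 'p, 'n) funct
     \<Rightarrow> ('o \<Rightarrow> 'n) set" where
  "nat_trans C D F G =
     {\<eta> \<in> extensional (Obj C).
        (\<forall>a\<in>Obj C. \<eta> a \<in> Hom D (fobj F a) (fobj G a)) \<and>
        (\<forall>a\<in>Obj C. \<forall>b\<in>Obj C. \<forall>f\<in>Hom C a b.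
           Comp D (fobj F a) (fobj F b) (fobj G b) (\<eta> b) (fmap F a b f) =
           Comp D (fobj F a) (fobj G a) (fobj G b) (fmap G a b f) (\<eta> a))}"

definition nat_isomorphic ::
  "('o, 'm) cat \<Rightarrow> ('p, 'n) cat \<Rightarrow> ('o, 'm, 'p, 'n) funct \<Rightarrow> ('o, 'm, 'p, 'n) funct
     \<Rightarrow> bool" where
  "nat_isomorphic C D F G \<longleftrightarrow>
     (\<exists>\<eta>\<in>nat_trans C D F G. \<forall>a\<in>Obj C. is_iso D (fobj F a) (fobj G a) (\<eta> a))"

definition equivalent_categories :: "('o, 'm) cat \<Rightarrow> ('p, 'n) cat \<Rightarrow> bool" where
  "equivalent_categories C D \<longleftrightarrow> category C \<and> category D \<and>
     (\<exists>F G. is_functor C D F \<and> is_functor D C G \<and>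
        nat_isomorphic C C id_functor (comp_functor G F) \<and>
        nat_isomorphic D D (comp_functor F G) id_functor)"


section \<open>The category of small sets and the category of small topological spaces\<close>

text \<open>
  The element type \<open>'v\<close> is independent of the universe, so that the hom-sets of a category can
  serve as objects. Maps are extensional functions.
\<close>

definition set_cat :: "'u itself \<Rightarrow> ('v set, 'v \<Rightarrow> 'v) cat" where
  "set_cat U = \<lparr> Obj = {A. small U A}, Hom = (\<lambda>A B. A \<rightarrow>\<^sub>E B), Iden = (\<lambda>A. \<lambda>x\<in>A. x),
                 Comp = (\<lambda>A B C g f. compose A g f) \<rparr>"

definition top_cat :: "('u topology, 'u \<Rightarrow> 'u) cat" where
  "top_cat = \<lparr> Obj = {T. small TYPE('u) (topspace T)},
               Hom = (\<lambda>S T. {f \<in> topspace S \<rightarrow>\<^sub>E topspace T. continuous_map S T f}),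
               Iden = (\<lambda>T. \<lambda>x\<in>topspace T. x),
               Comp = (\<lambda>R S T g f. compose (topspace R) g f) \<rparr>"


section \<open>Limit sketches\<close>

record ('j, 'k, 'o, 'm) cone =
  shape :: "('j, 'k) cat"
  diagram :: "('j, 'k, 'o, 'm) funct"
  apex :: "'o"
  leg :: "'j \<Rightarrow> 'm"

definition is_cone :: "('o, 'm) cat \<Rightarrow> ('j, 'k, 'o, 'm) cone \<Rightarrow> bool" where
  "is_cone C K \<longleftrightarrow>
     category (shape K) \<and> is_functor (shape K) C (diagram K) \<and> apex K \<in> Obj C \<and>
     (\<forall>j\<in>Obj (shape K). leg K j \<in> Hom C (apex K) (fobj (diagram K) j)) \<and>
     (\<forall>i\<in>Obj (shape K). \<forall>j\<in>Obj (shape K). \<forall>s\<in>Hom (shape K) i j.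
        Comp C (apex K) (fobj (diagram K) i) (fobj (diagram K) j) (fmap (diagram K) i j s) (leg K i)
        = leg K j)"

definition is_limit_cone :: "('o, 'm) cat \<Rightarrow> ('j, 'k, 'o, 'm) cone \<Rightarrow> bool" where
  "is_limit_cone C K \<longleftrightarrow> is_cone C K \<and>
     (\<forall>K'. is_cone C K' \<and> shape K' = shape K \<and> diagram K' = diagram K \<longrightarrow>
        (\<exists>!u. u \<in> Hom C (apex K') (apex K) \<and>
           (\<forall>j\<in>Obj (shape K).
              Comp C (apex K') (apex K) (fobj (diagram K) j) (leg K j) u = leg K' j)))"

definition map_cone ::
  "('o, 'm, 'p, 'n) funct \<Rightarrow> ('j, 'k, 'o, 'm) cone \<Rightarrow> ('j, 'k, 'p, 'n) cone" where
  "map_cone F K = \<lparr> shape = shape K, diagram = comp_functor F (diagram K), apex = fobj F (apex K),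
                    leg = (\<lambda>j. fmap F (apex K) (fobj (diagram K) j) (leg K j)) \<rparr>"

definition limit_sketch ::
  "'u itself \<Rightarrow> ('o, 'm) cat \<Rightarrow> ('j, 'k, 'o, 'm) cone set \<Rightarrow> bool" where
  "limit_sketch U C \<S> \<longleftrightarrow> category C \<and>
     (\<forall>K\<in>\<S>. is_cone C K \<and> small U (Obj (shape K)) \<and>
        (\<forall>i\<in>Obj (shape K). \<forall>j\<in>Obj (shape K). small U (Hom (shape K) i j)))"

definition is_model ::
  "'u itself \<Rightarrow> ('o, 'm) cat \<Rightarrow> ('j, 'k, 'o, 'm) cone set \<Rightarrow> ('o, 'm, 'v set, 'v \<Rightarrow> 'v) funct
     \<Rightarrow> bool" where
  "is_model U C \<S> M \<longleftrightarrow> is_functor C (set_cat U) M \<and>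
     (\<forall>K\<in>\<S>. is_limit_cone (set_cat U) (map_cone M K))"

definition hom_functor :: "('o, 'm) cat \<Rightarrow> 'o \<Rightarrow> ('o, 'm, 'm set, 'm \<Rightarrow> 'm) funct" where
  "hom_functor C a = \<lparr> fobj = Hom C a, fmap = (\<lambda>b c g. \<lambda>f\<in>Hom C a b. Comp C a b c g f) \<rparr>"

definition realized_limit_sketch ::
  "'u itself \<Rightarrow> ('o, 'm) cat \<Rightarrow> ('j, 'k, 'o, 'm) cone set \<Rightarrow> bool" where
  "realized_limit_sketch U C \<S> \<longleftrightarrow> limit_sketch U C \<S> \<and>
     (\<forall>a\<in>Obj C. is_model U C \<S> (hom_functor C a)) \<and>
     (\<forall>K\<in>\<S>. is_limit_cone C K)"

definition Mod_cat ::
  "('o, 'm) cat \<Rightarrow> ('j, 'k, 'o, 'm) cone set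
     \<Rightarrow> (('o, 'm, 'u set, 'u \<Rightarrow> 'u) funct, 'o \<Rightarrow> 'u \<Rightarrow> 'u) cat" where
  "Mod_cat C \<S> =
     \<lparr> Obj = {M. is_model TYPE('u) C \<S> M},
       Hom = nat_trans C (set_cat TYPE('u)),
       Iden = (\<lambda>M. \<lambda>a\<in>Obj C. Iden (set_cat TYPE('u)) (fobj M a)),
       Comp = (\<lambda>L M N \<tau> \<sigma>. \<lambda>a\<in>Obj C.
                 Comp (set_cat TYPE('u)) (fobj L a) (fobj M a) (fobj N a) (\<tau> a) (\<sigma> a)) \<rparr>"


subsection \<open>Power cones and monomorphism cones\<close>

text \<open>
  The distinguished cones of a sketch share one type of shapes: an index \<open>i\<close> of a power is the
  object \<open>Inl i\<close> of a discrete shape, and the three objects of the cospan shape are tagged by \<open>Inr\<close>.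
\<close>

datatype cospan = LeftEnd | RightEnd | Vertex

definition thin_cat :: "'j set \<Rightarrow> ('j \<Rightarrow> 'j \<Rightarrow> bool) \<Rightarrow> ('j, unit) cat" where
  "thin_cat A R = \<lparr> Obj = A, Hom = (\<lambda>i j. if R i j then {()} else {}), Iden = (\<lambda>_. ()),
                    Comp = (\<lambda>_ _ _ _ _. ()) \<rparr>"

definition power_cone ::
  "('o, 'm) cat \<Rightarrow> 'i set \<Rightarrow> 'o \<Rightarrow> 'o \<Rightarrow> ('i \<Rightarrow> 'm) \<Rightarrow> ('i + cospan, unit, 'o, 'm) cone" where
  "power_cone C I p x pr =
     \<lparr> shape = thin_cat (Inl ` I) (=),
       diagram = \<lparr> fobj = (\<lambda>_. x), fmap = (\<lambda>_ _ _. Iden C x) \<rparr>,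
       apex = p,
       leg = case_sum pr (\<lambda>_. undefined) \<rparr>"

definition mono_cone ::
  "('o, 'm) cat \<Rightarrow> 'o \<Rightarrow> 'o \<Rightarrow> 'm \<Rightarrow> ('i + cospan, unit, 'o, 'm) cone" where
  "mono_cone C a b f =
     \<lparr> shape = thin_cat (range Inr) (\<lambda>i j. i = j \<or> j = Inr Vertex),
       diagram =
         \<lparr> fobj = (\<lambda>i. if i = Inr Vertex then b else a),
           fmap = (\<lambda>i j _. if i \<noteq> j then f else if i = Inr Vertex then Iden C b else Iden C a) \<rparr>,
       apex = a,
       leg = (\<lambda>i. if i = Inr Vertex then f else Iden C a) \<rparr>"


section \<open>Frames and complete atomic boolean algebras\<close>

definition is_frame :: "'a gorder \<Rightarrow> bool" where
  "is_frame L \<longleftrightarrow> complete_lattice L \<and>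
     (\<forall>a\<in>carrier L. \<forall>S\<subseteq>carrier L. a \<sqinter>\<^bsub>L\<^esub> (\<Squnion>\<^bsub>L\<^esub> S) = \<Squnion>\<^bsub>L\<^esub> ((\<lambda>s. a \<sqinter>\<^bsub>L\<^esub> s) ` S))"

definition frame_homs :: "'a gorder \<Rightarrow> 'a gorder \<Rightarrow> ('a \<Rightarrow> 'a) set" where
  "frame_homs L M = {h \<in> carrier L \<rightarrow>\<^sub>E carrier M.
     sup_pres L M h \<and> meet_pres L M h \<and> h \<top>\<^bsub>L\<^esub> = \<top>\<^bsub>M\<^esub>}"

definition is_atom :: "'a gorder \<Rightarrow> 'a \<Rightarrow> bool" where
  "is_atom L a \<longleftrightarrow> a \<in> carrier L \<and> a \<noteq> \<bottom>\<^bsub>L\<^esub> \<and>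
     (\<forall>x\<in>carrier L. x \<sqsubseteq>\<^bsub>L\<^esub> a \<longrightarrow> x = \<bottom>\<^bsub>L\<^esub> \<or> x = a)"

definition is_caba :: "'a gorder \<Rightarrow> bool" where
  "is_caba L \<longleftrightarrow> complete_lattice L \<and>
     (\<forall>x\<in>carrier L. \<forall>y\<in>carrier L. \<forall>z\<in>carrier L.
        x \<sqinter>\<^bsub>L\<^esub> (y \<squnion>\<^bsub>L\<^esub> z) = (x \<sqinter>\<^bsub>L\<^esub> y) \<squnion>\<^bsub>L\<^esub> (x \<sqinter>\<^bsub>L\<^esub> z)) \<and>
     (\<forall>x\<in>carrier L. \<exists>y\<in>carrier L. x \<sqinter>\<^bsub>L\<^esub> y = \<bottom>\<^bsub>L\<^esub> \<and> x \<squnion>\<^bsub>L\<^esub> y = \<top>\<^bsub>L\<^esub>) \<and>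
     (\<forall>x\<in>carrier L. x \<noteq> \<bottom>\<^bsub>L\<^esub> \<longrightarrow> (\<exists>a. is_atom L a \<and> a \<sqsubseteq>\<^bsub>L\<^esub> x))"

text \<open>
  Maps preserving all joins and all meets preserve bottom and top, hence also complements.
\<close>

definition caba_homs :: "'a gorder \<Rightarrow> 'a gorder \<Rightarrow> ('a \<Rightarrow> 'a) set" where
  "caba_homs L M = {h \<in> carrier L \<rightarrow>\<^sub>E carrier M. sup_pres L M h \<and> inf_pres L M h}"

definition frm_cat :: "('u gorder, 'u \<Rightarrow> 'u) cat" where
  "frm_cat = \<lparr> Obj = {L. is_frame L \<and> small TYPE('u) (carrier L)},
               Hom = frame_homs, Iden = (\<lambda>L. \<lambda>x\<in>carrier L. x),
               Comp = (\<lambda>K L M g f. compose (carrier K) g f) \<rparr>"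

definition caba_cat :: "('u gorder, 'u \<Rightarrow> 'u) cat" where
  "caba_cat = \<lparr> Obj = {L. is_caba L \<and> small TYPE('u) (carrier L)},
                Hom = caba_homs, Iden = (\<lambda>L. \<lambda>x\<in>carrier L. x),
                Comp = (\<lambda>K L M g f. compose (carrier K) g f) \<rparr>"


section \<open>The two infinitary Lawvere theories\<close>

text \<open>
  Below, \<open>A\<close> is a category of ordered algebras with functions as morphisms, to be instantiated by
  \<^const>\<open>frm_cat\<close> and \<^const>\<open>caba_cat\<close>. Free algebras on a small set are unique up to unique
  isomorphism; one of them, with its generators, is chosen for each small set.
\<close>

definition is_free_on ::
  "('u gorder, 'u \<Rightarrow> 'u) cat \<Rightarrow> 'u set \<Rightarrow> 'u gorder \<Rightarrow> ('u \<Rightarrow> 'u) \<Rightarrow> bool" where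
  "is_free_on A I F \<eta> \<longleftrightarrow> F \<in> Obj A \<and> \<eta> \<in> I \<rightarrow> carrier F \<and>
     (\<forall>L\<in>Obj A. \<forall>g \<in> I \<rightarrow> carrier L. \<exists>!h. h \<in> Hom A F L \<and> (\<forall>i\<in>I. h (\<eta> i) = g i))"

definition chosen_free ::
  "('u gorder, 'u \<Rightarrow> 'u) cat \<Rightarrow> 'u set \<Rightarrow> 'u gorder \<times> ('u \<Rightarrow> 'u)" where
  "chosen_free A I = (SOME (F, \<eta>). is_free_on A I F \<eta>)"

definition free_alg :: "('u gorder, 'u \<Rightarrow> 'u) cat \<Rightarrow> 'u set \<Rightarrow> 'u gorder" where
  "free_alg A I = fst (chosen_free A I)"

definition generator :: "('u gorder, 'u \<Rightarrow> 'u) cat \<Rightarrow> 'u set \<Rightarrow> 'u \<Rightarrow> 'u" where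
  "generator A I = snd (chosen_free A I)"

text \<open>
  The small set \<open>I\<close>, as an object of the theory, stands for the power of the distinguished object
  with exponent \<open>I\<close>. The distinguished object itself is the power with a one-element exponent.
\<close>

definition lawvere_theory :: "('u gorder, 'u \<Rightarrow> 'u) cat \<Rightarrow> ('u set, 'u \<Rightarrow> 'u) cat" where
  "lawvere_theory A =
     \<lparr> Obj = {I. small TYPE('u) I},
       Hom = (\<lambda>I J. Hom (op_cat A) (free_alg A I) (free_alg A J)),
       Iden = (\<lambda>I. Iden (op_cat A) (free_alg A I)),
       Comp = (\<lambda>I J K. Comp (op_cat A) (free_alg A I) (free_alg A J) (free_alg A K)) \<rparr>"

abbreviation one_point :: "'u set" where
  "one_point \<equiv> {undefined}"

definition power_proj :: "('u gorder, 'u \<Rightarrow> 'u) cat \<Rightarrow> 'u set \<Rightarrow> 'u \<Rightarrow> 'u \<Rightarrow> 'u" where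
  "power_proj A I i = (THE h. h \<in> Hom (lawvere_theory A) I one_point \<and>
     h (generator A one_point undefined) = generator A I i)"

definition to_terminal :: "('u set, 'u \<Rightarrow> 'u) cat \<Rightarrow> 'u set \<Rightarrow> 'u \<Rightarrow> 'u" where
  "to_terminal T I = (THE h. h \<in> Hom T I {})"

abbreviation LF :: "('u set, 'u \<Rightarrow> 'u) cat" where
  "LF \<equiv> lawvere_theory frm_cat"

abbreviation LB :: "('u set, 'u \<Rightarrow> 'u) cat" where
  "LB \<equiv> lawvere_theory caba_cat"

text \<open>
  Every CABA is a frame, so there is a canonical frame homomorphism \<open>\<theta>\<^sub>I\<close> from the free frame to
  the free CABA on \<open>I\<close>. The functor \<open>V\<close> is the identity on objects. On morphisms it sends
  \<open>h : X\<^sup>I \<rightarrow> X\<^sup>J\<close>, i.e. a homomorphism from the free frame on \<open>J\<close> to the free frame on \<open>I\<close>, to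
  the homomorphism \<open>k\<close> of free CABAs with \<open>k \<circ> \<theta>\<^sub>J = \<theta>\<^sub>I \<circ> h\<close>.
\<close>

definition comparison :: "'u set \<Rightarrow> 'u \<Rightarrow> 'u" where
  "comparison I = (THE h. h \<in> frame_homs (free_alg frm_cat I) (free_alg caba_cat I) \<and>
     (\<forall>i\<in>I. h (generator frm_cat I i) = generator caba_cat I i))"

definition V_map :: "'u set \<Rightarrow> 'u set \<Rightarrow> ('u \<Rightarrow> 'u) \<Rightarrow> 'u \<Rightarrow> 'u" where
  "V_map I J h = (THE k. k \<in> Hom LB I J \<and>
     (\<forall>x\<in>carrier (free_alg frm_cat J). k (comparison J x) = comparison I (h x)))"


section \<open>The sketch of frames embedded into complete atomic boolean algebras\<close>

text \<open>
  A morphism \<open>Y\<^sup>J \<rightarrow> X\<^sup>I\<close> is a constant \<open>X\<^sup>0 \<rightarrow> X\<^sup>I\<close>, thought of as precomposed with the map from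
  \<open>Y\<^sup>J\<close> to the terminal object; the exponent \<open>0\<close> is the empty set.
\<close>

datatype 'u eobj = XPow "'u set" | YPow "'u set"

fun E_hom :: "'u eobj \<Rightarrow> 'u eobj \<Rightarrow> ('u \<Rightarrow> 'u) set" where
  "E_hom (XPow I) (XPow J) = Hom LF I J"
| "E_hom (YPow I) (YPow J) = Hom LB I J"
| "E_hom (XPow I) (YPow J) = Hom LB I J"
| "E_hom (YPow J) (XPow I) = Hom LF {} I"

fun E_iden :: "'u eobj \<Rightarrow> 'u \<Rightarrow> 'u" where
  "E_iden (XPow I) = Iden LF I"
| "E_iden (YPow I) = Iden LB I"

fun E_comp ::
  "'u eobj \<Rightarrow> 'u eobj \<Rightarrow> 'u eobj \<Rightarrow> ('u \<Rightarrow> 'u) \<Rightarrow> ('u \<Rightarrow> 'u) \<Rightarrow> 'u \<Rightarrow> 'u" where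
  "E_comp (XPow K) (XPow I) (XPow J) g f = Comp LF K I J g f"
| "E_comp (YPow K) (YPow I) (YPow J) g f = Comp LB K I J g f"
| "E_comp (XPow K) (XPow I) (YPow J) g f = Comp LB K I J g (V_map K I f)"
| "E_comp (XPow I) (YPow J) (YPow K) g f = Comp LB I J K g f"
| "E_comp (YPow J) (XPow I) (XPow K) g f = Comp LF {} I K g f"
| "E_comp (YPow K) (YPow J) (XPow I) g f = g"
| "E_comp (YPow J) (XPow I) (YPow K) g f =
     Comp LB J {} K (Comp LB {} I K g (V_map {} I f)) (to_terminal LB J)"
| "E_comp (XPow I) (YPow J) (XPow K) g f = Comp LF I {} K g (to_terminal LF I)"

definition E_cat :: "('u eobj, 'u \<Rightarrow> 'u) cat" where
  "E_cat = \<lparr> Obj = XPow ` Obj LF \<union> YPow ` Obj LB, Hom = E_hom, Iden = E_iden, Comp = E_comp \<rparr>"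

definition phi :: "'u \<Rightarrow> 'u" where
  "phi = Iden LB one_point"

definition E_cones :: "('u + cospan, unit, 'u eobj, 'u \<Rightarrow> 'u) cone set" where
  "E_cones =
     {power_cone E_cat I (XPow I) (XPow one_point) (power_proj frm_cat I) | I. small TYPE('u) I} \<union>
     {power_cone E_cat J (YPow J) (YPow one_point) (power_proj caba_cat J) | J. small TYPE('u) J} \<union>
     {mono_cone E_cat (XPow one_point) (YPow one_point) phi}"

end

theory Submission
  imports Defs
begin

text \<open>
  The category \<open>E\<close> is a category of spaces in disguise. Put on the power set of a small set \<open>I\<close>
  either the topology of the \<open>I\<close>-th power of the Sierpinski space, or the indiscrete topology,
  and call these spaces \<open>S\<^sup>I\<close> and \<open>D\<^sup>I\<close>. The opens of \<open>S\<^sup>I\<close> form the free frame on \<open>I\<close>, and the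
  subsets of \<open>Pow I\<close> form the free CABA on \<open>I\<close>. Hence continuous maps \<open>S\<^sup>I \<rightarrow> S\<^sup>J\<close> are the
  morphisms \<open>X\<^sup>I \<rightarrow> X\<^sup>J\<close>, arbitrary functions \<open>Pow I \<rightarrow> Pow J\<close> are the morphisms \<open>Y\<^sup>I \<rightarrow> Y\<^sup>J\<close> and
  \<open>X\<^sup>I \<rightarrow> Y\<^sup>J\<close>, and the constant maps, which are the only continuous maps \<open>D\<^sup>J \<rightarrow> S\<^sup>I\<close>, are the
  morphisms \<open>Y\<^sup>J \<rightarrow> X\<^sup>I\<close>. The functor \<open>V\<close> forgets continuity, and \<open>\<phi>\<close> is the identity function on
  a two-element set. So \<open>X\<^sup>I \<mapsto> S\<^sup>I\<close>, \<open>Y\<^sup>J \<mapsto> D\<^sup>J\<close> is a fully faithful functor from \<open>E\<close> to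
  spaces (\<open>realizeE_bij\<close>, \<open>realizeE_comp\<close>). The category axioms for \<open>E\<close> follow, and so
  does the first half of the theorem (\<open>realized_E\<close>): the powers in \<open>E\<close> are products of spaces, and
  \<open>\<phi>\<close> is injective.

  A small space \<open>T\<close> gives a model: it sends an object of \<open>E\<close> to the set of continuous maps from
  \<open>T\<close> to the corresponding space. The second half says that this functor \<open>top_functor\<close> from
  \<open>Top\<^sup>o\<^sup>p\<close> to models is an equivalence.

  It is fully faithful (\<open>natural_maps_representable\<close>) because every function on \<open>T\<close> with
  values in a power set factors through the map \<open>x \<mapsto> {x}\<close> from \<open>T\<close> to \<open>Pow T\<close>. By naturality a transformation
  from the model of \<open>T\<close> to that of \<open>S\<close> is determined by the value of this one map, which is a
  function from \<open>S\<close> to \<open>Pow T\<close>. Its values are singletons, again by naturality, so it is a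
  function \<open>S \<rightarrow> T\<close>; maps to the Sierpinski space show that it is continuous.

  It is essentially surjective (\<open>top_functor_essentially_surjective\<close>) by the following
  argument, which reconstructs the points of a model \<open>M\<close> directly. Let \<open>B = M(Y)\<close>. The elements of \<open>B\<close>, taken
  together as one tuple, form an element \<open>e\<close> of \<open>M(Y\<^sup>B)\<close>, and every element of \<open>M(Y\<^sup>K)\<close> is
  the image of \<open>e\<close> under some function \<open>u : Pow B \<rightarrow> Pow K\<close>. The subsets of \<open>Pow B\<close> whose indicator
  function has the same value at \<open>e\<close> as the constant function true form a filter that
  contains its own intersection \<open>P\<close> (\<open>points_true\<close>), and two functions have the same value at
  \<open>e\<close> if and only if they agree on \<open>P\<close> (\<open>ev_eq_iff\<close>). So \<open>M(Y\<^sup>K)\<close> is the set of functions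
  \<open>P \<rightarrow> Pow K\<close>. As \<open>M\<close> sends \<open>\<phi>\<close> to an injection, \<open>M(X)\<close> becomes a set of
  subsets of \<open>P\<close>. It is closed under unions and finite intersections because these
  operations are continuous maps between Sierpinski powers, so it is a topology, and
  \<open>M(X\<^sup>I)\<close> is the set of continuous maps from \<open>P\<close> to \<open>S\<^sup>I\<close>.
\<close>

section \<open>Small sets and their codes in the universe\<close>


lemma small_lepoll:
  assumes "A \<lesssim> B" "small U B"
  shows "small U A"
  using assms lesspoll_trans1 unfolding small_def by blast

lemma small_subset: "A \<subseteq> B \<Longrightarrow> small U B \<Longrightarrow> small U A"
  by (blast intro: small_lepoll subset_imp_lepoll)

lemma small_image: "small U A \<Longrightarrow> small U (f ` A)"
  by (blast intro: small_lepoll image_lepoll)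

lemma small_inj: "inj_on f A \<Longrightarrow> small U (f ` A) \<Longrightarrow> small U A"
  by (rule small_lepoll[of A "f ` A"]) (auto simp: lepoll_def)

lemma small_UNIV: "\<not> small TYPE('u) (UNIV :: 'u set)"
  by (simp add: small_def)

text \<open>
  A model takes its values in subsets of the universe, so the small sets that occur below, for
  instance sets of continuous maps, have to be copied into it. One injection is chosen for each
  set, so that the copies depend only on the set.
\<close>

definition code :: "'a set \<Rightarrow> 'a \<Rightarrow> 'u" where
  "code A = (SOME f. inj_on f A)"

lemma inj_code:
  fixes A :: "'a set"
  assumes "small TYPE('u) A"
  shows "inj_on (code A :: 'a \<Rightarrow> 'u) A"
proof -
  have "A \<lesssim> (UNIV :: 'u set)"
    using assms by (simp add: small_def lesspoll_def)
  then obtain f :: "'a \<Rightarrow> 'u" where "inj_on f A"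
    unfolding lepoll_def by blast
  then show ?thesis unfolding code_def by (rule someI[where P = "\<lambda>f. inj_on f A"])
qed

definition decode :: "'a set \<Rightarrow> 'u \<Rightarrow> 'a" where
  "decode A = inv_into A (code A)"

lemma decode_code: "small TYPE('u) A \<Longrightarrow> x \<in> A \<Longrightarrow> decode A (code A x :: 'u) = x"
  unfolding decode_def by (simp add: inj_code)

lemma code_decode: "y \<in> code A ` A \<Longrightarrow> code A (decode A y) = y"
  unfolding decode_def by (rule f_inv_into_f)

lemma decode_in: "y \<in> code A ` A \<Longrightarrow> decode A y \<in> A"
  unfolding decode_def by (rule inv_into_into)

lemma code_eq_iff:
  "small TYPE('u) A \<Longrightarrow> x \<in> A \<Longrightarrow> y \<in> A \<Longrightarrow> (code A x :: 'u) = code A y \<longleftrightarrow> x = y"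
  using inj_code[of A] by (auto dest: inj_onD)

context
  fixes U :: "'u itself"
  assumes universe: "set_universe TYPE('u)"
begin

text \<open>
  A universe with \<open>n\<close> elements would have a small subset with \<open>n - 1\<close> elements, whose power set
  has at least \<open>n\<close> elements.
\<close>

lemma infinite_universe: "infinite (UNIV :: 'u set)"
proof
  assume fin: "finite (UNIV :: 'u set)"
  define n where "n = card (UNIV :: 'u set)"
  have small_iff: "small TYPE('u) A \<longleftrightarrow> card A < n" if "finite A" for A :: "'b set"
  proof -
    have "A \<lesssim> (UNIV :: 'u set) \<longleftrightarrow> card A \<le> n"
      using that fin unfolding lepoll_def n_def by (rule inj_on_iff_card_le)
    moreover have "A \<approx> (UNIV :: 'u set) \<longleftrightarrow> card A = n"
      using that fin unfolding n_def by (rule eqpoll_iff_card)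
    ultimately show ?thesis unfolding small_def lesspoll_def by auto
  qed
  have "n > 0" unfolding n_def using fin by (simp add: card_gt_0_iff)
  obtain x :: 'u where True by blast
  let ?A = "UNIV - {x}"
  have card: "card ?A = n - 1" unfolding n_def using fin by simp
  have "small TYPE('u) ?A"
    using small_iff[of ?A] card fin \<open>n > 0\<close> by simp
  then have "small TYPE('u) (Pow ?A)"
    using universe by (simp add: set_universe_def)
  then have "2 ^ (n - 1) < n"
    using small_iff[of "Pow ?A"] fin card by (simp add: card_Pow)
  moreover have "n - 1 < 2 ^ (n - 1)" by (rule less_exp)
  ultimately show False by linarith
qed

lemma small_finite: "finite A \<Longrightarrow> small TYPE('u) A"
  unfolding small_def by (rule finite_lesspoll_infinite[OF infinite_universe])

lemma small_Pow:
  fixes A :: "'a set"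
  assumes "small TYPE('u) A"
  shows "small TYPE('u) (Pow A)"
proof -
  let ?c = "code A :: 'a \<Rightarrow> 'u"
  have "small TYPE('u) (Pow (?c ` A))"
    using universe assms small_image unfolding set_universe_def by blast
  moreover have "inj_on ((`) ?c) (Pow A)"
    using inj_code[OF assms] by (rule inj_on_image_Pow)
  moreover have "((`) ?c) ` Pow A = Pow (?c ` A)"
    by (simp add: image_Pow_surj)
  ultimately show ?thesis using small_inj by metis
qed

lemma small_Plus:
  fixes A :: "'a set" and B :: "'b set"
  assumes "small TYPE('u) A" "small TYPE('u) B"
  shows "small TYPE('u) (A <+> B)"
proof -
  include cardinal_syntax
  have lesspoll: "small TYPE('u) C \<longleftrightarrow> |C| <o |UNIV :: 'u set|" for C :: "'c set"
    unfolding small_def lesspoll_def lepoll_def eqpoll_iff_card_of_ordIso card_of_ordLeq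
    by (auto simp: ordLeq_iff_ordLess_or_ordIso not_ordLess_ordIso)
  show ?thesis
    using assms unfolding lesspoll
    by (rule card_of_Plus_ordLess_infinite[OF infinite_universe])
qed

lemma small_insert: "small TYPE('u) A \<Longrightarrow> small TYPE('u) (insert x A)"
proof -
  assume A: "small TYPE('u) A"
  have "inj_on (\<lambda>y. if y \<in> A then Inl y else Inr y) (insert x A)"
    by (auto simp: inj_on_def)
  moreover have "small TYPE('u) ((\<lambda>y. if y \<in> A then Inl y else Inr y) ` insert x A)"
    by (rule small_subset[OF _ small_Plus[OF A small_finite[of "{x}"]]]) auto
  ultimately show ?thesis by (rule small_inj)
qed

text \<open>
  The sum of two small sets is small, and ordered pairs can be coded as sets of sets of
  elements of the sum, in the style of Kuratowski.
\<close>

lemma small_Times: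
  fixes A :: "'a set" and B :: "'b set"
  assumes "small TYPE('u) A" "small TYPE('u) B"
  shows "small TYPE('u) (A \<times> B)"
proof -
  let ?f = "\<lambda>(a, b). {{Inl a}, {Inl a, Inr b}} :: ('a + 'b) set set"
  have "inj_on ?f (A \<times> B)"
    by (auto simp: inj_on_def doubleton_eq_iff)
  moreover have "?f ` (A \<times> B) \<subseteq> Pow (Pow (A <+> B))" by auto
  then have "small TYPE('u) (?f ` (A \<times> B))"
    by (rule small_subset) (intro small_Pow small_Plus assms)
  ultimately show ?thesis by (rule small_inj)
qed

lemma small_PiE:
  assumes "small TYPE('u) A" "small TYPE('u) B"
  shows "small TYPE('u) (A \<rightarrow>\<^sub>E B)"
proof (rule small_inj)
  let ?g = "\<lambda>f. {(x, y). x \<in> A \<and> y = f x}"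
  show "inj_on ?g (A \<rightarrow>\<^sub>E B)"
  proof (rule inj_onI)
    fix f g assume fg: "f \<in> A \<rightarrow>\<^sub>E B" "g \<in> A \<rightarrow>\<^sub>E B" and eq: "?g f = ?g g"
    have "f x = g x" if "x \<in> A" for x
    proof -
      have "(x, f x) \<in> ?g f" using that by simp
      then show ?thesis unfolding eq by simp
    qed
    then show "f = g" by (rule PiE_ext[OF fg])
  qed
  show "small TYPE('u) (?g ` (A \<rightarrow>\<^sub>E B))"
    by (rule small_subset[OF _ small_Pow[OF small_Times[OF assms]]]) auto
qed

end

section \<open>Categories, equivalences and limit cones\<close>

lemma category_idenI: "category C \<Longrightarrow> a \<in> Obj C \<Longrightarrow> Iden C a \<in> Hom C a a"
  by (simp add: category_def)

lemma category_comp_in: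
  "category C \<Longrightarrow> a \<in> Obj C \<Longrightarrow> b \<in> Obj C \<Longrightarrow> c \<in> Obj C \<Longrightarrow> f \<in> Hom C a b \<Longrightarrow> g \<in> Hom C b c
    \<Longrightarrow> Comp C a b c g f \<in> Hom C a c"
  unfolding category_def by blast

lemma category_unit:
  assumes "category C" "a \<in> Obj C" "b \<in> Obj C" "f \<in> Hom C a b"
  shows "Comp C a a b f (Iden C a) = f" "Comp C a b b (Iden C b) f = f"
  using assms unfolding category_def by blast+

lemma category_assoc:
  assumes "category C" "a \<in> Obj C" "b \<in> Obj C" "c \<in> Obj C" "d \<in> Obj C"
    and "f \<in> Hom C a b" "g \<in> Hom C b c" "h \<in> Hom C c d"
  shows "Comp C a c d h (Comp C a b c g f) = Comp C a b d (Comp C b c d h g) f"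
  using assms unfolding category_def by blast

lemma functor_obj: "is_functor C D F \<Longrightarrow> a \<in> Obj C \<Longrightarrow> fobj F a \<in> Obj D"
  by (simp add: is_functor_def)

lemma functor_map:
  "is_functor C D F \<Longrightarrow> a \<in> Obj C \<Longrightarrow> b \<in> Obj C \<Longrightarrow> f \<in> Hom C a b
    \<Longrightarrow> fmap F a b f \<in> Hom D (fobj F a) (fobj F b)"
  by (simp add: is_functor_def)

lemma functor_iden: "is_functor C D F \<Longrightarrow> a \<in> Obj C \<Longrightarrow> fmap F a a (Iden C a) = Iden D (fobj F a)"
  by (simp add: is_functor_def)

lemma functor_comp:
  "is_functor C D F \<Longrightarrow> a \<in> Obj C \<Longrightarrow> b \<in> Obj C \<Longrightarrow> c \<in> Obj C \<Longrightarrow> f \<in> Hom C a b \<Longrightarrow> g \<in> Hom C b c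
    \<Longrightarrow> fmap F a c (Comp C a b c g f)
      = Comp D (fobj F a) (fobj F b) (fobj F c) (fmap F b c g) (fmap F a b f)"
  by (simp add: is_functor_def)

lemma category_op: "category C \<Longrightarrow> category (op_cat C)"
  unfolding category_def op_cat_def by simp

text \<open>
  An object \<open>F c\<close> with \<open>G (F c) \<cong> c\<close> is chosen for each \<open>c\<close>, and \<open>F\<close> is defined on morphisms by
  conjugating with the chosen isomorphisms and lifting along \<open>G\<close>. Every equation between
  morphisms of \<open>D\<close> can be tested after applying \<open>G\<close>.
\<close>

lemma equivalence_if_fully_faithful_essentially_surjective:
  assumes C: "category C" and D: "category D" and G: "is_functor D C G"
    and ff: "\<And>x y. x \<in> Obj D \<Longrightarrow> y \<in> Obj D
      \<Longrightarrow> bij_betw (fmap G x y) (Hom D x y) (Hom C (fobj G x) (fobj G y))"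
    and ess: "\<And>c. c \<in> Obj C \<Longrightarrow> \<exists>x\<in>Obj D. \<exists>f. is_iso C c (fobj G x) f"
  shows "equivalent_categories C D"
proof -
  let ?G = "fobj G"
  note [simp] = functor_obj[OF G] category_idenI[OF C] category_idenI[OF D]
    category_comp_in[OF C] category_comp_in[OF D] functor_map[OF G]
  have "\<forall>c\<in>Obj C. \<exists>x f g. x \<in> Obj D \<and> f \<in> Hom C c (?G x) \<and> g \<in> Hom C (?G x) c \<and>
      Comp C c (?G x) c g f = Iden C c \<and> Comp C (?G x) c (?G x) f g = Iden C (?G x)"
    using ess unfolding is_iso_def by blast
  then obtain F i j where F: "\<And>c. c \<in> Obj C \<Longrightarrow> F c \<in> Obj D"
    and i: "\<And>c. c \<in> Obj C \<Longrightarrow> i c \<in> Hom C c (?G (F c))"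
    and j: "\<And>c. c \<in> Obj C \<Longrightarrow> j c \<in> Hom C (?G (F c)) c"
    and ji: "\<And>c. c \<in> Obj C \<Longrightarrow> Comp C c (?G (F c)) c (j c) (i c) = Iden C c"
    and ij: "\<And>c. c \<in> Obj C \<Longrightarrow> Comp C (?G (F c)) c (?G (F c)) (i c) (j c) = Iden C (?G (F c))"
    by metis
  note [simp] = F i j
  define lift where "lift x y = inv_into (Hom D x y) (fmap G x y)" for x y
  have lift: "lift x y g \<in> Hom D x y" "fmap G x y (lift x y g) = g"
    if "x \<in> Obj D" "y \<in> Obj D" "g \<in> Hom C (?G x) (?G y)" for x y g
  proof -
    have g: "g \<in> fmap G x y ` Hom D x y"
      using ff[of x y] that by (simp add: bij_betw_def)
    show "lift x y g \<in> Hom D x y" "fmap G x y (lift x y g) = g"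
      unfolding lift_def using g by (rule inv_into_into, rule f_inv_into_f)
  qed
  note [simp] = lift
  have faithful: "f = f'" if "x \<in> Obj D" "y \<in> Obj D" "f \<in> Hom D x y" "f' \<in> Hom D x y"
      "fmap G x y f = fmap G x y f'" for x y f f'
    using ff[of x y] that by (auto simp: bij_betw_def dest: inj_onD)
  define conj where "conj a b f =
      Comp C (?G (F a)) a (?G (F b)) (Comp C a b (?G (F b)) (i b) f) (j a)" for a b f
  have conj[simp]: "conj a b f \<in> Hom C (?G (F a)) (?G (F b))"
    if "a \<in> Obj C" "b \<in> Obj C" "f \<in> Hom C a b" for a b f
    using that unfolding conj_def by simp
  have conj_i: "Comp C a (?G (F a)) (?G (F b)) (conj a b f) (i a) = Comp C a b (?G (F b)) (i b) f"
    if "a \<in> Obj C" "b \<in> Obj C" "f \<in> Hom C a b" for a b f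
    using that unfolding conj_def
    by (simp add: category_assoc[OF C, symmetric] ji category_unit[OF C])
  have j_conj: "Comp C (?G (F a)) (?G (F b)) b (j b) (conj a b f) = Comp C (?G (F a)) a b f (j a)"
    if "a \<in> Obj C" "b \<in> Obj C" "f \<in> Hom C a b" for a b f
    using that unfolding conj_def
    by (simp add: category_assoc[OF C] ji category_unit[OF C])
  have conj_comp: "conj a c (Comp C a b c g f) = Comp C (?G (F a)) (?G (F b)) (?G (F c)) (conj b c g) (conj a b f)"
    if "a \<in> Obj C" "b \<in> Obj C" "c \<in> Obj C" "f \<in> Hom C a b" "g \<in> Hom C b c" for a b c f g
  proof -
    have "Comp C (?G (F a)) (?G (F b)) (?G (F c)) (conj b c g) (conj a b f)
        = Comp C (?G (F a)) b (?G (F c)) (Comp C b c (?G (F c)) (i c) g)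
           (Comp C (?G (F a)) (?G (F b)) b (j b) (conj a b f))"
      using that by (subst (1) conj_def) (simp add: category_assoc[OF C])
    also have "\<dots> = conj a c (Comp C a b c g f)"
      using that by (simp add: j_conj) (simp add: conj_def category_assoc[OF C])
    finally show ?thesis by simp
  qed
  have conj_iden: "conj a a (Iden C a) = Iden C (?G (F a))" if "a \<in> Obj C" for a
    using that by (simp add: conj_def category_unit[OF C] ij)
  define FF where "FF = \<lparr>fobj = F, fmap = (\<lambda>a b f. lift (F a) (F b) (conj a b f))\<rparr>"
  have FF: "is_functor C D FF"
    unfolding is_functor_def FF_def
  proof (simp, intro conjI ballI)
    fix a assume a: "a \<in> Obj C"
    show "lift (F a) (F a) (conj a a (Iden C a)) = Iden D (F a)"
      using a by (intro faithful[of "F a" "F a"]) (simp_all add: conj_iden functor_iden[OF G])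
  next
    fix a b c f g assume [simp]: "a \<in> Obj C" "b \<in> Obj C" "c \<in> Obj C" "f \<in> Hom C a b" "g \<in> Hom C b c"
    show "lift (F a) (F c) (conj a c (Comp C a b c g f)) =
       Comp D (F a) (F b) (F c) (lift (F b) (F c) (conj b c g)) (lift (F a) (F b) (conj a b f))"
      by (intro faithful[of "F a" "F c"]) (simp_all add: conj_comp functor_comp[OF G])
  qed
  have "nat_isomorphic C C id_functor (comp_functor G FF)"
    unfolding nat_isomorphic_def
  proof (intro bexI[of _ "restrict i (Obj C)"] ballI)
    show "restrict i (Obj C) \<in> nat_trans C C id_functor (comp_functor G FF)"
      unfolding nat_trans_def id_functor_def comp_functor_def FF_def by (simp add: conj_i)
    fix a assume "a \<in> Obj C"
    then show "is_iso C (fobj id_functor a) (fobj (comp_functor G FF) a) (restrict i (Obj C) a)"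
      unfolding is_iso_def id_functor_def comp_functor_def FF_def by (auto simp: ij ji intro!: bexI[of _ "j a"])
  qed
  moreover have "nat_isomorphic D D (comp_functor FF G) id_functor"
    unfolding nat_isomorphic_def
  proof (intro bexI[of _ "\<lambda>x\<in>Obj D. lift (F (?G x)) x (j (?G x))"] ballI)
    show "(\<lambda>x\<in>Obj D. lift (F (?G x)) x (j (?G x))) \<in> nat_trans D D (comp_functor FF G) id_functor"
      unfolding nat_trans_def id_functor_def comp_functor_def FF_def
    proof (simp, intro ballI)
      fix a b f assume [simp]: "a \<in> Obj D" "b \<in> Obj D" "f \<in> Hom D a b"
      show "Comp D (F (?G a)) (F (?G b)) b (lift (F (?G b)) b (j (?G b)))
            (lift (F (?G a)) (F (?G b)) (conj (?G a) (?G b) (fmap G a b f))) =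
           Comp D (F (?G a)) a b f (lift (F (?G a)) a (j (?G a)))"
        by (intro faithful[of "F (?G a)" b]) (simp_all add: functor_comp[OF G] j_conj)
    qed
    fix a assume [simp]: "a \<in> Obj D"
    show "is_iso D (fobj (comp_functor FF G) a) (fobj id_functor a) ((\<lambda>x\<in>Obj D. lift (F (?G x)) x (j (?G x))) a)"
      unfolding is_iso_def id_functor_def comp_functor_def FF_def
    proof (simp, intro bexI[of _ "lift a (F (?G a)) (i (?G a))"] conjI)
      show "Comp D (F (?G a)) a (F (?G a)) (lift a (F (?G a)) (i (?G a))) (lift (F (?G a)) a (j (?G a))) = Iden D (F (?G a))"
        by (intro faithful[of "F (?G a)" "F (?G a)"]) (simp_all add: functor_comp[OF G] functor_iden[OF G] ij)
      show "Comp D a (F (?G a)) a (lift (F (?G a)) a (j (?G a))) (lift a (F (?G a)) (i (?G a))) = Iden D a"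
        by (intro faithful[of a a]) (simp_all add: functor_comp[OF G] functor_iden[OF G] ji)
    qed simp
  qed
  ultimately show ?thesis
    unfolding equivalent_categories_def using C D FF G by blast
qed

lemma set_cat_simps[simp]:
  "Obj (set_cat U) = {A. small U A}" "Hom (set_cat U) A B = (A \<rightarrow>\<^sub>E B)"
  "Iden (set_cat U) A = (\<lambda>x\<in>A. x)" "Comp (set_cat U) A B D g f = compose A g f"
  by (simp_all add: set_cat_def)

lemma category_set_cat: "category (set_cat U)"
  unfolding category_def
  by (simp add: compose_def fun_eq_iff PiE_iff extensional_def)

lemma thin_cat_simps[simp]:
  "Obj (thin_cat A R) = A" "Hom (thin_cat A R) i j = (if R i j then {()} else {})"
  "Iden (thin_cat A R) i = ()" "Comp (thin_cat A R) i j k g f = ()"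
  by (simp_all add: thin_cat_def)

lemma category_thin_cat:
  assumes "\<And>i. i \<in> A \<Longrightarrow> R i i"
    and "\<And>i j k. R i j \<Longrightarrow> R j k \<Longrightarrow> R i k"
  shows "category (thin_cat A R)"
  unfolding category_def by (auto simp: assms intro: assms(2) split: if_splits)

text \<open>
  Only the diagram and the legs at the indices \<open>Inl i\<close> are prescribed, so that this also applies to
  the image of a power cone under a functor, which differs from a power cone in the legs outside
  the shape.
\<close>

lemma is_limit_cone_powerI:
  fixes K :: "('i + 'j, unit, 'o, 'm) cone"
  assumes C: "category C" and x: "x \<in> Obj C" and p: "apex K \<in> Obj C"
    and shape: "shape K = thin_cat (Inl ` I) (=)"
    and diagram: "diagram K = \<lparr>fobj = (\<lambda>_. x), fmap = (\<lambda>_ _ _. Iden C x)\<rparr>"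
    and leg: "\<And>i. i \<in> I \<Longrightarrow> leg K (Inl i) \<in> Hom C (apex K) x"
    and univ: "\<And>a g. a \<in> Obj C \<Longrightarrow> (\<And>i. i \<in> I \<Longrightarrow> g i \<in> Hom C a x) \<Longrightarrow>
      \<exists>!u. u \<in> Hom C a (apex K) \<and> (\<forall>i\<in>I. Comp C a (apex K) x (leg K (Inl i)) u = g i)"
  shows "is_limit_cone C K"
proof -
  have fct: "is_functor (shape K) C (diagram K)"
    unfolding is_functor_def shape diagram using C x
    by (auto simp: category_idenI category_unit)
  have "is_cone C K"
    unfolding is_cone_def using fct p
    by (auto simp: shape category_thin_cat diagram leg C x category_unit[OF C p x])
  moreover have "\<exists>!u. u \<in> Hom C (apex K') (apex K) \<and>
           (\<forall>j\<in>Obj (shape K).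
              Comp C (apex K') (apex K) (fobj (diagram K) j) (leg K j) u = leg K' j)"
    if "is_cone C K'" "shape K' = shape K" "diagram K' = diagram K" for K'
    using univ[of "apex K'" "\<lambda>i. leg K' (Inl i)"] that
    unfolding is_cone_def by (simp add: shape diagram)
  ultimately show ?thesis unfolding is_limit_cone_def by blast
qed

lemma is_limit_cone_powerD:
  fixes K :: "('i + 'j, unit, 'o, 'm) cone"
  assumes C: "category C" and x: "x \<in> Obj C" and lim: "is_limit_cone C K"
    and shape: "shape K = thin_cat (Inl ` I) (=)"
    and diagram: "diagram K = \<lparr>fobj = (\<lambda>_. x), fmap = (\<lambda>_ _ _. Iden C x)\<rparr>"
    and a: "a \<in> Obj C" and g: "\<And>i. i \<in> I \<Longrightarrow> g i \<in> Hom C a x"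
  shows "\<exists>!u. u \<in> Hom C a (apex K) \<and> (\<forall>i\<in>I. Comp C a (apex K) x (leg K (Inl i)) u = g i)"
proof -
  define K' :: "('i + 'j, unit, 'o, 'm) cone" where
    "K' = \<lparr>shape = shape K, diagram = diagram K, apex = a, leg = case_sum g (\<lambda>_. undefined)\<rparr>"
  have "is_cone C K'"
    using lim unfolding is_limit_cone_def is_cone_def K'_def
    by (auto simp: shape diagram a g category_unit[OF C a x])
  then have "\<exists>!u. u \<in> Hom C (apex K') (apex K) \<and>
           (\<forall>j\<in>Obj (shape K).
              Comp C (apex K') (apex K) (fobj (diagram K) j) (leg K j) u = leg K' j)"
    using lim[unfolded is_limit_cone_def, THEN conjunct2, rule_format, of K']
    by (simp add: K'_def)
  then show ?thesis by (simp add: shape diagram K'_def)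
qed

text \<open>
  Maps out of a one-point set are elements, and conversely the universal property for
  elements can be applied pointwise.
\<close>

lemma is_limit_cone_set_power_iff:
  fixes K :: "('i + 'j, unit, 'v set, 'v \<Rightarrow> 'v) cone" and U :: "'u itself"
  assumes point: "small U {undefined :: 'v}" and X: "small U X" and P: "small U (apex K)"
    and shape: "shape K = thin_cat (Inl ` I) (=)"
    and diagram: "diagram K = \<lparr>fobj = (\<lambda>_. X), fmap = (\<lambda>_ _ _. Iden (set_cat U) X)\<rparr>"
    and leg: "\<And>i. i \<in> I \<Longrightarrow> leg K (Inl i) \<in> apex K \<rightarrow>\<^sub>E X"
  shows "is_limit_cone (set_cat U) K \<longleftrightarrow>
    (\<forall>g. (\<forall>i\<in>I. g i \<in> X) \<longrightarrow> (\<exists>!z. z \<in> apex K \<and> (\<forall>i\<in>I. leg K (Inl i) z = g i)))"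
proof (intro iffI allI impI)
  fix g assume lim: "is_limit_cone (set_cat U) K" and g: "\<forall>i\<in>I. g i \<in> X"
  let ?c = "\<lambda>y. \<lambda>_\<in>{undefined :: 'v}. y"
  have "\<exists>!u. u \<in> {undefined} \<rightarrow>\<^sub>E apex K \<and>
      (\<forall>i\<in>I. compose {undefined} (leg K (Inl i)) u = ?c (g i))"
    using is_limit_cone_powerD[OF category_set_cat _ lim shape diagram, of "{undefined}" "\<lambda>i. ?c (g i)"]
      g X point by auto
  then obtain u where u: "u \<in> {undefined} \<rightarrow>\<^sub>E apex K"
      "\<forall>i\<in>I. compose {undefined} (leg K (Inl i)) u = ?c (g i)"
    and uniq: "\<And>u'. u' \<in> {undefined} \<rightarrow>\<^sub>E apex K \<Longrightarrow>
      \<forall>i\<in>I. compose {undefined} (leg K (Inl i)) u' = ?c (g i) \<Longrightarrow> u' = u"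
    by (elim ex1E conjE) blast
  show "\<exists>!z. z \<in> apex K \<and> (\<forall>i\<in>I. leg K (Inl i) z = g i)"
  proof (intro ex1I[of _ "u undefined"] conjI ballI)
    show "u undefined \<in> apex K" using u(1) by auto
    fix i assume "i \<in> I"
    then have "compose {undefined} (leg K (Inl i)) u undefined = ?c (g i) undefined"
      using u(2) by simp
    then show "leg K (Inl i) (u undefined) = g i" by (simp add: compose_def)
  next
    fix z assume z: "z \<in> apex K \<and> (\<forall>i\<in>I. leg K (Inl i) z = g i)"
    then have "?c z = u"
      by (intro uniq) (auto simp: compose_def fun_eq_iff)
    then show "z = u undefined" by auto
  qed
next
  assume univ: "\<forall>g. (\<forall>i\<in>I. g i \<in> X) \<longrightarrow> (\<exists>!z. z \<in> apex K \<and> (\<forall>i\<in>I. leg K (Inl i) z = g i))"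
  show "is_limit_cone (set_cat U) K"
  proof (rule is_limit_cone_powerI[OF category_set_cat _ _ shape diagram])
    fix A g assume g: "\<And>i. i \<in> I \<Longrightarrow> g i \<in> Hom (set_cat U) A X"
    have "\<exists>z. \<forall>y\<in>A. z y \<in> apex K \<and> (\<forall>i\<in>I. leg K (Inl i) (z y) = g i y)"
    proof (rule bchoice, rule ballI)
      fix y assume "y \<in> A"
      then have "\<forall>i\<in>I. g i y \<in> X" using g by auto
      then show "\<exists>z. z \<in> apex K \<and> (\<forall>i\<in>I. leg K (Inl i) z = g i y)"
        using univ[rule_format, of "\<lambda>i. g i y"] by blast
    qed
    then obtain z where z: "\<And>y. y \<in> A \<Longrightarrow> z y \<in> apex K"
      "\<And>y i. y \<in> A \<Longrightarrow> i \<in> I \<Longrightarrow> leg K (Inl i) (z y) = g i y" by blast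
    show "\<exists>!u. u \<in> Hom (set_cat U) A (apex K) \<and>
        (\<forall>i\<in>I. Comp (set_cat U) A (apex K) X (leg K (Inl i)) u = g i)"
    proof (intro ex1I[of _ "restrict z A"])
      show "restrict z A \<in> Hom (set_cat U) A (apex K) \<and>
        (\<forall>i\<in>I. Comp (set_cat U) A (apex K) X (leg K (Inl i)) (restrict z A) = g i)"
        using z g by (auto simp: compose_def fun_eq_iff PiE_iff extensional_def)
      fix u assume u: "u \<in> Hom (set_cat U) A (apex K) \<and>
        (\<forall>i\<in>I. Comp (set_cat U) A (apex K) X (leg K (Inl i)) u = g i)"
      have "u y = z y" if y: "y \<in> A" for y
      proof -
        have "leg K (Inl i) (u y) = g i y" if "i \<in> I" for i
          using u that y by (metis set_cat_simps(4) compose_eq)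
        moreover have "u y \<in> apex K" using u y by auto
        moreover have "\<forall>i\<in>I. g i y \<in> X" using g y by auto
        ultimately show ?thesis
          using univ[rule_format, of "\<lambda>i. g i y"] z y by (metis (mono_tags, lifting))
      qed
      then show "u = restrict z A"
        using u by (intro extensionalityI[of _ A]) (auto simp: PiE_iff)
    qed
  qed (use X P leg in auto)
qed

definition is_mono :: "('o, 'm) cat \<Rightarrow> 'o \<Rightarrow> 'o \<Rightarrow> 'm \<Rightarrow> bool" where
  "is_mono C a b f \<longleftrightarrow> (\<forall>c\<in>Obj C. \<forall>u\<in>Hom C c a. \<forall>v\<in>Hom C c a.
     Comp C c a b f u = Comp C c a b f v \<longrightarrow> u = v)"

text \<open>
  The diagram is prescribed only on the arrows of the shape: the image of a monomorphism cone
  under a functor takes other values elsewhere.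
\<close>

lemma is_limit_cone_mono_iff:
  fixes K :: "('i + cospan, unit, 'o, 'm) cone"
  assumes C: "category C" and a: "a \<in> Obj C" and b: "b \<in> Obj C" and f: "f \<in> Hom C a b"
    and shape: "shape K = thin_cat (range Inr) (\<lambda>i j. i = j \<or> j = Inr Vertex)"
    and fobj: "fobj (diagram K) = (\<lambda>i. if i = Inr Vertex then b else a)"
    and fmap: "\<And>i j s. i = j \<or> j = Inr Vertex \<Longrightarrow> fmap (diagram K) i j s =
      (if i \<noteq> j then f else if i = Inr Vertex then Iden C b else Iden C a)"
    and apex: "apex K = a"
    and leg: "\<And>i. leg K (Inr i) = (if i = Vertex then f else Iden C a)"
  shows "is_limit_cone C K \<longleftrightarrow> is_mono C a b f"
proof
  have cospan: "(\<forall>i. Q i) \<longleftrightarrow> Q LeftEnd \<and> Q RightEnd \<and> Q Vertex" for Q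
    by (metis cospan.exhaust)
  note units = category_idenI[OF C] category_unit[OF C a b f] category_unit[OF C a a]
    category_unit[OF C b b]
  have fct: "is_functor (shape K) C (diagram K)"
    unfolding is_functor_def shape
    by (simp add: fmap fobj cospan a b f units)
  have cat: "category (shape K)" unfolding shape by (rule category_thin_cat) auto
  have cone_iff: "is_cone C K' \<longleftrightarrow> apex K' \<in> Obj C \<and>
      leg K' (Inr LeftEnd) \<in> Hom C (apex K') a \<and> leg K' (Inr RightEnd) \<in> Hom C (apex K') a \<and>
      leg K' (Inr Vertex) = Comp C (apex K') a b f (leg K' (Inr LeftEnd)) \<and>
      leg K' (Inr Vertex) = Comp C (apex K') a b f (leg K' (Inr RightEnd))"
    if "shape K' = shape K" "diagram K' = diagram K" for K'
    unfolding is_cone_def using that fct cat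
    by (auto simp: shape fobj fmap cospan category_unit[OF C _ a] category_unit[OF C _ b]
        category_comp_in[OF C _ a b _ f])
  have factor: "(\<forall>j\<in>Obj (shape K).
        Comp C (apex K') (apex K) (fobj (diagram K) j) (leg K j) u = leg K' j) \<longleftrightarrow>
      leg K' (Inr LeftEnd) = u \<and> leg K' (Inr RightEnd) = u"
    if "is_cone C K'" "shape K' = shape K" "diagram K' = diagram K" "u \<in> Hom C (apex K') a" for K' u
    using that(1) that(4) unfolding cone_iff[OF that(2,3)]
    by (auto simp: shape fobj apex leg cospan category_unit[OF C _ a])
  {
    assume lim: "is_limit_cone C K"
    show "is_mono C a b f"
      unfolding is_mono_def
    proof (intro ballI impI)
      fix c u v assume c: "c \<in> Obj C" and u: "u \<in> Hom C c a" and v: "v \<in> Hom C c a"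
        and eq: "Comp C c a b f u = Comp C c a b f v"
      define K' :: "('i + cospan, unit, 'o, 'm) cone" where
        "K' = \<lparr>shape = shape K, diagram = diagram K, apex = c,
          leg = case_sum (\<lambda>_. undefined) (case_cospan u v (Comp C c a b f u))\<rparr>"
      have K': "shape K' = shape K" "diagram K' = diagram K" by (simp_all add: K'_def)
      have cone: "is_cone C K'"
        unfolding cone_iff[OF K'] by (simp add: K'_def c u v eq)
      then obtain w where "w \<in> Hom C (apex K') a" "\<forall>j\<in>Obj (shape K).
        Comp C (apex K') (apex K) (fobj (diagram K) j) (leg K j) w = leg K' j"
        using lim[unfolded is_limit_cone_def, THEN conjunct2, rule_format, of K'] K' apex by auto
      then have "leg K' (Inr LeftEnd) = w \<and> leg K' (Inr RightEnd) = w"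
        using factor[OF cone K'] by simp
      then show "u = v" by (simp add: K'_def)
    qed
  next
    assume mono: "is_mono C a b f"
    show "is_limit_cone C K"
      unfolding is_limit_cone_def
    proof (intro conjI allI impI)
      show "is_cone C K" unfolding cone_iff[OF refl refl] by (simp add: leg apex a f units)
      fix K' assume K': "is_cone C K' \<and> shape K' = shape K \<and> diagram K' = diagram K"
      then have K'_shape: "shape K' = shape K" "diagram K' = diagram K" and cone: "is_cone C K'" by auto
      note K'_cone = cone[unfolded cone_iff[OF K'_shape]]
      then have "leg K' (Inr LeftEnd) = leg K' (Inr RightEnd)"
        using mono unfolding is_mono_def by auto
      then show "\<exists>!u. u \<in> Hom C (apex K') (apex K) \<and> (\<forall>j\<in>Obj (shape K).
        Comp C (apex K') (apex K) (fobj (diagram K) j) (leg K j) u = leg K' j)"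
        using factor[OF cone K'_shape] K'_cone apex by (intro ex1I[of _ "leg K' (Inr LeftEnd)"]) auto
    qed
  }
qed

lemma is_mono_set_cat_iff:
  assumes point: "small U {undefined :: 'v}" and f: "f \<in> A \<rightarrow>\<^sub>E B"
  shows "is_mono (set_cat U) A B (f :: 'v \<Rightarrow> 'v) \<longleftrightarrow> inj_on f A"
proof
  assume mono: "is_mono (set_cat U) A B f"
  show "inj_on f A"
  proof (rule inj_onI)
    fix x y assume xy: "x \<in> A" "y \<in> A" "f x = f y"
    have "compose {undefined} f (\<lambda>_\<in>{undefined :: 'v}. x) = compose {undefined} f (\<lambda>_\<in>{undefined}. y)"
      by (simp add: compose_def xy fun_eq_iff)
    then have "(\<lambda>_\<in>{undefined :: 'v}. x) = (\<lambda>_\<in>{undefined}. y)"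
      using mono[unfolded is_mono_def, rule_format, of "{undefined}" "\<lambda>_\<in>{undefined}. x" "\<lambda>_\<in>{undefined}. y"]
        xy point by auto
    then show "x = y" by (metis restrict_apply' singletonI)
  qed
next
  assume inj: "inj_on f A"
  show "is_mono (set_cat U) A B f"
    unfolding is_mono_def
  proof (intro ballI impI)
    fix D u v assume uv: "u \<in> Hom (set_cat U) D A" "v \<in> Hom (set_cat U) D A"
      and eq: "Comp (set_cat U) D A B f u = Comp (set_cat U) D A B f v"
    have "u y = v y" if "y \<in> D" for y
    proof -
      have "f (u y) = f (v y)"
        using eq that by (metis set_cat_simps(4) compose_eq)
      then show ?thesis using inj uv that by (auto dest: inj_onD)
    qed
    then show "u = v" using uv by (auto intro: PiE_ext)
  qed
qed

section \<open>The frame of open sets of a space\<close>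

lemma complete_lattice_sup_eqI:
  assumes "complete_lattice L" "A \<subseteq> carrier L" "s \<in> carrier L"
    and "\<And>x. x \<in> A \<Longrightarrow> x \<sqsubseteq>\<^bsub>L\<^esub> s"
    and "\<And>y. y \<in> carrier L \<Longrightarrow> (\<And>x. x \<in> A \<Longrightarrow> x \<sqsubseteq>\<^bsub>L\<^esub> y) \<Longrightarrow> s \<sqsubseteq>\<^bsub>L\<^esub> y"
  shows "\<Squnion>\<^bsub>L\<^esub> A = s"
proof -
  interpret complete_lattice L by fact
  show ?thesis
    by (intro le_antisym sup_least sup_closed assms(2-5) sup_upper)
qed

lemma complete_lattice_inf_eqI:
  assumes "complete_lattice L" "A \<subseteq> carrier L" "s \<in> carrier L"
    and "\<And>x. x \<in> A \<Longrightarrow> s \<sqsubseteq>\<^bsub>L\<^esub> x"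
    and "\<And>y. y \<in> carrier L \<Longrightarrow> (\<And>x. x \<in> A \<Longrightarrow> y \<sqsubseteq>\<^bsub>L\<^esub> x) \<Longrightarrow> y \<sqsubseteq>\<^bsub>L\<^esub> s"
  shows "\<Sqinter>\<^bsub>L\<^esub> A = s"
proof -
  interpret complete_lattice L by fact
  show ?thesis
    by (intro le_antisym inf_greatest inf_closed assms(2-5) inf_lower)
qed

lemma complete_lattice_inf_empty:
  assumes "complete_lattice L"
  shows "\<Sqinter>\<^bsub>L\<^esub> {} = \<top>\<^bsub>L\<^esub>"
proof -
  interpret complete_lattice L by fact
  show ?thesis by (rule complete_lattice_inf_eqI[OF assms]) auto
qed

lemma complete_lattice_sup_empty:
  assumes "complete_lattice L"
  shows "\<Squnion>\<^bsub>L\<^esub> {} = \<bottom>\<^bsub>L\<^esub>"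
proof -
  interpret complete_lattice L by fact
  show ?thesis by (rule complete_lattice_sup_eqI[OF assms]) auto
qed


definition opens :: "'a topology \<Rightarrow> 'a set set" where
  "opens X = {U. openin X U}"

lemma mem_opens[simp]: "U \<in> opens X \<longleftrightarrow> openin X U"
  by (simp add: opens_def)

lemma opens_discrete_topology: "opens (discrete_topology S) = Pow S"
  by (auto simp: opens_def)

text \<open>
  The opens of a space, copied into the universe. For a discrete space this is a power set
  algebra, so both the free frames and the free CABAs arise in this way.
\<close>

definition open_alg :: "'a topology \<Rightarrow> 'u gorder" where
  "open_alg X = \<lparr>carrier = code (opens X) ` opens X, eq = (=),
     le = (\<lambda>x y. decode (opens X) x \<subseteq> decode (opens X) y)\<rparr>"

abbreviation enc :: "'a topology \<Rightarrow> 'a set \<Rightarrow> 'u" where "enc X \<equiv> code (opens X)"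
abbreviation dec :: "'a topology \<Rightarrow> 'u \<Rightarrow> 'a set" where "dec X \<equiv> decode (opens X)"

definition preimage_hom :: "'a topology \<Rightarrow> 'b topology \<Rightarrow> ('a \<Rightarrow> 'b) \<Rightarrow> 'u \<Rightarrow> 'u" where
  "preimage_hom X Y f = (\<lambda>y\<in>carrier (open_alg Y). enc X {x \<in> topspace X. f x \<in> dec Y y})"

lemma carrier_open_alg: "carrier (open_alg X) = enc X ` opens X"
  by (simp add: open_alg_def)

lemma openin_dec: "x \<in> carrier (open_alg X) \<Longrightarrow> openin X (dec X x)"
  using decode_in[of x "opens X"] by (simp add: carrier_open_alg)

lemma enc_dec: "x \<in> carrier (open_alg X) \<Longrightarrow> enc X (dec X x) = x"
  unfolding carrier_open_alg by (rule code_decode)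

lemma enc_carrier: "openin X U \<Longrightarrow> enc X U \<in> carrier (open_alg X)"
  by (simp add: carrier_open_alg)

lemma le_open_alg: "x \<sqsubseteq>\<^bsub>open_alg X\<^esub> y \<longleftrightarrow> dec X x \<subseteq> dec X y"
  by (simp add: open_alg_def)

context
  fixes X :: "'a topology" and L :: "'u gorder"
  assumes small: "small TYPE('u) (opens X)"
  defines "L \<equiv> open_alg X"
begin

lemma dec_enc: "openin X U \<Longrightarrow> dec X (enc X U :: 'u) = U"
  using decode_code[OF small, of U] by simp

lemma partial_order_open_alg: "partial_order L"
proof
  show "(.=\<^bsub>L\<^esub>) = (=)" by (simp add: L_def open_alg_def)
  fix x y assume "x \<in> carrier L" "y \<in> carrier L" "x \<sqsubseteq>\<^bsub>L\<^esub> y" "y \<sqsubseteq>\<^bsub>L\<^esub> x"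
  then have "x = y" unfolding L_def le_open_alg by (metis enc_dec subset_antisym)
  then show "x .=\<^bsub>L\<^esub> y" by (simp add: L_def open_alg_def)
qed (auto simp: L_def open_alg_def)

text \<open>
  Joins are unions, and a meet is the interior of an intersection.
\<close>

lemma complete_lattice_open_alg: "complete_lattice L"
proof -
  interpret partial_order L by (rule partial_order_open_alg)
  show ?thesis
  proof
    fix A assume A: "A \<subseteq> carrier L"
    have op: "openin X (dec X x)" if "x \<in> A" for x
      using A that by (intro openin_dec) (auto simp: L_def)
    then have "openin X (\<Union>(dec X ` A))" by (intro openin_Union) auto
    then have "least L (enc X (\<Union>(dec X ` A))) (Upper L A)"
      unfolding least_def Upper_def using A
      by (auto simp: L_def le_open_alg dec_enc intro: enc_carrier)
    then show "\<exists>s. least L s (Upper L A)" by blast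
    let ?I = "X interior_of (topspace X \<inter> \<Inter>(dec X ` A))"
    have "?I \<subseteq> dec X x" if "x \<in> A" for x
      by (rule order_trans[OF interior_of_subset]) (use that in auto)
    moreover have "dec X y \<subseteq> ?I" if "y \<in> Lower L A" for y
    proof (rule interior_of_maximal)
      show op: "openin X (dec X y)" using that by (simp add: L_def openin_dec Lower_def)
      show "dec X y \<subseteq> topspace X \<inter> \<Inter>(dec X ` A)"
        using that A openin_subset[OF op] by (auto simp: L_def le_open_alg Lower_def)
    qed
    ultimately have "greatest L (enc X ?I) (Lower L A)"
      unfolding greatest_def using A
      by (auto simp: L_def le_open_alg dec_enc Lower_def intro: enc_carrier)
    then show "\<exists>i. greatest L i (Lower L A)" by blast
  qed
qed

interpretation complete_lattice L by (rule complete_lattice_open_alg)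

lemma sup_open_alg: "A \<subseteq> carrier L \<Longrightarrow> \<Squnion>\<^bsub>L\<^esub> A = enc X (\<Union>(dec X ` A))"
proof -
  assume A: "A \<subseteq> carrier L"
  have "openin X (\<Union>(dec X ` A))"
    using A by (intro openin_Union) (auto simp: L_def openin_dec)
  then show ?thesis
    using A by (intro complete_lattice_sup_eqI complete_lattice_open_alg)
      (auto simp: L_def le_open_alg dec_enc intro!: enc_carrier)
qed

lemma inf_open_alg:
  assumes A: "A \<subseteq> carrier L" and op: "openin X (topspace X \<inter> \<Inter>(dec X ` A))"
  shows "\<Sqinter>\<^bsub>L\<^esub> A = enc X (topspace X \<inter> \<Inter>(dec X ` A))"
proof (rule complete_lattice_inf_eqI[OF complete_lattice_open_alg A])
  fix y assume "y \<in> carrier L" "\<And>x. x \<in> A \<Longrightarrow> y \<sqsubseteq>\<^bsub>L\<^esub> x"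
  then show "y \<sqsubseteq>\<^bsub>L\<^esub> enc X (topspace X \<inter> \<Inter>(dec X ` A))"
    using op openin_dec[of y X] openin_subset[of X "dec X y"] by (auto simp: L_def le_open_alg dec_enc)
qed (use op in \<open>auto simp: L_def le_open_alg dec_enc intro: enc_carrier\<close>)

lemma meet_open_alg: "x \<in> carrier L \<Longrightarrow> y \<in> carrier L \<Longrightarrow> x \<sqinter>\<^bsub>L\<^esub> y = enc X (dec X x \<inter> dec X y)"
proof -
  assume xy: "x \<in> carrier L" "y \<in> carrier L"
  then have op: "openin X (dec X x)" "openin X (dec X y)" by (auto simp: L_def openin_dec)
  then have "topspace X \<inter> \<Inter>(dec X ` {x, y}) = dec X x \<inter> dec X y"
    using openin_subset by fastforce
  then show ?thesis
    unfolding meet_def using xy op inf_open_alg[of "{x, y}"] by auto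
qed

lemma top_open_alg: "\<top>\<^bsub>L\<^esub> = enc X (topspace X)"
  using inf_open_alg[of "{}"] complete_lattice_inf_empty[OF complete_lattice_open_alg] by simp

lemma is_frame_open_alg: "is_frame L"
  unfolding is_frame_def
proof (intro conjI ballI allI impI complete_lattice_open_alg)
  fix x A assume x: "x \<in> carrier L" and A: "A \<subseteq> carrier L"
  have op: "openin X (dec X y)" if "y \<in> insert x A" for y
    using A x that by (intro openin_dec) (auto simp: L_def)
  have 1: "openin X (\<Union>(dec X ` A))" using op by (intro openin_Union) auto
  have mA: "(\<lambda>y. x \<sqinter>\<^bsub>L\<^esub> y) ` A \<subseteq> carrier L"
    using x A by auto
  have "dec X (x \<sqinter>\<^bsub>L\<^esub> y) = dec X x \<inter> dec X y" if "y \<in> A" for y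
    using that A x op by (simp add: meet_open_alg dec_enc subset_iff openin_Int)
  then have "\<Union>(dec X ` (\<lambda>y. x \<sqinter>\<^bsub>L\<^esub> y) ` A) = dec X x \<inter> \<Union>(dec X ` A)"
    by auto
  then show "x \<sqinter>\<^bsub>L\<^esub> \<Squnion>\<^bsub>L\<^esub> A = \<Squnion>\<^bsub>L\<^esub> ((\<lambda>y. x \<sqinter>\<^bsub>L\<^esub> y) ` A)"
    using x A 1 sup_closed[OF A] by (simp add: sup_open_alg[OF mA] meet_open_alg) (simp add: sup_open_alg dec_enc)
qed

end

lemma is_caba_open_alg:
  fixes S :: "'a set"
  assumes small: "small TYPE('u) (Pow S)"
  shows "is_caba (open_alg (discrete_topology S) :: 'u gorder)"
proof -
  let ?X = "discrete_topology S"
  let ?L = "open_alg ?X :: 'u gorder"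
  have sm: "small TYPE('u) (opens ?X)" using small by (simp add: opens_discrete_topology)
  interpret complete_lattice ?L by (rule complete_lattice_open_alg[OF sm])
  note de = dec_enc[OF sm]
  have meet: "x \<sqinter>\<^bsub>?L\<^esub> y = enc ?X (dec ?X x \<inter> dec ?X y)"
    if "x \<in> carrier ?L" "y \<in> carrier ?L" for x y
    using that by (rule meet_open_alg[OF sm])
  have join: "x \<squnion>\<^bsub>?L\<^esub> y = enc ?X (dec ?X x \<union> dec ?X y)"
    if "x \<in> carrier ?L" "y \<in> carrier ?L" for x y
    unfolding join_def using that by (subst sup_open_alg[OF sm]) auto
  have sub: "dec ?X x \<subseteq> S" if "x \<in> carrier ?L" for x
    using openin_dec[OF that] by simp
  have ec: "enc ?X T \<in> carrier ?L" if "T \<subseteq> S" for T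
    using that by (intro enc_carrier) simp
  have bot: "\<bottom>\<^bsub>?L\<^esub> = enc ?X {}"
    using sup_open_alg[OF sm, of "{}"] complete_lattice_sup_empty[OF complete_lattice_axioms] by simp
  have top: "\<top>\<^bsub>?L\<^esub> = enc ?X S"
    using top_open_alg[OF sm] by simp
  have dec_meet: "dec ?X (x \<sqinter>\<^bsub>?L\<^esub> y) = dec ?X x \<inter> dec ?X y"
    if "x \<in> carrier ?L" "y \<in> carrier ?L" for x y
    using that sub[of x] sub[of y] by (simp add: meet de le_infI1)
  have dec_join: "dec ?X (x \<squnion>\<^bsub>?L\<^esub> y) = dec ?X x \<union> dec ?X y"
    if "x \<in> carrier ?L" "y \<in> carrier ?L" for x y
    using that sub[of x] sub[of y] by (simp add: join de)
  have eqI: "x = y" if "x \<in> carrier ?L" "y \<in> carrier ?L" "dec ?X x = dec ?X y" for x y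
    using that by (metis enc_dec)
  show ?thesis
    unfolding is_caba_def
  proof (intro conjI ballI impI complete_lattice_axioms)
    fix x y z assume xyz: "x \<in> carrier ?L" "y \<in> carrier ?L" "z \<in> carrier ?L"
    then show "x \<sqinter>\<^bsub>?L\<^esub> (y \<squnion>\<^bsub>?L\<^esub> z) = (x \<sqinter>\<^bsub>?L\<^esub> y) \<squnion>\<^bsub>?L\<^esub> (x \<sqinter>\<^bsub>?L\<^esub> z)"
      by (intro eqI) (auto simp: dec_meet dec_join)
  next
    fix x assume x: "x \<in> carrier ?L"
    show "\<exists>y\<in>carrier ?L. x \<sqinter>\<^bsub>?L\<^esub> y = \<bottom>\<^bsub>?L\<^esub> \<and> x \<squnion>\<^bsub>?L\<^esub> y = \<top>\<^bsub>?L\<^esub>"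
      using sub[OF x] x by (intro bexI[of _ "enc ?X (S - dec ?X x)"])
        (auto simp: meet join de bot top ec Un_absorb1)
    assume nb: "x \<noteq> \<bottom>\<^bsub>?L\<^esub>"
    have "dec ?X x \<noteq> {}" using nb bot enc_dec[OF x] by auto
    then obtain p where p: "p \<in> dec ?X x" by blast
    then have pS: "{p} \<subseteq> S" using sub[OF x] by blast
    have "is_atom ?L (enc ?X {p})"
      unfolding is_atom_def
    proof (intro conjI ballI impI)
      show "enc ?X {p} \<in> carrier ?L" using pS by (rule ec)
      show "enc ?X {p} \<noteq> \<bottom>\<^bsub>?L\<^esub>"
        unfolding bot using pS de[of "{p}"] de[of "{}"] by auto
      fix y assume y: "y \<in> carrier ?L" "y \<sqsubseteq>\<^bsub>?L\<^esub> enc ?X {p}"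
      then have "dec ?X y \<subseteq> {p}" using pS de[of "{p}"] by (simp add: le_open_alg)
      then show "y = \<bottom>\<^bsub>?L\<^esub> \<or> y = enc ?X {p}"
        unfolding bot using enc_dec[OF y(1)] by (metis subset_singletonD)
    qed
    moreover have "enc ?X {p} \<sqsubseteq>\<^bsub>?L\<^esub> x"
      using p pS de[of "{p}"] by (simp add: le_open_alg)
    ultimately show "\<exists>a. is_atom ?L a \<and> a \<sqsubseteq>\<^bsub>?L\<^esub> x" by blast
  qed
qed

context
  fixes X :: "'a topology" and Y :: "'b topology" and f :: "'a \<Rightarrow> 'b"
  assumes smallX: "small TYPE('u) (opens X)" and smallY: "small TYPE('u) (opens Y)"
    and cont: "continuous_map X Y f"
begin

lemma dec_preimage_hom:
  "y \<in> carrier (open_alg Y) \<Longrightarrow> dec X (preimage_hom X Y f y :: 'u) = {x \<in> topspace X. f x \<in> dec Y y}"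
  unfolding preimage_hom_def
  by (simp add: dec_enc[OF smallX] openin_continuous_map_preimage[OF cont] openin_dec)

lemma preimage_hom_carrier:
  "(preimage_hom X Y f :: 'u \<Rightarrow> 'u) \<in> carrier (open_alg Y) \<rightarrow>\<^sub>E carrier (open_alg X)"
  unfolding preimage_hom_def
  by (auto intro!: enc_carrier openin_continuous_map_preimage[OF cont] openin_dec)

lemma preimage_hom_sup:
  "sup_pres (open_alg Y :: 'u gorder) (open_alg X) (preimage_hom X Y f)"
  unfolding sup_pres_def
proof (intro conjI allI impI complete_lattice_open_alg smallX smallY)
  fix A assume A: "A \<subseteq> carrier (open_alg Y :: 'u gorder)"
  have im: "preimage_hom X Y f ` A \<subseteq> carrier (open_alg X)"
    using A PiE_mem[OF preimage_hom_carrier] by auto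
  have op: "openin Y (\<Union>(dec Y ` A))" using A by (intro openin_Union) (auto simp: openin_dec)
  have "\<Union>(dec X ` preimage_hom X Y f ` A) = {x \<in> topspace X. f x \<in> \<Union>(dec Y ` A)}"
  proof -
    have "dec X (preimage_hom X Y f y) = {x \<in> topspace X. f x \<in> dec Y y}" if "y \<in> A" for y
      using that A by (intro dec_preimage_hom) auto
    then show ?thesis by auto
  qed
  then show "preimage_hom X Y f (\<Squnion>\<^bsub>open_alg Y\<^esub> A) = \<Squnion>\<^bsub>open_alg X\<^esub> (preimage_hom X Y f ` A)"
    unfolding sup_open_alg[OF smallX im] sup_open_alg[OF smallY A]
    using op by (simp add: preimage_hom_def enc_carrier dec_enc[OF smallY])
qed

lemma preimage_hom_frame: "preimage_hom X Y f \<in> frame_homs (open_alg Y :: 'u gorder) (open_alg X)"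
proof -
  have "preimage_hom X Y f (x \<sqinter>\<^bsub>open_alg Y\<^esub> y) = preimage_hom X Y f x \<sqinter>\<^bsub>open_alg X\<^esub> preimage_hom X Y f y"
    if xy: "x \<in> carrier (open_alg Y :: 'u gorder)" "y \<in> carrier (open_alg Y)" for x y
  proof -
    have im: "preimage_hom X Y f x \<in> carrier (open_alg X)" "preimage_hom X Y f y \<in> carrier (open_alg X)"
      using xy by (auto intro: PiE_mem[OF preimage_hom_carrier])
    have op: "openin Y (dec Y x \<inter> dec Y y)" using xy by (intro openin_Int openin_dec)
    have "{a \<in> topspace X. f a \<in> dec Y x \<inter> dec Y y} =
        dec X (preimage_hom X Y f x) \<inter> dec X (preimage_hom X Y f y)"
      using xy by (auto simp: dec_preimage_hom)
    then show ?thesis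
      unfolding meet_open_alg[OF smallX im] meet_open_alg[OF smallY xy] using op
      by (simp add: preimage_hom_def enc_carrier dec_enc[OF smallY])
  qed
  moreover have "preimage_hom X Y f \<top>\<^bsub>open_alg Y\<^esub> = \<top>\<^bsub>open_alg X :: 'u gorder\<^esub>"
  proof -
    have "{x \<in> topspace X. f x \<in> topspace Y} = topspace X"
      using continuous_map_image_subset_topspace[OF cont] by blast
    then show ?thesis
      unfolding top_open_alg[OF smallX] top_open_alg[OF smallY]
      by (simp add: preimage_hom_def enc_carrier dec_enc[OF smallY])
  qed
  ultimately show ?thesis
    unfolding frame_homs_def meet_pres_def
    using complete_lattice_lattice[OF complete_lattice_open_alg[OF smallX]]
      complete_lattice_lattice[OF complete_lattice_open_alg[OF smallY]]
    by (simp add: preimage_hom_sup preimage_hom_carrier)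
qed

end

lemma preimage_hom_caba:
  fixes S :: "'a set" and T :: "'b set"
  assumes S: "small TYPE('u) (Pow S)" and T: "small TYPE('u) (Pow T)" and f: "f \<in> S \<rightarrow> T"
  shows "preimage_hom (discrete_topology S) (discrete_topology T) f
    \<in> caba_homs (open_alg (discrete_topology T) :: 'u gorder) (open_alg (discrete_topology S))"
proof -
  let ?X = "discrete_topology S" and ?Y = "discrete_topology T"
  let ?h = "preimage_hom ?X ?Y f :: 'u \<Rightarrow> 'u"
  have sm: "small TYPE('u) (opens ?X)" "small TYPE('u) (opens ?Y)" using S T by (simp_all add: opens_discrete_topology)
  have cont: "continuous_map ?X ?Y f" using f by auto
  have "?h (\<Sqinter>\<^bsub>open_alg ?Y\<^esub> A) = \<Sqinter>\<^bsub>open_alg ?X\<^esub> (?h ` A)" if A: "A \<subseteq> carrier (open_alg ?Y)" for A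
  proof -
    have im: "?h ` A \<subseteq> carrier (open_alg ?X)"
      using A PiE_mem[OF preimage_hom_carrier[OF sm cont]] by auto
    have *: "?h (enc ?Y U) = enc ?X {x \<in> S. f x \<in> U}" if "U \<subseteq> T" for U
      using that by (simp add: preimage_hom_def enc_carrier dec_enc[OF sm(2)])
    have "dec ?X (?h y) = {x \<in> S. f x \<in> dec ?Y y}" if "y \<in> A" for y
      using that A by (subst dec_preimage_hom[OF sm cont]) auto
    then have "{x \<in> S. f x \<in> T \<inter> \<Inter>(dec ?Y ` A)} = S \<inter> \<Inter>(dec ?X ` ?h ` A)"
      using f by auto
    then show ?thesis
      by (subst inf_open_alg[OF sm(1) im], force, subst inf_open_alg[OF sm(2) A], force)
        (simp add: *)
  qed
  then show ?thesis
    unfolding caba_homs_def inf_pres_def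
    using preimage_hom_carrier[OF sm cont] preimage_hom_sup[OF sm cont]
      complete_lattice_open_alg[OF sm(1)] complete_lattice_open_alg[OF sm(2)] by blast
qed

section \<open>Powers of the Sierpinski space\<close>

text \<open>
  The points of the \<open>I\<close>-th power of the Sierpinski space are the subsets of \<open>I\<close>. A set of
  points is open if each of its members has a finite subset that already forces membership;
  this is also the Scott topology of the power set.
\<close>

definition sierp :: "'a set \<Rightarrow> 'a set topology" where
  "sierp I = topology (\<lambda>U. U \<subseteq> Pow I \<and>
     (\<forall>s\<in>U. \<exists>F\<subseteq>s. finite F \<and> (\<forall>t. F \<subseteq> t \<and> t \<subseteq> I \<longrightarrow> t \<in> U)))"

lemma openin_sierp: "openin (sierp I) U \<longleftrightarrow> U \<subseteq> Pow I \<and>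
     (\<forall>s\<in>U. \<exists>F\<subseteq>s. finite F \<and> (\<forall>t. F \<subseteq> t \<and> t \<subseteq> I \<longrightarrow> t \<in> U))"
proof -
  let ?P = "\<lambda>U. U \<subseteq> Pow I \<and> (\<forall>s\<in>U. \<exists>F\<subseteq>s. finite F \<and> (\<forall>t. F \<subseteq> t \<and> t \<subseteq> I \<longrightarrow> t \<in> U))"
  have "istopology ?P"
    unfolding istopology_def
  proof (intro conjI allI impI)
    fix S T assume S: "?P S" and T: "?P T"
    show "S \<inter> T \<subseteq> Pow I" using S by blast
    show "\<forall>s\<in>S \<inter> T. \<exists>F\<subseteq>s. finite F \<and> (\<forall>t. F \<subseteq> t \<and> t \<subseteq> I \<longrightarrow> t \<in> S \<inter> T)"
    proof
      fix s assume "s \<in> S \<inter> T"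
      then obtain F G where "F \<subseteq> s" "finite F" "\<forall>t. F \<subseteq> t \<and> t \<subseteq> I \<longrightarrow> t \<in> S"
        and "G \<subseteq> s" "finite G" "\<forall>t. G \<subseteq> t \<and> t \<subseteq> I \<longrightarrow> t \<in> T"
        using S T by (metis IntE)
      then show "\<exists>F\<subseteq>s. finite F \<and> (\<forall>t. F \<subseteq> t \<and> t \<subseteq> I \<longrightarrow> t \<in> S \<inter> T)"
        by (intro exI[of _ "F \<union> G"]) auto
    qed
  next
    fix \<K> assume K: "\<forall>S\<in>\<K>. ?P S"
    then show "\<Union>\<K> \<subseteq> Pow I" by blast
    show "\<forall>s\<in>\<Union>\<K>. \<exists>F\<subseteq>s. finite F \<and> (\<forall>t. F \<subseteq> t \<and> t \<subseteq> I \<longrightarrow> t \<in> \<Union>\<K>)"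
      using K by (meson UnionE UnionI)
  qed
  then show ?thesis by (simp add: sierp_def)
qed

abbreviation containing :: "'a set \<Rightarrow> 'a \<Rightarrow> 'a set set" where
  "containing I i \<equiv> {s. s \<subseteq> I \<and> i \<in> s}"

lemma openin_containing: "openin (sierp I) (containing I i)"
  unfolding openin_sierp by (auto intro!: exI[of _ "{i}"])

lemma topspace_sierp[simp]: "topspace (sierp I) = Pow I"
proof
  show "topspace (sierp I) \<subseteq> Pow I"
    using openin_topspace[of "sierp I"] unfolding openin_sierp by blast
  have "openin (sierp I) (Pow I)" unfolding openin_sierp by auto
  then show "Pow I \<subseteq> topspace (sierp I)" by (rule openin_subset)
qed

text \<open>
  Every open set is a union of finite intersections of the sets \<open>containing I i\<close>; this is the normal
  form of an element of a free frame.
\<close>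

lemma openin_sierp_basic:
  assumes "openin (sierp I) U"
  shows "U = \<Union>{{s. s \<subseteq> I \<and> F \<subseteq> s} |F. finite F \<and> F \<in> U}"
proof (rule equalityI; rule subsetI)
  fix s assume s: "s \<in> U"
  then obtain F where F: "F \<subseteq> s" "finite F" "\<forall>t. F \<subseteq> t \<and> t \<subseteq> I \<longrightarrow> t \<in> U"
    using assms unfolding openin_sierp by blast
  moreover have sI: "s \<subseteq> I" using s assms unfolding openin_sierp by blast
  moreover have "F \<in> U" using F sI by blast
  ultimately show "s \<in> \<Union>{{s. s \<subseteq> I \<and> F \<subseteq> s} |F. finite F \<and> F \<in> U}" by blast
next
  fix s assume "s \<in> \<Union>{{s. s \<subseteq> I \<and> F \<subseteq> s} |F. finite F \<and> F \<in> U}"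
  then obtain F where F: "finite F" "F \<in> U" "s \<subseteq> I" "F \<subseteq> s" by blast
  then obtain G where "G \<subseteq> F" "\<forall>t. G \<subseteq> t \<and> t \<subseteq> I \<longrightarrow> t \<in> U"
    using assms unfolding openin_sierp by blast
  then show "s \<in> U" using F by blast
qed

lemma openin_sierp_upward:
  "openin (sierp I) U \<Longrightarrow> s \<in> U \<Longrightarrow> s \<subseteq> t \<Longrightarrow> t \<subseteq> I \<Longrightarrow> t \<in> U"
  unfolding openin_sierp by (meson order_trans)

text \<open>
  The space is the power of the Sierpinski space, so a map into it is a family of open sets.
\<close>

lemma continuous_map_sierp:
  "continuous_map X (sierp I) f \<longleftrightarrow>
    f \<in> topspace X \<rightarrow> Pow I \<and> (\<forall>i\<in>I. openin X {x \<in> topspace X. i \<in> f x})"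
proof (intro iffI conjI ballI)
  assume f: "continuous_map X (sierp I) f"
  then show fP: "f \<in> topspace X \<rightarrow> Pow I" by (simp add: continuous_map_def)
  fix i assume "i \<in> I"
  have "{x \<in> topspace X. f x \<in> containing I i} = {x \<in> topspace X. i \<in> f x}"
    using fP by auto
  then show "openin X {x \<in> topspace X. i \<in> f x}"
    using openin_continuous_map_preimage[OF f openin_containing[of I i]] by simp
next
  assume f: "f \<in> topspace X \<rightarrow> Pow I \<and> (\<forall>i\<in>I. openin X {x \<in> topspace X. i \<in> f x})"
  have fin: "openin X {x \<in> topspace X. F \<subseteq> f x}" if "finite F" "F \<subseteq> I" for F
    using that
  proof induction
    case (insert i F)
    have "{x \<in> topspace X. insert i F \<subseteq> f x} = {x \<in> topspace X. i \<in> f x} \<inter> {x \<in> topspace X. F \<subseteq> f x}"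
      by auto
    then show ?case using insert f by (simp add: openin_Int)
  qed simp
  show "continuous_map X (sierp I) f"
    unfolding continuous_map_def
  proof (intro conjI allI impI)
    show "f \<in> topspace X \<rightarrow> topspace (sierp I)" using f by simp
    fix U assume U: "openin (sierp I) U"
    have sub: "U \<subseteq> Pow I" using openin_subset[OF U] by simp
    have "{x \<in> topspace X. f x \<in> U} = (\<Union>F\<in>{F \<in> U. finite F}. {x \<in> topspace X. F \<subseteq> f x})"
      (is "?A = ?B")
    proof
      show "?A \<subseteq> ?B" using openin_sierp_basic[OF U] by blast
      show "?B \<subseteq> ?A" using openin_sierp_upward[OF U] f by blast
    qed
    also have "openin X \<dots>"
      using sub by (intro openin_Union) (auto intro: fin)
    finally show "openin X {x \<in> topspace X. f x \<in> U}" .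
  qed
qed

section \<open>Free frames\<close>

lemma small_opens_sierp:
  fixes I :: "'a set"
  assumes "set_universe TYPE('u)" "small TYPE('u) I"
  shows "small TYPE('u) (opens (sierp I))"
proof (rule small_subset)
  show "opens (sierp I) \<subseteq> Pow (Pow I)" by (intro subsetI) (simp add: openin_sierp)
  show "small TYPE('u) (Pow (Pow I))" using assms by (intro small_Pow)
qed

abbreviation gen_in :: "('a set \<Rightarrow> 'a set topology) \<Rightarrow> 'a set \<Rightarrow> 'a \<Rightarrow> 'u" where
  "gen_in Sp I i \<equiv> enc (Sp I) (containing I i)"

context
  fixes I :: "'u set"
  assumes universe: "set_universe TYPE('u)" and I: "small TYPE('u) I"
begin

text \<open>
  Two homomorphisms that agree on the generators agree on finite meets of
  generators, hence on joins of those, and these are all open sets.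
\<close>

lemma frame_hom_from_sierp_unique:
  fixes L :: "'u gorder"
  assumes h: "h \<in> frame_homs (open_alg (sierp I)) L" and h': "h' \<in> frame_homs (open_alg (sierp I)) L"
    and eq: "\<And>i. i \<in> I \<Longrightarrow> h (gen_in sierp I i) = h' (gen_in sierp I i)"
  shows "h = h'"
proof -
  let ?A = "open_alg (sierp I) :: 'u gorder"
  let ?e = "enc (sierp I) :: _ \<Rightarrow> 'u"
  note sm = small_opens_sierp[OF universe I]
  note de = dec_enc[OF sm]
  have fin: "h (?e {s. s \<subseteq> I \<and> F \<subseteq> s}) = h' (?e {s. s \<subseteq> I \<and> F \<subseteq> s})
      \<and> openin (sierp I) {s. s \<subseteq> I \<and> F \<subseteq> s}" if "finite F" "F \<subseteq> I" for F
    using that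
  proof induction
    case empty
    have "{s. s \<subseteq> I \<and> {} \<subseteq> s} = topspace (sierp I)" by auto
    moreover have "openin (sierp I) (topspace (sierp I))" by (rule openin_topspace)
    moreover have "\<top>\<^bsub>?A\<^esub> = ?e (topspace (sierp I))" by (rule top_open_alg[OF sm])
    ultimately show ?case using h h' unfolding frame_homs_def by (metis (mono_tags, lifting) mem_Collect_eq)
  next
    case (insert i F)
    let ?F = "{s. s \<subseteq> I \<and> F \<subseteq> s}"
    have i: "i \<in> I" and F: "openin (sierp I) ?F" "h (?e ?F) = h' (?e ?F)" using insert by auto
    have eqs: "{s. s \<subseteq> I \<and> insert i F \<subseteq> s} = containing I i \<inter> ?F" by auto
    have "?e (containing I i \<inter> ?F) = ?e (containing I i) \<sqinter>\<^bsub>?A\<^esub> ?e ?F"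
      using F openin_containing[of I i] by (simp add: meet_open_alg[OF sm] enc_carrier de)
    moreover have meet: "k (?e (containing I i) \<sqinter>\<^bsub>?A\<^esub> ?e ?F) = k (?e (containing I i)) \<sqinter>\<^bsub>L\<^esub> k (?e ?F)"
      if "k \<in> frame_homs ?A L" for k
      using that F openin_containing[of I i] unfolding frame_homs_def meet_pres_def by (simp add: enc_carrier)
    ultimately show ?case
      unfolding eqs using meet[OF h] meet[OF h'] F eq[OF i] openin_containing[of I i]
      by (simp add: openin_Int)
  qed
  have "h x = h' x" if x: "x \<in> carrier ?A" for x
  proof -
    let ?U = "dec (sierp I) x"
    have U: "openin (sierp I) ?U" using x by (rule openin_dec)
    then have sub: "?U \<subseteq> Pow I" using openin_subset by fastforce
    define B where "B = (\<lambda>F. ?e {s. s \<subseteq> I \<and> F \<subseteq> s}) ` {F \<in> ?U. finite F}"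
    have B: "B \<subseteq> carrier ?A"
      using sub fin unfolding B_def by (auto intro!: enc_carrier)
    have "\<Union>(dec (sierp I) ` B) = \<Union>{{s. s \<subseteq> I \<and> F \<subseteq> s} |F. finite F \<and> F \<in> ?U}"
    proof -
      have "dec (sierp I) (?e {s. s \<subseteq> I \<and> F \<subseteq> s}) = {s. s \<subseteq> I \<and> F \<subseteq> s}"
        if "F \<in> {F \<in> ?U. finite F}" for F
        using fin[of F] that sub by (intro de) auto
      then show ?thesis unfolding B_def by auto
    qed
    then have "\<Squnion>\<^bsub>?A\<^esub> B = x"
      using openin_sierp_basic[OF U] enc_dec[OF x] by (simp add: sup_open_alg[OF sm B])
    moreover have "h ` B = h' ` B"
      unfolding B_def using fin sub by (auto simp: image_image intro!: image_cong)
    ultimately show ?thesis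
      using h h' B unfolding frame_homs_def sup_pres_def by auto
  qed
  moreover have "h \<in> carrier ?A \<rightarrow>\<^sub>E carrier L" "h' \<in> carrier ?A \<rightarrow>\<^sub>E carrier L"
    using h h' by (simp_all add: frame_homs_def)
  ultimately show ?thesis by (metis PiE_ext)
qed

text \<open>
  An open set \<open>U\<close> is the join of the finite meets of generators indexed by the finite members \<open>F\<close>
  of \<open>U\<close>, so it has to be sent to the join of the elements \<open>m F = \<Sqinter> (g ` F)\<close>. This map preserves joins because
  \<open>F\<close> lies in a union only if it lies in one of its members. It preserves binary meets because of
  frame distributivity: \<open>m F \<sqinter> m G\<close> lies below \<open>m (F \<union> G)\<close>, and \<open>F \<union> G\<close> is a member of both
  open sets since they are upward closed.
\<close>

lemma frame_hom_from_sierp_exists: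
  fixes L :: "'u gorder"
  assumes L: "is_frame L" and g: "g \<in> I \<rightarrow> carrier L"
  shows "\<exists>h\<in>frame_homs (open_alg (sierp I)) L. \<forall>i\<in>I. h (gen_in sierp I i) = g i"
proof -
  let ?A = "open_alg (sierp I) :: 'u gorder"
  let ?d = "dec (sierp I) :: 'u \<Rightarrow> _"
  note sm = small_opens_sierp[OF universe I]
  note de = dec_enc[OF sm]
  interpret complete_lattice L using L by (simp add: is_frame_def)
  interpret A: complete_lattice ?A by (rule complete_lattice_open_alg[OF sm])
  have distrib: "a \<sqinter>\<^bsub>L\<^esub> \<Squnion>\<^bsub>L\<^esub> S = \<Squnion>\<^bsub>L\<^esub> ((\<lambda>s. a \<sqinter>\<^bsub>L\<^esub> s) ` S)" if "a \<in> carrier L" "S \<subseteq> carrier L" for a S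
    using L that by (simp add: is_frame_def)
  define m where "m F = \<Sqinter>\<^bsub>L\<^esub> (g ` F)" for F
  have gF: "g ` F \<subseteq> carrier L" if "F \<subseteq> I" for F using g that by auto
  have m: "m F \<in> carrier L" if "F \<subseteq> I" for F
    unfolding m_def using gF[OF that] by (rule inf_closed)
  have m_le: "m F \<sqsubseteq>\<^bsub>L\<^esub> g i" if "F \<subseteq> I" "i \<in> F" for F i
    unfolding m_def using gF[OF that(1)] that by (intro inf_lower) auto
  have m_Un: "m F \<sqinter>\<^bsub>L\<^esub> m G \<sqsubseteq>\<^bsub>L\<^esub> m (F \<union> G)" if FG: "F \<subseteq> I" "G \<subseteq> I" for F G
  proof -
    have mc: "m F \<sqinter>\<^bsub>L\<^esub> m G \<in> carrier L" using m FG by simp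
    have "m F \<sqinter>\<^bsub>L\<^esub> m G \<sqsubseteq>\<^bsub>L\<^esub> g i" if i: "i \<in> F \<union> G" for i
    proof -
      have gi: "g i \<in> carrier L" using g i FG by auto
      from i show ?thesis
      proof
        assume "i \<in> F"
        then show ?thesis using le_trans[OF meet_left m_le mc _ gi] m FG by auto
      next
        assume "i \<in> G"
        then show ?thesis using le_trans[OF meet_right m_le mc _ gi] m FG by auto
      qed
    qed
    then show ?thesis
      unfolding m_def[of "F \<union> G"] using gF[of "F \<union> G"] FG mc by (intro inf_greatest) auto
  qed
  define S where "S U = m ` {F \<in> U. finite F}" for U
  have S: "S U \<subseteq> carrier L" if "U \<subseteq> Pow I" for U
    unfolding S_def using m that by auto
  define h where "h = (\<lambda>x\<in>carrier ?A. \<Squnion>\<^bsub>L\<^esub> S (?d x))"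
  have d: "?d x \<subseteq> Pow I" if "x \<in> carrier ?A" for x
    using openin_subset[OF openin_dec[OF that]] by simp
  have h: "h x \<in> carrier L" if "x \<in> carrier ?A" for x
    using that S[OF d] by (simp add: h_def)
  have le_h: "m F \<sqsubseteq>\<^bsub>L\<^esub> h x" if "x \<in> carrier ?A" "F \<in> ?d x" "finite F" for x F
    using that S[OF d] unfolding h_def by (simp, intro sup_upper) (auto simp: S_def)
  have h_le: "h x \<sqsubseteq>\<^bsub>L\<^esub> z" if "x \<in> carrier ?A" "z \<in> carrier L"
    "\<And>F. F \<in> ?d x \<Longrightarrow> finite F \<Longrightarrow> m F \<sqsubseteq>\<^bsub>L\<^esub> z" for x z
    using that S[OF d] unfolding h_def by (simp, intro sup_least) (auto simp: S_def)
  have mono: "h x \<sqsubseteq>\<^bsub>L\<^esub> h y" if "x \<in> carrier ?A" "y \<in> carrier ?A" "?d x \<subseteq> ?d y" for x y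
    using that by (intro h_le h le_h) auto
  have "sup_pres ?A L h"
    unfolding sup_pres_def
  proof (intro conjI allI impI complete_lattice_axioms A.complete_lattice_axioms)
    fix A assume A: "A \<subseteq> carrier ?A"
    have sup: "\<Squnion>\<^bsub>?A\<^esub> A \<in> carrier ?A" using A by simp
    have "openin (sierp I) (\<Union>(?d ` A))"
      using A by (intro openin_Union) (auto simp: openin_dec)
    then have d_sup: "?d (\<Squnion>\<^bsub>?A\<^esub> A) = \<Union>(?d ` A)"
      by (simp add: sup_open_alg[OF sm A] de)
    have hA: "h ` A \<subseteq> carrier L" using A h by auto
    show "h (\<Squnion>\<^bsub>?A\<^esub> A) = \<Squnion>\<^bsub>L\<^esub> (h ` A)"
    proof (rule le_antisym)
      show "h (\<Squnion>\<^bsub>?A\<^esub> A) \<sqsubseteq>\<^bsub>L\<^esub> \<Squnion>\<^bsub>L\<^esub> (h ` A)"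
      proof (rule h_le[OF sup])
        fix F assume F: "F \<in> ?d (\<Squnion>\<^bsub>?A\<^esub> A)" "finite F"
        then obtain x where x: "x \<in> A" "F \<in> ?d x" unfolding d_sup by blast
        then have xA: "x \<in> carrier ?A" and FI: "F \<subseteq> I" using A d by auto
        have "m F \<sqsubseteq>\<^bsub>L\<^esub> h x" using xA x F by (intro le_h)
        moreover have "h x \<sqsubseteq>\<^bsub>L\<^esub> \<Squnion>\<^bsub>L\<^esub> (h ` A)" using hA x by (intro sup_upper) auto
        ultimately show "m F \<sqsubseteq>\<^bsub>L\<^esub> \<Squnion>\<^bsub>L\<^esub> (h ` A)"
          using m[OF FI] h[OF xA] hA by (auto intro: le_trans)
      qed (use hA in simp)
      show "\<Squnion>\<^bsub>L\<^esub> (h ` A) \<sqsubseteq>\<^bsub>L\<^esub> h (\<Squnion>\<^bsub>?A\<^esub> A)"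
        using hA A h[OF sup] sup d_sup by (intro sup_least) (auto intro!: mono)
    qed (use hA h[OF sup] in simp_all)
  qed
  moreover have "h (x \<sqinter>\<^bsub>?A\<^esub> y) = h x \<sqinter>\<^bsub>L\<^esub> h y" if xy: "x \<in> carrier ?A" "y \<in> carrier ?A" for x y
  proof -
    have xyc: "x \<sqinter>\<^bsub>?A\<^esub> y \<in> carrier ?A" using xy by simp
    have "openin (sierp I) (?d x \<inter> ?d y)" using xy by (intro openin_Int openin_dec)
    then have dm: "?d (x \<sqinter>\<^bsub>?A\<^esub> y) = ?d x \<inter> ?d y"
      using xy by (simp add: meet_open_alg[OF sm] de)
    have up: "F \<union> G \<in> ?d x \<inter> ?d y" if "F \<in> ?d x" "G \<in> ?d y" for F G
      using that d[OF xy(1)] d[OF xy(2)]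
        openin_sierp_upward[OF openin_dec[OF xy(1)] that(1), of "F \<union> G"]
        openin_sierp_upward[OF openin_dec[OF xy(2)] that(2), of "F \<union> G"] by auto
    have Sx: "S (?d x) \<subseteq> carrier L" and Sy: "S (?d y) \<subseteq> carrier L" using S d xy by auto
    show ?thesis
    proof (rule le_antisym)
      show "h (x \<sqinter>\<^bsub>?A\<^esub> y) \<sqsubseteq>\<^bsub>L\<^esub> h x \<sqinter>\<^bsub>L\<^esub> h y"
        using h xy xyc mono dm by (intro meet_le) auto
      have "h x \<sqinter>\<^bsub>L\<^esub> h y = \<Squnion>\<^bsub>L\<^esub> ((\<lambda>s. h x \<sqinter>\<^bsub>L\<^esub> s) ` S (?d y))"
        using distrib[OF h[OF xy(1)] Sy] xy by (simp add: h_def)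
      also have "\<dots> \<sqsubseteq>\<^bsub>L\<^esub> h (x \<sqinter>\<^bsub>?A\<^esub> y)"
      proof (rule sup_least)
        show "(\<lambda>s. h x \<sqinter>\<^bsub>L\<^esub> s) ` S (?d y) \<subseteq> carrier L" using h xy Sy by auto
        fix z assume "z \<in> (\<lambda>s. h x \<sqinter>\<^bsub>L\<^esub> s) ` S (?d y)"
        then obtain G where G: "G \<in> ?d y" "finite G" and z: "z = h x \<sqinter>\<^bsub>L\<^esub> m G"
          unfolding S_def by blast
        have GI: "G \<subseteq> I" using G d xy by blast
        have "z = m G \<sqinter>\<^bsub>L\<^esub> h x" unfolding z by (rule meet_comm)
        also have "\<dots> = \<Squnion>\<^bsub>L\<^esub> ((\<lambda>s. m G \<sqinter>\<^bsub>L\<^esub> s) ` S (?d x))"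
          using distrib[OF m[OF GI] Sx] xy by (simp add: h_def)
        also have "\<dots> \<sqsubseteq>\<^bsub>L\<^esub> h (x \<sqinter>\<^bsub>?A\<^esub> y)"
        proof (rule sup_least)
          show "(\<lambda>s. m G \<sqinter>\<^bsub>L\<^esub> s) ` S (?d x) \<subseteq> carrier L" using m[OF GI] Sx by auto
          fix w assume "w \<in> (\<lambda>s. m G \<sqinter>\<^bsub>L\<^esub> s) ` S (?d x)"
          then obtain F where F: "F \<in> ?d x" "finite F" and w: "w = m G \<sqinter>\<^bsub>L\<^esub> m F"
            unfolding S_def by blast
          have FI: "F \<subseteq> I" using F d xy by blast
          have "w \<sqsubseteq>\<^bsub>L\<^esub> m (F \<union> G)"
            unfolding w using m_Un[OF GI FI] by (simp add: Un_commute)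
          moreover have "m (F \<union> G) \<sqsubseteq>\<^bsub>L\<^esub> h (x \<sqinter>\<^bsub>?A\<^esub> y)"
            using up[OF F(1) G(1)] F G xyc by (intro le_h) (auto simp: dm)
          ultimately show "w \<sqsubseteq>\<^bsub>L\<^esub> h (x \<sqinter>\<^bsub>?A\<^esub> y)"
            using m[OF FI] m[OF GI] m[of "F \<union> G"] FI GI h[OF xyc] by (auto intro: le_trans simp: w)
        qed (use h[OF xyc] in simp)
        finally show "z \<sqsubseteq>\<^bsub>L\<^esub> h (x \<sqinter>\<^bsub>?A\<^esub> y)" .
      qed (use h[OF xyc] in simp)
      finally show "h x \<sqinter>\<^bsub>L\<^esub> h y \<sqsubseteq>\<^bsub>L\<^esub> h (x \<sqinter>\<^bsub>?A\<^esub> y)" .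
    qed (use h xy xyc in auto)
  qed
  moreover have "h \<top>\<^bsub>?A\<^esub> = \<top>\<^bsub>L\<^esub>"
  proof -
    have "?d \<top>\<^bsub>?A\<^esub> = Pow I"
      using de[of "Pow I"] openin_topspace[of "sierp I"] by (simp add: top_open_alg[OF sm])
    then have "m {} \<sqsubseteq>\<^bsub>L\<^esub> h \<top>\<^bsub>?A\<^esub>" by (intro le_h) auto
    then have "\<top>\<^bsub>L\<^esub> \<sqsubseteq>\<^bsub>L\<^esub> h \<top>\<^bsub>?A\<^esub>"
      by (simp add: m_def complete_lattice_inf_empty[OF complete_lattice_axioms])
    then show ?thesis using h[of "\<top>\<^bsub>?A\<^esub>"] by (intro le_antisym) auto
  qed
  moreover have "h (gen_in sierp I i) = g i" if i: "i \<in> I" for i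
  proof -
    let ?x = "gen_in sierp I i"
    have x: "?x \<in> carrier ?A" by (intro enc_carrier openin_containing)
    have dx: "?d ?x = containing I i" by (intro de openin_containing)
    have gi: "g i \<in> carrier L" using g i by auto
    have "h ?x \<sqsubseteq>\<^bsub>L\<^esub> g i" using x gi by (intro h_le m_le) (auto simp: dx)
    moreover have "m {i} \<sqsubseteq>\<^bsub>L\<^esub> h ?x" using x i by (intro le_h) (auto simp: dx)
    then have "g i \<sqsubseteq>\<^bsub>L\<^esub> h ?x" using gi by (simp add: m_def)
    ultimately show ?thesis using h[OF x] gi by (intro le_antisym)
  qed
  moreover have "h \<in> carrier ?A \<rightarrow>\<^sub>E carrier L"
    using h unfolding h_def by auto
  ultimately show ?thesis
    unfolding frame_homs_def meet_pres_def using lattice_axioms A.lattice_axioms by blast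
qed

lemma free_frame: "is_free_on frm_cat I (open_alg (sierp I)) (gen_in sierp I)"
proof -
  note sm = small_opens_sierp[OF universe I]
  have "open_alg (sierp I) \<in> Obj (frm_cat :: ('u gorder, 'u \<Rightarrow> 'u) cat)"
    using is_frame_open_alg[OF sm] sm by (simp add: frm_cat_def carrier_open_alg small_image)
  moreover have "gen_in sierp I \<in> I \<rightarrow> carrier (open_alg (sierp I) :: 'u gorder)"
    by (auto intro: enc_carrier openin_containing)
  moreover have "\<exists>!h. h \<in> Hom frm_cat (open_alg (sierp I)) L \<and> (\<forall>i\<in>I. h (gen_in sierp I i) = g i)"
    if "L \<in> Obj frm_cat" "g \<in> I \<rightarrow> carrier L" for L :: "'u gorder" and g
    using frame_hom_from_sierp_exists[of L g] frame_hom_from_sierp_unique[of _ L] that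
    unfolding frm_cat_def by (auto intro!: ex_ex1I)
  ultimately show ?thesis unfolding is_free_on_def by blast
qed


end

section \<open>Free complete atomic boolean algebras\<close>

definition atoms_below :: "'a gorder \<Rightarrow> 'a \<Rightarrow> 'a set" where
  "atoms_below L x = {a. is_atom L a \<and> a \<sqsubseteq>\<^bsub>L\<^esub> x}"

context
  fixes L :: "'u gorder" and At :: "'u set"
  assumes L: "is_caba L"
  defines "At \<equiv> {a. is_atom L a}"
begin

interpretation complete_lattice L using L by (simp add: is_caba_def)

lemma atom_carrier: "At \<subseteq> carrier L" unfolding At_def is_atom_def by blast

lemma caba_complement:
  assumes "x \<in> carrier L"
  obtains y where "y \<in> carrier L" "x \<sqinter>\<^bsub>L\<^esub> y = \<bottom>\<^bsub>L\<^esub>" "x \<squnion>\<^bsub>L\<^esub> y = \<top>\<^bsub>L\<^esub>"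
  using L assms unfolding is_caba_def by blast

lemma le_if_meet_complement:
  assumes c: "x \<in> carrier L" "y \<in> carrier L" "z \<in> carrier L"
    and "y \<squnion>\<^bsub>L\<^esub> z = \<top>\<^bsub>L\<^esub>" "x \<sqinter>\<^bsub>L\<^esub> y = \<bottom>\<^bsub>L\<^esub>"
  shows "x \<sqsubseteq>\<^bsub>L\<^esub> z"
proof -
  have "x = x \<sqinter>\<^bsub>L\<^esub> (y \<squnion>\<^bsub>L\<^esub> z)"
    using le_iff_join[OF c(1) top_closed] top_higher[OF c(1)] assms(4) by simp
  also have "\<dots> = (x \<sqinter>\<^bsub>L\<^esub> y) \<squnion>\<^bsub>L\<^esub> (x \<sqinter>\<^bsub>L\<^esub> z)"
    using L c unfolding is_caba_def by blast
  also have "\<dots> \<sqsubseteq>\<^bsub>L\<^esub> z"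
    using assms by (intro join_le) (auto intro: meet_right)
  finally show ?thesis .
qed

text \<open>
  Atoms are completely join-prime: if \<open>a\<close> is below no member of \<open>S\<close>, then every member of \<open>S\<close>,
  hence its join, is below a complement of \<open>a\<close>.
\<close>

lemma atom_le_sup_iff:
  assumes a: "a \<in> At" and S: "S \<subseteq> carrier L"
  shows "a \<sqsubseteq>\<^bsub>L\<^esub> \<Squnion>\<^bsub>L\<^esub> S \<longleftrightarrow> (\<exists>s\<in>S. a \<sqsubseteq>\<^bsub>L\<^esub> s)"
proof
  assume le: "a \<sqsubseteq>\<^bsub>L\<^esub> \<Squnion>\<^bsub>L\<^esub> S"
  show "\<exists>s\<in>S. a \<sqsubseteq>\<^bsub>L\<^esub> s"
  proof (rule ccontr)
    assume no: "\<not> (\<exists>s\<in>S. a \<sqsubseteq>\<^bsub>L\<^esub> s)"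
    have ac: "a \<in> carrier L" using a atom_carrier by blast
    obtain b where b: "b \<in> carrier L" "a \<sqinter>\<^bsub>L\<^esub> b = \<bottom>\<^bsub>L\<^esub>" "a \<squnion>\<^bsub>L\<^esub> b = \<top>\<^bsub>L\<^esub>"
      using caba_complement[OF ac] .
    have "s \<sqsubseteq>\<^bsub>L\<^esub> b" if s: "s \<in> S" for s
    proof (rule le_if_meet_complement[of s a b])
      have sc: "s \<in> carrier L" using s S by blast
      have "a \<sqinter>\<^bsub>L\<^esub> s = \<bottom>\<^bsub>L\<^esub> \<or> a \<sqinter>\<^bsub>L\<^esub> s = a"
        using a ac sc meet_left[OF ac sc] meet_closed[OF ac sc] unfolding At_def is_atom_def by blast
      moreover have "a \<sqinter>\<^bsub>L\<^esub> s \<noteq> a" using no s meet_right[OF ac sc] by metis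
      ultimately show "s \<sqinter>\<^bsub>L\<^esub> a = \<bottom>\<^bsub>L\<^esub>" by (simp add: meet_comm)
    qed (use s S ac b in auto)
    then have "\<Squnion>\<^bsub>L\<^esub> S \<sqsubseteq>\<^bsub>L\<^esub> b" using S b by (intro sup_least)
    then have "a \<sqsubseteq>\<^bsub>L\<^esub> b" using le_trans[OF le _ ac _ b(1)] S by simp
    then have "a = \<bottom>\<^bsub>L\<^esub>" using b(1,2) ac by (metis le_iff_join)
    then show False using a by (simp add: At_def is_atom_def)
  qed
next
  assume "\<exists>s\<in>S. a \<sqsubseteq>\<^bsub>L\<^esub> s"
  then obtain s where s: "s \<in> S" "a \<sqsubseteq>\<^bsub>L\<^esub> s" by blast
  then show "a \<sqsubseteq>\<^bsub>L\<^esub> \<Squnion>\<^bsub>L\<^esub> S"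
    using le_trans[OF s(2) sup_upper[OF S s(1)]] S a atom_carrier sup_closed[OF S] by blast
qed

lemma atoms_below_Sup:
  "T \<subseteq> carrier L \<Longrightarrow> atoms_below L (\<Squnion>\<^bsub>L\<^esub> T) = (\<Union>t\<in>T. atoms_below L t)"
  using atom_le_sup_iff[of _ T] unfolding atoms_below_def At_def by blast

text \<open>
  If \<open>x\<close> were not below \<open>y\<close>, there would be an atom below the meet of \<open>x\<close> with a complement of \<open>y\<close>.
\<close>

lemma le_if_atoms_below:
  assumes c: "x \<in> carrier L" "y \<in> carrier L" and sub: "atoms_below L x \<subseteq> atoms_below L y"
  shows "x \<sqsubseteq>\<^bsub>L\<^esub> y"
proof -
  obtain z where z: "z \<in> carrier L" "y \<sqinter>\<^bsub>L\<^esub> z = \<bottom>\<^bsub>L\<^esub>" "y \<squnion>\<^bsub>L\<^esub> z = \<top>\<^bsub>L\<^esub>"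
    using caba_complement[OF c(2)] .
  have "x \<sqinter>\<^bsub>L\<^esub> z = \<bottom>\<^bsub>L\<^esub>"
  proof (rule ccontr)
    have xz: "x \<sqinter>\<^bsub>L\<^esub> z \<in> carrier L" using c z by simp
    assume "x \<sqinter>\<^bsub>L\<^esub> z \<noteq> \<bottom>\<^bsub>L\<^esub>"
    then obtain a where a: "is_atom L a" "a \<sqsubseteq>\<^bsub>L\<^esub> x \<sqinter>\<^bsub>L\<^esub> z"
      using L xz unfolding is_caba_def by blast
    have ac: "a \<in> carrier L" using a by (simp add: is_atom_def)
    have "a \<sqsubseteq>\<^bsub>L\<^esub> x" using le_trans[OF a(2) meet_left ac xz] c z by simp
    then have ay: "a \<sqsubseteq>\<^bsub>L\<^esub> y" using sub a unfolding atoms_below_def by blast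
    have "a \<sqsubseteq>\<^bsub>L\<^esub> z" using le_trans[OF a(2) meet_right ac xz] c z by simp
    then have "a \<sqsubseteq>\<^bsub>L\<^esub> y \<sqinter>\<^bsub>L\<^esub> z" using ay ac c z by (intro meet_le)
    then have "a \<sqsubseteq>\<^bsub>L\<^esub> \<bottom>\<^bsub>L\<^esub>" by (simp add: z)
    then show False using a ac unfolding is_atom_def by (metis bottom_closed bottom_lower le_antisym)
  qed
  then have "x \<sqinter>\<^bsub>L\<^esub> z = \<bottom>\<^bsub>L\<^esub>" .
  then show ?thesis
    using c z by (intro le_if_meet_complement[of x z y]) (auto simp: join_comm[of L z y])
qed

lemma atoms_below_sup:
  "T \<subseteq> At \<Longrightarrow> atoms_below L (\<Squnion>\<^bsub>L\<^esub> T) = T"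
proof -
  assume T: "T \<subseteq> At"
  have Tc: "T \<subseteq> carrier L" using T atom_carrier by blast
  have "a \<in> T" if a: "a \<in> At" "t \<in> T" "a \<sqsubseteq>\<^bsub>L\<^esub> t" for a t
  proof -
    have "is_atom L t" "is_atom L a" using a T unfolding At_def by auto
    then have "a = t" using a(3) unfolding is_atom_def by auto
    then show ?thesis using a by simp
  qed
  moreover have "t \<sqsubseteq>\<^bsub>L\<^esub> t" if "t \<in> T" for t using that Tc by auto
  ultimately show ?thesis
    using atom_le_sup_iff[OF _ Tc] T unfolding atoms_below_def At_def by blast
qed

lemma sup_atoms_below:
  "x \<in> carrier L \<Longrightarrow> \<Squnion>\<^bsub>L\<^esub> (atoms_below L x) = x"
proof -
  assume x: "x \<in> carrier L"
  have sub: "atoms_below L x \<subseteq> At" unfolding atoms_below_def At_def by blast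
  then have c: "atoms_below L x \<subseteq> carrier L" using atom_carrier by blast
  show ?thesis
    using atoms_below_sup[OF sub] x c by (intro le_antisym le_if_atoms_below) auto
qed

lemma atoms_below_inf:
  assumes S: "S \<subseteq> carrier L"
  shows "atoms_below L (\<Sqinter>\<^bsub>L\<^esub> S) = At \<inter> \<Inter>(atoms_below L ` S)"
proof -
  have "a \<sqsubseteq>\<^bsub>L\<^esub> \<Sqinter>\<^bsub>L\<^esub> S \<longleftrightarrow> (\<forall>s\<in>S. a \<sqsubseteq>\<^bsub>L\<^esub> s)" if a: "a \<in> At" for a
  proof
    have ac: "a \<in> carrier L" using a atom_carrier by blast
    show "\<forall>s\<in>S. a \<sqsubseteq>\<^bsub>L\<^esub> s" if "a \<sqsubseteq>\<^bsub>L\<^esub> \<Sqinter>\<^bsub>L\<^esub> S"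
      using that ac S by (auto intro!: le_trans[OF that inf_lower])
    show "a \<sqsubseteq>\<^bsub>L\<^esub> \<Sqinter>\<^bsub>L\<^esub> S" if "\<forall>s\<in>S. a \<sqsubseteq>\<^bsub>L\<^esub> s"
      using that ac S by (intro inf_greatest) auto
  qed
  then show ?thesis unfolding atoms_below_def At_def by auto
qed

text \<open>
  The half of the representation of a CABA by the power set of its atoms that is
  used for the free CABA; \<open>atoms_below\<close> is inverse to this map.
\<close>

lemma sup_caba_hom:
  assumes small: "small TYPE('u) (Pow At)"
  shows "(\<lambda>y\<in>carrier (open_alg (discrete_topology At)). \<Squnion>\<^bsub>L\<^esub> (dec (discrete_topology At) y))
    \<in> caba_homs (open_alg (discrete_topology At)) L"
proof -
  let ?X = "discrete_topology At"
  let ?A = "open_alg ?X :: 'u gorder"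
  let ?b = "\<lambda>y\<in>carrier ?A. \<Squnion>\<^bsub>L\<^esub> (dec ?X y)"
  have sm: "small TYPE('u) (opens ?X)" unfolding opens_discrete_topology by (rule small)
  interpret A: complete_lattice ?A by (rule complete_lattice_open_alg[OF sm])
  have d: "dec ?X y \<subseteq> At" if "y \<in> carrier ?A" for y using openin_dec[OF that] by simp
  have dc: "dec ?X y \<subseteq> carrier L" if "y \<in> carrier ?A" for y using d[OF that] atom_carrier by blast
  have b: "?b y \<in> carrier L" if "y \<in> carrier ?A" for y using dc[OF that] that by simp
  have ab: "atoms_below L (?b y) = dec ?X y" if "y \<in> carrier ?A" for y
    using atoms_below_sup[OF d[OF that]] that by simp
  have eqI: "x = y" if "x \<in> carrier L" "y \<in> carrier L" "atoms_below L x = atoms_below L y" for x y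
    using that by (intro le_antisym le_if_atoms_below) auto
  have "?b (\<Squnion>\<^bsub>?A\<^esub> S) = \<Squnion>\<^bsub>L\<^esub> (?b ` S)" if S: "S \<subseteq> carrier ?A" for S
  proof (rule eqI)
    have sc: "\<Squnion>\<^bsub>?A\<^esub> S \<in> carrier ?A" using S by simp
    have bS: "?b ` S \<subseteq> carrier L" using b S by blast
    show "?b (\<Squnion>\<^bsub>?A\<^esub> S) \<in> carrier L" by (rule b[OF sc])
    show "\<Squnion>\<^bsub>L\<^esub> (?b ` S) \<in> carrier L" using bS by (rule sup_closed)
    have "\<Union>(dec ?X ` S) \<subseteq> At" using S d by blast
    then have "atoms_below L (?b (\<Squnion>\<^bsub>?A\<^esub> S)) = \<Union>(dec ?X ` S)"
      unfolding ab[OF sc] by (simp add: sup_open_alg[OF sm S] dec_enc[OF sm])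
    also have "\<dots> = (\<Union>y\<in>S. atoms_below L (?b y))"
      using S ab by (intro arg_cong[of _ _ Union] image_cong) auto
    also have "\<dots> = atoms_below L (\<Squnion>\<^bsub>L\<^esub> (?b ` S))"
      by (simp only: atoms_below_Sup[OF bS] image_image)
    finally show "atoms_below L (?b (\<Squnion>\<^bsub>?A\<^esub> S)) = atoms_below L (\<Squnion>\<^bsub>L\<^esub> (?b ` S))" .
  qed
  moreover have "?b (\<Sqinter>\<^bsub>?A\<^esub> S) = \<Sqinter>\<^bsub>L\<^esub> (?b ` S)" if S: "S \<subseteq> carrier ?A" for S
  proof (rule eqI)
    have sc: "\<Sqinter>\<^bsub>?A\<^esub> S \<in> carrier ?A" using S by simp
    have bS: "?b ` S \<subseteq> carrier L" using b S by blast
    show "?b (\<Sqinter>\<^bsub>?A\<^esub> S) \<in> carrier L" by (rule b[OF sc])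
    show "\<Sqinter>\<^bsub>L\<^esub> (?b ` S) \<in> carrier L" using bS by (rule inf_closed)
    have "atoms_below L (?b (\<Sqinter>\<^bsub>?A\<^esub> S)) = At \<inter> \<Inter>(dec ?X ` S)"
      unfolding ab[OF sc] using inf_open_alg[OF sm S] by (simp add: dec_enc[OF sm])
    also have "\<dots> = At \<inter> (\<Inter>y\<in>S. atoms_below L (?b y))"
      using S ab by (intro arg_cong[of _ _ "\<lambda>x. At \<inter> \<Inter>x"] image_cong) auto
    also have "\<dots> = atoms_below L (\<Sqinter>\<^bsub>L\<^esub> (?b ` S))"
      by (simp only: atoms_below_inf[OF bS] image_image)
    finally show "atoms_below L (?b (\<Sqinter>\<^bsub>?A\<^esub> S)) = atoms_below L (\<Sqinter>\<^bsub>L\<^esub> (?b ` S))" .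
  qed
  moreover have "?b \<in> carrier ?A \<rightarrow>\<^sub>E carrier L" using b by auto
  ultimately show ?thesis
    unfolding caba_homs_def sup_pres_def inf_pres_def
    using complete_lattice_axioms A.complete_lattice_axioms by blast
qed

end

context
  fixes I :: "'u set"
  assumes universe: "set_universe TYPE('u)" and I: "small TYPE('u) I"
begin

text \<open>
  The sets on which two homomorphisms agree are closed under unions, intersections and complements. A
  singleton \<open>{s}\<close> is the intersection of the generators at the members of \<open>s\<close> with the complements of the
  generators at the other elements of \<open>I\<close>, and every set is a union of singletons.
\<close>

lemma caba_hom_from_powerset_unique:
  fixes L :: "'u gorder"
  defines "D \<equiv> \<lambda>I :: 'u set. discrete_topology (Pow I)"
  assumes L: "is_caba L"
    and h: "h \<in> caba_homs (open_alg (D I)) L" and h': "h' \<in> caba_homs (open_alg (D I)) L"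
    and eq: "\<And>i. i \<in> I \<Longrightarrow> h (gen_in D I i) = h' (gen_in D I i)"
  shows "h = h'"
proof -
  let ?A = "open_alg (D I) :: 'u gorder"
  let ?e = "enc (D I) :: _ \<Rightarrow> 'u"
  have opn[simp]: "openin (D I) T \<longleftrightarrow> T \<subseteq> Pow I" for T by (simp add: D_def)
  have tsp[simp]: "topspace (D I) = Pow I" by (simp add: D_def)
  have sm: "small TYPE('u) (opens (D I))"
    unfolding D_def opens_discrete_topology by (intro small_Pow universe I)
  note de = dec_enc[OF sm]
  interpret complete_lattice L using L by (simp add: is_caba_def)
  interpret A: complete_lattice ?A by (rule complete_lattice_open_alg[OF sm])
  have cA: "?e T \<in> carrier ?A" if "T \<subseteq> Pow I" for T using that by (intro enc_carrier) simp
  have sup: "k (?e (\<Union>\<T>)) = \<Squnion>\<^bsub>L\<^esub> ((\<lambda>T. k (?e T)) ` \<T>)"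
    if "k \<in> caba_homs ?A L" "\<T> \<subseteq> Pow (Pow I)" for k \<T>
  proof -
    have T: "?e ` \<T> \<subseteq> carrier ?A" using that(2) cA by auto
    have "dec (D I) ` ?e ` \<T> = \<T>"
    proof -
      have "dec (D I) (?e T) = T" if "T \<in> \<T>" for T
        using that \<open>\<T> \<subseteq> Pow (Pow I)\<close> by (intro de) auto
      then show ?thesis by (simp add: image_image cong: image_cong_simp)
    qed
    then have "\<Squnion>\<^bsub>?A\<^esub> (?e ` \<T>) = ?e (\<Union>\<T>)" by (simp add: sup_open_alg[OF sm T])
    moreover have "k (\<Squnion>\<^bsub>?A\<^esub> (?e ` \<T>)) = \<Squnion>\<^bsub>L\<^esub> (k ` ?e ` \<T>)"
      using that(1) T unfolding caba_homs_def sup_pres_def by blast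
    ultimately show ?thesis by (simp add: image_image)
  qed
  have inf: "k (?e (Pow I \<inter> \<Inter>\<T>)) = \<Sqinter>\<^bsub>L\<^esub> ((\<lambda>T. k (?e T)) ` \<T>)"
    if "k \<in> caba_homs ?A L" "\<T> \<subseteq> Pow (Pow I)" for k \<T>
  proof -
    have T: "?e ` \<T> \<subseteq> carrier ?A" using that(2) cA by auto
    have "dec (D I) ` ?e ` \<T> = \<T>"
    proof -
      have "dec (D I) (?e T) = T" if "T \<in> \<T>" for T
        using that \<open>\<T> \<subseteq> Pow (Pow I)\<close> by (intro de) auto
      then show ?thesis by (simp add: image_image cong: image_cong_simp)
    qed
    then have "\<Sqinter>\<^bsub>?A\<^esub> (?e ` \<T>) = ?e (Pow I \<inter> \<Inter>\<T>)"
      using inf_open_alg[OF sm T] by simp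
    moreover have "k (\<Sqinter>\<^bsub>?A\<^esub> (?e ` \<T>)) = \<Sqinter>\<^bsub>L\<^esub> (k ` ?e ` \<T>)"
      using that(1) T unfolding caba_homs_def inf_pres_def by blast
    ultimately show ?thesis by (simp add: image_image)
  qed
  have k_in: "k (?e T) \<in> carrier L" if "k \<in> caba_homs ?A L" "T \<subseteq> Pow I" for k T
  proof -
    have "k \<in> carrier ?A \<rightarrow>\<^sub>E carrier L" using that(1) by (simp add: caba_homs_def)
    then show ?thesis using cA[OF that(2)] by (rule PiE_mem)
  qed
  have compl: "k (?e T) \<sqinter>\<^bsub>L\<^esub> k (?e (Pow I - T)) = \<bottom>\<^bsub>L\<^esub> \<and> k (?e T) \<squnion>\<^bsub>L\<^esub> k (?e (Pow I - T)) = \<top>\<^bsub>L\<^esub>"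
    if k: "k \<in> caba_homs ?A L" and T: "T \<subseteq> Pow I" for k T
  proof
    have top: "k (?e (Pow I)) = \<top>\<^bsub>L\<^esub>"
      using inf[OF k, of "{}"] complete_lattice_inf_empty[OF complete_lattice_axioms] by simp
    have bot: "k (?e {}) = \<bottom>\<^bsub>L\<^esub>"
      using sup[OF k, of "{}"] complete_lattice_sup_empty[OF complete_lattice_axioms] by simp
    have pair: "{T, Pow I - T} \<subseteq> Pow (Pow I)" using T by simp
    have im: "(\<lambda>T. k (?e T)) ` {T, Pow I - T} = {k (?e T), k (?e (Pow I - T))}" by simp
    have Un: "\<Union>{T, Pow I - T} = Pow I" and In: "Pow I \<inter> \<Inter>{T, Pow I - T} = {}" using T by auto
    show "k (?e T) \<squnion>\<^bsub>L\<^esub> k (?e (Pow I - T)) = \<top>\<^bsub>L\<^esub>"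
      using sup[OF k pair] unfolding join_def Un im top by simp
    show "k (?e T) \<sqinter>\<^bsub>L\<^esub> k (?e (Pow I - T)) = \<bottom>\<^bsub>L\<^esub>"
      using inf[OF k pair] unfolding meet_def In im bot by simp
  qed
  have compl_unique: "z \<sqsubseteq>\<^bsub>L\<^esub> z'" if "x \<in> carrier L" "z \<in> carrier L" "z' \<in> carrier L"
    and "x \<sqinter>\<^bsub>L\<^esub> z = \<bottom>\<^bsub>L\<^esub>" "x \<squnion>\<^bsub>L\<^esub> z' = \<top>\<^bsub>L\<^esub>" for x z z'
    using that by (intro le_if_meet_complement[OF L, of z x z']) (simp_all add: meet_comm)
  let ?E = "\<lambda>T. T \<subseteq> Pow I \<and> h (?e T) = h' (?e T)"
  have E_compl: "?E (Pow I - T)" if T: "?E T" for T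
  proof
    have hT: "h (?e T) = h' (?e T)" and sub: "T \<subseteq> Pow I" "Pow I - T \<subseteq> Pow I" using T by auto
    note c = compl[OF h sub(1)] compl[OF h' sub(1), folded hT]
    show "h (?e (Pow I - T)) = h' (?e (Pow I - T))"
    proof (rule le_antisym)
      show "h (?e (Pow I - T)) \<sqsubseteq>\<^bsub>L\<^esub> h' (?e (Pow I - T))"
        using c by (intro compl_unique[OF k_in[OF h sub(1)] k_in[OF h sub(2)] k_in[OF h' sub(2)]]) simp_all
      show "h' (?e (Pow I - T)) \<sqsubseteq>\<^bsub>L\<^esub> h (?e (Pow I - T))"
        using c by (intro compl_unique[OF k_in[OF h sub(1)] k_in[OF h' sub(2)] k_in[OF h sub(2)]]) simp_all
    qed (rule k_in[OF h sub(2)] k_in[OF h' sub(2)])+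
  qed simp
  have E_Inter: "?E (Pow I \<inter> \<Inter>\<T>)" if "\<And>T. T \<in> \<T> \<Longrightarrow> ?E T" for \<T>
  proof -
    have "\<T> \<subseteq> Pow (Pow I)" using that by blast
    moreover have "(\<lambda>T. h (?e T)) ` \<T> = (\<lambda>T. h' (?e T)) ` \<T>"
      using that by (intro image_cong) auto
    ultimately show ?thesis using inf[OF h, of \<T>] inf[OF h', of \<T>] by simp
  qed
  have E_Union: "?E (\<Union>\<T>)" if "\<And>T. T \<in> \<T> \<Longrightarrow> ?E T" for \<T>
  proof -
    have "\<T> \<subseteq> Pow (Pow I)" using that by blast
    moreover have "(\<lambda>T. h (?e T)) ` \<T> = (\<lambda>T. h' (?e T)) ` \<T>"
      using that by (intro image_cong) auto
    ultimately show ?thesis using sup[OF h, of \<T>] sup[OF h', of \<T>] by auto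
  qed
  have E_gen: "?E (containing I i)" if "i \<in> I" for i using eq[OF that] by auto
  have E_single: "?E {s}" if s: "s \<subseteq> I" for s
  proof -
    have "{s} = Pow I \<inter> \<Inter>(containing I ` s \<union> (\<lambda>i. Pow I - containing I i) ` (I - s))"
      (is "_ = ?R")
    proof (rule equalityI; rule subsetI)
      fix x assume "x \<in> ?R"
      then have "x \<subseteq> I" "\<forall>i\<in>s. x \<in> containing I i" "\<forall>i\<in>I - s. x \<in> Pow I - containing I i"
        by (simp_all add: ball_Un)
      then show "x \<in> {s}" by blast
    qed (use s in auto)
    moreover have "?E (Pow I \<inter> \<Inter>(containing I ` s \<union> (\<lambda>i. Pow I - containing I i) ` (I - s)))"
    proof (rule E_Inter)
      fix T assume "T \<in> containing I ` s \<union> (\<lambda>i. Pow I - containing I i) ` (I - s)"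
      then show "?E T"
      proof
        assume "T \<in> containing I ` s"
        then show ?thesis using s E_gen by blast
      next
        assume "T \<in> (\<lambda>i. Pow I - containing I i) ` (I - s)"
        then show ?thesis using E_gen[THEN E_compl] by blast
      qed
    qed
    ultimately show ?thesis by simp
  qed
  have E: "?E T" if T: "T \<subseteq> Pow I" for T
  proof -
    have "?E (\<Union>((\<lambda>s. {s}) ` T))"
    proof (rule E_Union)
      fix S assume "S \<in> (\<lambda>s. {s}) ` T"
      then show "?E S" using T E_single by blast
    qed
    then show ?thesis by simp
  qed
  have "h x = h' x" if x: "x \<in> carrier ?A" for x
    using E[of "dec (D I) x"] openin_dec[OF x] enc_dec[OF x] by simp
  moreover have "h \<in> carrier ?A \<rightarrow>\<^sub>E carrier L" "h' \<in> carrier ?A \<rightarrow>\<^sub>E carrier L"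
    using h h' by (simp_all add: caba_homs_def)
  ultimately show ?thesis by (metis PiE_ext)
qed

end

lemma caba_homs_compose:
  assumes "f \<in> caba_homs K L" "g \<in> caba_homs L M"
  shows "compose (carrier K) g f \<in> caba_homs K M"
proof -
  have f: "f \<in> carrier K \<rightarrow>\<^sub>E carrier L" "sup_pres K L f" "inf_pres K L f"
    and g: "g \<in> carrier L \<rightarrow>\<^sub>E carrier M" "sup_pres L M g" "inf_pres L M g"
    using assms by (auto simp: caba_homs_def)
  interpret K: complete_lattice K using f by (simp add: sup_pres_def)
  have fA: "f ` A \<subseteq> carrier L" if "A \<subseteq> carrier K" for A using that f(1) by auto
  have im: "compose (carrier K) g f ` A = g ` f ` A" if "A \<subseteq> carrier K" for A
    using that by (force simp: compose_def image_image)
  show ?thesis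
    using f g fA im unfolding caba_homs_def sup_pres_def inf_pres_def
    by (auto simp: compose_def PiE_iff)
qed

lemma frame_homs_compose:
  assumes "f \<in> frame_homs K L" "g \<in> frame_homs L M"
  shows "compose (carrier K) g f \<in> frame_homs K M"
proof -
  have f: "f \<in> carrier K \<rightarrow>\<^sub>E carrier L" "sup_pres K L f" "meet_pres K L f" "f \<top>\<^bsub>K\<^esub> = \<top>\<^bsub>L\<^esub>"
    and g: "g \<in> carrier L \<rightarrow>\<^sub>E carrier M" "sup_pres L M g" "meet_pres L M g" "g \<top>\<^bsub>L\<^esub> = \<top>\<^bsub>M\<^esub>"
    using assms by (auto simp: frame_homs_def)
  interpret K: complete_lattice K using f by (simp add: sup_pres_def)
  have fA: "f ` A \<subseteq> carrier L" if "A \<subseteq> carrier K" for A using that f(1) by auto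
  have fx: "f x \<in> carrier L" if "x \<in> carrier K" for x using that f(1) by auto
  have im: "compose (carrier K) g f ` A = g ` f ` A" if "A \<subseteq> carrier K" for A
    using that by (force simp: compose_def image_image)
  show ?thesis
    using f g fA fx im unfolding frame_homs_def sup_pres_def meet_pres_def
    by (auto simp: compose_def PiE_iff)
qed

lemma caba_homs_subset_frame_homs: "caba_homs L M \<subseteq> frame_homs L M"
proof
  fix h assume h: "h \<in> caba_homs L M"
  then have "weak_inf_pres L M h" and lat: "complete_lattice L" "complete_lattice M"
    and top: "h (\<Sqinter>\<^bsub>L\<^esub> {}) = \<Sqinter>\<^bsub>M\<^esub> (h ` {})"
    unfolding caba_homs_def weak_inf_pres_def inf_pres_def by auto
  then have "meet_pres L M h" by (intro inf_pres_is_meet_pres)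
  then show "h \<in> frame_homs L M"
    using h top unfolding caba_homs_def frame_homs_def
    by (simp add: complete_lattice_inf_empty[OF lat(1)] complete_lattice_inf_empty[OF lat(2)])
qed

text \<open>
  Distributivity over arbitrary joins can be checked on the atoms below both sides.
\<close>

lemma is_frame_if_is_caba:
  assumes L: "is_caba L"
  shows "is_frame L"
  unfolding is_frame_def
proof (intro conjI ballI allI impI)
  show cl: "complete_lattice L" using L by (simp add: is_caba_def)
  interpret complete_lattice L by (rule cl)
  fix x S assume x: "x \<in> carrier L" and S: "S \<subseteq> carrier L"
  have mS: "(\<lambda>s. x \<sqinter>\<^bsub>L\<^esub> s) ` S \<subseteq> carrier L" using x S by auto
  have below_meet: "atoms_below L (x \<sqinter>\<^bsub>L\<^esub> y) = atoms_below L x \<inter> atoms_below L y" if "y \<in> carrier L" for y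
    unfolding meet_def using atoms_below_inf[OF L, of "{x, y}"] that x
    by (auto simp: atoms_below_def)
  note below_sup = atoms_below_Sup[OF L]
  have "atoms_below L (x \<sqinter>\<^bsub>L\<^esub> \<Squnion>\<^bsub>L\<^esub> S) = atoms_below L (\<Squnion>\<^bsub>L\<^esub> ((\<lambda>s. x \<sqinter>\<^bsub>L\<^esub> s) ` S))"
  proof -
    have "atoms_below L (x \<sqinter>\<^bsub>L\<^esub> s) = atoms_below L x \<inter> atoms_below L s" if "s \<in> S" for s
      using that S by (intro below_meet) blast
    then have "(\<Union>s\<in>S. atoms_below L (x \<sqinter>\<^bsub>L\<^esub> s)) = atoms_below L x \<inter> (\<Union>s\<in>S. atoms_below L s)"
      by auto
    then show ?thesis
      using below_meet[of "\<Squnion>\<^bsub>L\<^esub> S"] sup_closed[OF S]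
      by (simp add: below_sup[OF mS] below_sup[OF S])
  qed
  then show "x \<sqinter>\<^bsub>L\<^esub> \<Squnion>\<^bsub>L\<^esub> S = \<Squnion>\<^bsub>L\<^esub> ((\<lambda>s. x \<sqinter>\<^bsub>L\<^esub> s) ` S)"
    using x S mS by (intro le_antisym le_if_atoms_below[OF L]) auto
qed

text \<open>
  A family \<open>g\<close> of elements of \<open>L\<close> sends an atom \<open>a\<close> to the point \<open>{i. a \<sqsubseteq> g i}\<close> of \<open>Pow I\<close>. Taking preimages along this
  map, followed by the isomorphism between the power set of the atoms and \<open>L\<close>, is the
  homomorphism that extends \<open>g\<close>.
\<close>

lemma free_caba:
  fixes I :: "'u set"
  defines "D \<equiv> \<lambda>I :: 'u set. discrete_topology (Pow I)"
  assumes universe: "set_universe TYPE('u)" and I: "small TYPE('u) I"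
  shows "is_free_on caba_cat I (open_alg (D I)) (gen_in D I)"
proof -
  have PPI: "small TYPE('u) (Pow (Pow I))" by (intro small_Pow universe I)
  have sm: "small TYPE('u) (opens (D I))" unfolding D_def opens_discrete_topology by (rule PPI)
  have genin: "gen_in D I i \<in> carrier (open_alg (D I) :: 'u gorder)" for i
    unfolding D_def by (rule enc_carrier) auto
  have "open_alg (D I) \<in> Obj (caba_cat :: ('u gorder, 'u \<Rightarrow> 'u) cat)"
    using is_caba_open_alg[OF PPI] sm by (simp add: caba_cat_def carrier_open_alg small_image D_def)
  moreover have "\<exists>!h. h \<in> Hom caba_cat (open_alg (D I)) L \<and> (\<forall>i\<in>I. h (gen_in D I i) = g i)"
    if "L \<in> Obj caba_cat" and g: "g \<in> I \<rightarrow> carrier L" for L :: "'u gorder" and g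
  proof -
    have L: "is_caba L" and smL: "small TYPE('u) (carrier L)" using that by (auto simp: caba_cat_def)
    define At where "At = {a. is_atom L a}"
    let ?X = "discrete_topology At"
    have "At \<subseteq> carrier L" unfolding At_def by (rule atom_carrier[OF L])
    then have PA: "small TYPE('u) (Pow At)" by (intro small_Pow[OF universe] small_subset[OF _ smL])
    \<comment> \<open>the point of the power set of \<open>I\<close> at which an atom sits\<close>
    define t where "t a = {i \<in> I. a \<sqsubseteq>\<^bsub>L\<^esub> g i}" for a
    have t: "t \<in> At \<rightarrow> Pow I" by (auto simp: t_def)
    let ?b = "\<lambda>y :: 'u\<in>carrier (open_alg ?X). \<Squnion>\<^bsub>L\<^esub> (dec ?X y)"
    let ?h = "compose (carrier (open_alg (D I))) ?b (preimage_hom ?X (D I) t)"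
    have "?h \<in> caba_homs (open_alg (D I)) L"
      using preimage_hom_caba[OF PA PPI t] sup_caba_hom[OF L] PA
      unfolding D_def At_def by (intro caba_homs_compose)
    moreover have "?h (gen_in D I i) = g i" if i: "i \<in> I" for i
    proof -
      have gi: "g i \<in> carrier L" using g i by auto
      have sA: "small TYPE('u) (opens ?X)" unfolding opens_discrete_topology by (rule PA)
      have "{a \<in> At. t a \<in> containing I i} = atoms_below L (g i)"
        using i by (auto simp: t_def atoms_below_def At_def)
      moreover have "openin (D I) (containing I i)" unfolding D_def by auto
      ultimately have "preimage_hom ?X (D I) t (gen_in D I i) = (enc ?X (atoms_below L (g i)) :: 'u)"
        using genin[of i] by (simp add: preimage_hom_def dec_enc[OF sm])
      moreover have "atoms_below L (g i) \<subseteq> At" by (auto simp: atoms_below_def At_def)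
      ultimately show ?thesis
        using genin[of i] sup_atoms_below[OF L gi]
        by (simp add: compose_def enc_carrier dec_enc[OF sA])
    qed
    ultimately have "\<exists>h. h \<in> Hom caba_cat (open_alg (D I)) L \<and> (\<forall>i\<in>I. h (gen_in D I i) = g i)"
      unfolding caba_cat_def by auto
    moreover have "h = h'" if "h \<in> Hom caba_cat (open_alg (D I)) L \<and> (\<forall>i\<in>I. h (gen_in D I i) = g i)"
      "h' \<in> Hom caba_cat (open_alg (D I)) L \<and> (\<forall>i\<in>I. h' (gen_in D I i) = g i)" for h h'
      using caba_hom_from_powerset_unique[OF universe I L, of h h'] that
      unfolding D_def caba_cat_def by auto
    ultimately show ?thesis by blast
  qed
  ultimately show ?thesis using genin unfolding is_free_on_def by blast
qed

section \<open>Lawvere theories of free algebras as categories of spaces\<close>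

text \<open>
  The isomorphism from the chosen free algebra to the algebra of opens of the space \<open>Sp I\<close>. It is
  unique whenever \<open>I\<close> is small.
\<close>

definition to_concrete :: "('u gorder, 'u \<Rightarrow> 'u) cat \<Rightarrow> ('u set \<Rightarrow> 'u set topology) \<Rightarrow> 'u set \<Rightarrow> 'u \<Rightarrow> 'u" where
  "to_concrete A Sp I = (SOME h. h \<in> Hom A (free_alg A I) (open_alg (Sp I)) \<and>
     (\<forall>i\<in>I. h (generator A I i) = gen_in Sp I i))"

text \<open>
  The open set that corresponds to an element of the free algebra.
\<close>

definition extent :: "('u gorder, 'u \<Rightarrow> 'u) cat \<Rightarrow> ('u set \<Rightarrow> 'u set topology) \<Rightarrow> 'u set \<Rightarrow> 'u \<Rightarrow> 'u set set" where
  "extent A Sp I x = dec (Sp I) (to_concrete A Sp I x)"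

text \<open>
  A morphism \<open>I \<rightarrow> J\<close> of the theory is a homomorphism from the free algebra on \<open>J\<close> to the one on \<open>I\<close>, that
  is, a \<open>J\<close>-indexed family of open sets of the space of \<open>I\<close>. It is turned into the function
  with this family as its coordinates.
\<close>

definition realize :: "('u gorder, 'u \<Rightarrow> 'u) cat \<Rightarrow> ('u set \<Rightarrow> 'u set topology) \<Rightarrow> 'u set \<Rightarrow> 'u set
    \<Rightarrow> ('u \<Rightarrow> 'u) \<Rightarrow> 'u set \<Rightarrow> 'u set" where
  "realize A Sp I J h = (\<lambda>s\<in>Pow I. {j \<in> J. s \<in> extent A Sp I (h (generator A J j))})"

text \<open>
  The common features of frames, with the Sierpinski powers, and of CABAs, with the discrete
  spaces on power sets: the opens of \<open>Sp I\<close> are the free algebra on \<open>I\<close>, a map into \<open>Sp J\<close> is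
  continuous if the preimages of the generators are open, and preimages under continuous maps are
  homomorphisms.
\<close>

locale free_theory =
  fixes A :: "('u gorder, 'u \<Rightarrow> 'u) cat" and Sp :: "'u set \<Rightarrow> 'u set topology"
  assumes universe: "set_universe TYPE('u)"
    and small_opens: "small TYPE('u) I \<Longrightarrow> small TYPE('u) (opens (Sp I))"
    and topspace: "topspace (Sp I) = Pow I"
    and open_gen: "openin (Sp I) (containing I i)"
    and continuous_iff: "continuous_map (Sp I) (Sp J) u \<longleftrightarrow>
          u \<in> Pow I \<rightarrow> Pow J \<and> (\<forall>j\<in>J. openin (Sp I) {s \<in> Pow I. j \<in> u s})"
    and Comp: "Comp A K L M g f = compose (carrier K) g f"
    and Iden: "Iden A L = (\<lambda>x\<in>carrier L. x)"
    and Hom_funcset: "Hom A K L \<subseteq> carrier K \<rightarrow>\<^sub>E carrier L"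
    and Hom_compose: "f \<in> Hom A K L \<Longrightarrow> g \<in> Hom A L M \<Longrightarrow> compose (carrier K) g f \<in> Hom A K M"
    and Hom_id: "L \<in> Obj A \<Longrightarrow> (\<lambda>x\<in>carrier L. x) \<in> Hom A L L"
    and free: "small TYPE('u) I \<Longrightarrow> is_free_on A I (open_alg (Sp I)) (gen_in Sp I)"
    and preimage: "small TYPE('u) I \<Longrightarrow> small TYPE('u) J \<Longrightarrow> continuous_map (Sp I) (Sp J) u \<Longrightarrow>
          preimage_hom (Sp I) (Sp J) u \<in> Hom A (open_alg (Sp J)) (open_alg (Sp I))"
begin

abbreviation FA :: "'u set \<Rightarrow> 'u gorder" where "FA \<equiv> free_alg A"
abbreviation gen :: "'u set \<Rightarrow> 'u \<Rightarrow> 'u" where "gen \<equiv> generator A"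
abbreviation OA :: "'u set \<Rightarrow> 'u gorder" where "OA I \<equiv> open_alg (Sp I)"
abbreviation extn :: "'u set \<Rightarrow> 'u \<Rightarrow> 'u set set" where "extn \<equiv> extent A Sp"
abbreviation \<kappa> :: "'u set \<Rightarrow> 'u \<Rightarrow> 'u" where "\<kappa> \<equiv> to_concrete A Sp"
abbreviation R :: "'u set \<Rightarrow> 'u set \<Rightarrow> ('u \<Rightarrow> 'u) \<Rightarrow> 'u set \<Rightarrow> 'u set" where "R \<equiv> realize A Sp"
abbreviation sm :: "'u set \<Rightarrow> bool" where "sm \<equiv> small TYPE('u)"

lemma Hom_mem: "h \<in> Hom A K L \<Longrightarrow> x \<in> carrier K \<Longrightarrow> h x \<in> carrier L"
  using Hom_funcset PiE_mem by (metis subsetD)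

lemma Hom_eqI:
  assumes "h \<in> Hom A K L" "h' \<in> Hom A K L" "\<And>x. x \<in> carrier K \<Longrightarrow> h x = h' x"
  shows "h = h'"
proof -
  have "h \<in> carrier K \<rightarrow>\<^sub>E carrier L" "h' \<in> carrier K \<rightarrow>\<^sub>E carrier L" using assms Hom_funcset by blast+
  then show ?thesis using assms(3) by (rule PiE_ext)
qed

lemma Hom_lawvere: "Hom (lawvere_theory A) I J = Hom A (FA J) (FA I)"
  by (simp add: lawvere_theory_def op_cat_def)

lemma Comp_lawvere: "Comp (lawvere_theory A) I J K g f = compose (carrier (FA K)) f g"
  by (simp add: lawvere_theory_def op_cat_def Comp)

lemma Iden_lawvere: "Iden (lawvere_theory A) I = (\<lambda>x\<in>carrier (FA I). x)"
  by (simp add: lawvere_theory_def op_cat_def Iden)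

lemma free_alg_free: "sm I \<Longrightarrow> is_free_on A I (FA I) (gen I)"
proof -
  assume "sm I"
  then have "\<exists>p. case p of (F, \<eta>) \<Rightarrow> is_free_on A I F \<eta>"
    using free[of I] by auto
  then have "case chosen_free A I of (F, \<eta>) \<Rightarrow> is_free_on A I F \<eta>"
    unfolding chosen_free_def by (rule someI_ex)
  then show ?thesis unfolding free_alg_def generator_def by (simp add: split_beta)
qed

lemma free_alg_obj: "sm I \<Longrightarrow> FA I \<in> Obj A"
  using free_alg_free by (simp add: is_free_on_def)

lemma open_alg_obj: "sm I \<Longrightarrow> OA I \<in> Obj A"
  using free by (simp add: is_free_on_def)

lemma gen_carrier: "sm I \<Longrightarrow> i \<in> I \<Longrightarrow> gen I i \<in> carrier (FA I)"
  using free_alg_free[of I] by (auto simp: is_free_on_def)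

lemma is_free_on_ex1:
  assumes "is_free_on A I F \<eta>" "L \<in> Obj A" "\<And>i. i \<in> I \<Longrightarrow> g i \<in> carrier L"
  shows "\<exists>!h. h \<in> Hom A F L \<and> (\<forall>i\<in>I. h (\<eta> i) = g i)"
  using assms unfolding is_free_on_def by blast

lemma free_hom_ex:
  assumes "sm I" "L \<in> Obj A" "\<And>i. i \<in> I \<Longrightarrow> g i \<in> carrier L"
  obtains h where "h \<in> Hom A (FA I) L" "\<And>i. i \<in> I \<Longrightarrow> h (gen I i) = g i"
proof -
  have "\<exists>!h. h \<in> Hom A (FA I) L \<and> (\<forall>i\<in>I. h (gen I i) = g i)"
    by (rule is_free_on_ex1[OF free_alg_free[OF assms(1)] assms(2)]) (rule assms(3))
  then obtain h where "h \<in> Hom A (FA I) L \<and> (\<forall>i\<in>I. h (gen I i) = g i)" by (rule ex1E)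
  then show ?thesis using that by blast
qed

lemma is_free_on_unique:
  assumes "is_free_on A I F \<eta>" "L \<in> Obj A" "h \<in> Hom A F L" "h' \<in> Hom A F L"
    and eq: "\<And>i. i \<in> I \<Longrightarrow> h (\<eta> i) = h' (\<eta> i)"
  shows "h = h'"
proof -
  have "\<eta> i \<in> carrier F" if "i \<in> I" for i using assms(1) that by (auto simp: is_free_on_def)
  then have "\<exists>!k. k \<in> Hom A F L \<and> (\<forall>i\<in>I. k (\<eta> i) = h (\<eta> i))"
    using Hom_mem[OF assms(3)] by (intro is_free_on_ex1[OF assms(1,2)]) simp
  then show ?thesis using assms(3,4) eq by (elim ex1E) metis
qed

lemmas free_hom_eqI = is_free_on_unique[OF free_alg_free]

lemma to_concrete:
  assumes I: "sm I"
  shows "\<kappa> I \<in> Hom A (FA I) (OA I) \<and> (\<forall>i\<in>I. \<kappa> I (gen I i) = gen_in Sp I i)"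
proof -
  have "gen_in Sp I i \<in> carrier (OA I)" for i by (intro enc_carrier open_gen)
  then obtain h where "h \<in> Hom A (FA I) (OA I)" "\<And>i. i \<in> I \<Longrightarrow> h (gen I i) = gen_in Sp I i"
    using free_hom_ex[OF I open_alg_obj[OF I], of "gen_in Sp I"] by blast
  then have "\<exists>h. h \<in> Hom A (FA I) (OA I) \<and> (\<forall>i\<in>I. h (gen I i) = gen_in Sp I i)" by blast
  from someI_ex[OF this] show ?thesis unfolding to_concrete_def .
qed

lemma to_concrete_hom: "sm I \<Longrightarrow> \<kappa> I \<in> Hom A (FA I) (OA I)"
  and to_concrete_gen: "sm I \<Longrightarrow> i \<in> I \<Longrightarrow> \<kappa> I (gen I i) = gen_in Sp I i"
  using to_concrete by blast+

lemma to_concrete_bij: "sm I \<Longrightarrow> bij_betw (\<kappa> I) (carrier (FA I)) (carrier (OA I))"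
proof -
  assume I: "sm I"
  have gc: "gen_in Sp I i \<in> carrier (OA I)" for i by (intro enc_carrier open_gen)
  have "\<exists>!h. h \<in> Hom A (OA I) (FA I) \<and> (\<forall>i\<in>I. h (gen_in Sp I i) = gen I i)"
    by (rule is_free_on_ex1[OF free[OF I] free_alg_obj[OF I]]) (rule gen_carrier[OF I])
  then obtain k' where k': "k' \<in> Hom A (OA I) (FA I)" "\<And>i. i \<in> I \<Longrightarrow> k' (gen_in Sp I i) = gen I i"
    by (elim ex1E) blast
  have "compose (carrier (FA I)) k' (\<kappa> I) = (\<lambda>x\<in>carrier (FA I). x)"
    using Hom_compose[OF to_concrete_hom[OF I] k'(1)] Hom_id[OF free_alg_obj[OF I]]
    by (rule free_hom_eqI[OF I free_alg_obj[OF I]]) (simp add: compose_def gen_carrier[OF I] to_concrete_gen[OF I] k')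
  then have 1: "k' (\<kappa> I x) = x" if "x \<in> carrier (FA I)" for x
    using that by (metis compose_eq restrict_apply')
  have "compose (carrier (OA I)) (\<kappa> I) k' = (\<lambda>x\<in>carrier (OA I). x)"
    using Hom_compose[OF k'(1) to_concrete_hom[OF I]] Hom_id[OF open_alg_obj[OF I]]
    by (rule is_free_on_unique[OF free[OF I] open_alg_obj[OF I]]) (simp add: compose_def gc to_concrete_gen[OF I] k')
  then have 2: "\<kappa> I (k' x) = x" if "x \<in> carrier (OA I)" for x
    using that by (metis compose_eq restrict_apply')
  show ?thesis
    by (rule bij_betw_byWitness[of _ k']) (use 1 2 Hom_mem[OF to_concrete_hom[OF I]] Hom_mem[OF k'(1)] in auto)
qed

lemma openin_extent: "sm I \<Longrightarrow> x \<in> carrier (FA I) \<Longrightarrow> openin (Sp I) (extn I x)"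
  unfolding extent_def by (intro openin_dec Hom_mem[OF to_concrete_hom])

lemma extent_subset: "sm I \<Longrightarrow> x \<in> carrier (FA I) \<Longrightarrow> extn I x \<subseteq> Pow I"
  using openin_subset[OF openin_extent, of I x] by (simp add: topspace)

lemma extent_gen: "sm I \<Longrightarrow> i \<in> I \<Longrightarrow> extn I (gen I i) = containing I i"
  using to_concrete_gen[of I i] dec_enc[OF small_opens open_gen, of I i] by (simp add: extent_def)

lemma extent_inj: "sm I \<Longrightarrow> x \<in> carrier (FA I) \<Longrightarrow> y \<in> carrier (FA I) \<Longrightarrow> extn I x = extn I y \<Longrightarrow> x = y"
proof -
  assume I: "sm I" and x: "x \<in> carrier (FA I)" and y: "y \<in> carrier (FA I)" and eq: "extn I x = extn I y"
  have "\<kappa> I x = \<kappa> I y"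
    using enc_dec[OF Hom_mem[OF to_concrete_hom[OF I] x]] enc_dec[OF Hom_mem[OF to_concrete_hom[OF I] y]]
      eq[unfolded extent_def] by metis
  then show ?thesis using to_concrete_bij[OF I] x y unfolding bij_betw_def inj_on_def by blast
qed

lemma extent_surj:
  assumes I: "sm I" and U: "openin (Sp I) U"
  obtains x where "x \<in> carrier (FA I)" "extn I x = U"
proof -
  have "enc (Sp I) U \<in> \<kappa> I ` carrier (FA I)"
    using to_concrete_bij[OF I] enc_carrier[OF U] by (simp add: bij_betw_def)
  then obtain x where x: "x \<in> carrier (FA I)" "\<kappa> I x = enc (Sp I) U" by auto
  then have "extn I x = U" unfolding extent_def by (simp add: dec_enc[OF small_opens[OF I] U])
  then show ?thesis using that x by blast
qed

lemma realize_continuous: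
  assumes I: "sm I" and J: "sm J" and h: "h \<in> Hom A (FA J) (FA I)"
  shows "R I J h \<in> Pow I \<rightarrow>\<^sub>E Pow J" "continuous_map (Sp I) (Sp J) (R I J h)"
proof -
  show R: "R I J h \<in> Pow I \<rightarrow>\<^sub>E Pow J" by (auto simp: realize_def)
  have "{s \<in> Pow I. j \<in> R I J h s} = extn I (h (gen J j))" if "j \<in> J" for j
    using extent_subset[OF I Hom_mem[OF h gen_carrier[OF J that]]] that by (auto simp: realize_def)
  then show "continuous_map (Sp I) (Sp J) (R I J h)"
    unfolding continuous_iff using R openin_extent[OF I Hom_mem[OF h gen_carrier[OF J]]] by auto
qed

text \<open>
  Under the identification of elements with open sets, a homomorphism \<open>h\<close> is the preimage map of
  its realization. Both sides are homomorphisms of a free algebra, so it suffices that they agree on generators.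
\<close>

lemma extent_hom:
  assumes I: "sm I" and J: "sm J" and h: "h \<in> Hom A (FA J) (FA I)" and x: "x \<in> carrier (FA J)"
  shows "extn I (h x) = {s \<in> Pow I. R I J h s \<in> extn J x}"
proof -
  note cont = realize_continuous(2)[OF I J h]
  note p = preimage[OF I J cont]
  have "compose (carrier (FA J)) (\<kappa> I) h = compose (carrier (FA J)) (preimage_hom (Sp I) (Sp J) (R I J h)) (\<kappa> J)"
    using Hom_compose[OF h to_concrete_hom[OF I]] Hom_compose[OF to_concrete_hom[OF J] p]
  proof (rule free_hom_eqI[OF J open_alg_obj[OF I]])
    fix j assume j: "j \<in> J"
    have hj: "h (gen J j) \<in> carrier (FA I)" by (rule Hom_mem[OF h gen_carrier[OF J j]])
    have gj: "gen_in Sp J j \<in> carrier (OA J)" by (intro enc_carrier open_gen)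
    have "{s \<in> Pow I. R I J h s \<in> containing J j} = extn I (h (gen J j))"
      using extent_subset[OF I hj] j by (auto simp: realize_def)
    then have "preimage_hom (Sp I) (Sp J) (R I J h) (gen_in Sp J j) = (enc (Sp I) (extn I (h (gen J j))) :: 'u)"
      unfolding preimage_hom_def using gj
      by (simp add: topspace dec_enc[OF small_opens[OF J] open_gen])
    also have "\<dots> = \<kappa> I (h (gen J j))"
      unfolding extent_def by (rule enc_dec[OF Hom_mem[OF to_concrete_hom[OF I] hj]])
    finally show "compose (carrier (FA J)) (\<kappa> I) h (gen J j) =
        compose (carrier (FA J)) (preimage_hom (Sp I) (Sp J) (R I J h)) (\<kappa> J) (gen J j)"
      using j by (simp add: compose_def gen_carrier[OF J] to_concrete_gen[OF J])
  qed
  then have "\<kappa> I (h x) = preimage_hom (Sp I) (Sp J) (R I J h) (\<kappa> J x)"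
    using x by (metis compose_eq)
  then show ?thesis
    unfolding extent_def
    by (simp add: dec_preimage_hom[OF small_opens[OF I] small_opens[OF J] cont Hom_mem[OF to_concrete_hom[OF J] x]] topspace)
qed

lemma realize_inj:
  assumes "sm I" "sm J" "h \<in> Hom A (FA J) (FA I)" "h' \<in> Hom A (FA J) (FA I)" "R I J h = R I J h'"
  shows "h = h'"
  using assms(3,4)
proof (rule Hom_eqI)
  fix x assume x: "x \<in> carrier (FA J)"
  show "h x = h' x"
    using extent_hom[OF assms(1-3) x] extent_hom[OF assms(1,2,4) x] assms(5)
    by (intro extent_inj[OF assms(1)] Hom_mem[OF assms(3) x] Hom_mem[OF assms(4) x]) simp
qed

lemma realize_surj:
  assumes I: "sm I" and J: "sm J" and u: "u \<in> Pow I \<rightarrow>\<^sub>E Pow J" "continuous_map (Sp I) (Sp J) u"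
  obtains h where "h \<in> Hom A (FA J) (FA I)" "R I J h = u"
proof -
  have "\<exists>x\<in>carrier (FA I). extn I x = {s \<in> Pow I. j \<in> u s}" if "j \<in> J" for j
    using u(2) that unfolding continuous_iff by (metis (lifting) extent_surj[OF I])
  then obtain x where x: "\<And>j. j \<in> J \<Longrightarrow> x j \<in> carrier (FA I)" "\<And>j. j \<in> J \<Longrightarrow> extn I (x j) = {s \<in> Pow I. j \<in> u s}"
    by metis
  obtain h where h: "h \<in> Hom A (FA J) (FA I)" "\<And>j. j \<in> J \<Longrightarrow> h (gen J j) = x j"
    using free_hom_ex[OF J free_alg_obj[OF I], of x] x(1) by blast
  have "R I J h s = u s" if s: "s \<in> Pow I" for s
  proof -
    have "u s \<subseteq> J" using u(1) s by auto
    then show ?thesis using s x h by (auto simp: realize_def)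
  qed
  then have "R I J h = u"
    using realize_continuous(1)[OF I J h(1)] u(1) by (intro PiE_ext)
  then show ?thesis using that h by blast
qed

text \<open>
  By \<open>extent_hom\<close>, \<open>s\<close> lies in the open set of \<open>h (h' x)\<close> if and only if its image under the realization of \<open>h\<close> lies
  in the open set of \<open>h' x\<close>.
\<close>

lemma realize_compose:
  assumes I: "sm I" and J: "sm J" and K: "sm K"
    and h: "h \<in> Hom A (FA J) (FA I)" and h': "h' \<in> Hom A (FA K) (FA J)"
  shows "R I K (compose (carrier (FA K)) h h') = compose (Pow I) (R J K h') (R I J h)"
proof (rule ext)
  fix s
  show "R I K (compose (carrier (FA K)) h h') s = compose (Pow I) (R J K h') (R I J h) s"
  proof (cases "s \<in> Pow I")
    case True
    have "R I J h s \<in> Pow J" using realize_continuous(1)[OF I J h] True by (rule PiE_mem)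
    moreover have "s \<in> extn I (h (h' (gen K j))) \<longleftrightarrow> R I J h s \<in> extn J (h' (gen K j))" if "j \<in> K" for j
      using extent_hom[OF I J h Hom_mem[OF h' gen_carrier[OF K that]]] True by simp
    ultimately show ?thesis
      using True gen_carrier[OF K] by (auto simp: compose_def realize_def[of A Sp _ K])
  qed (simp add: compose_def realize_def)
qed

lemma realize_id: "sm I \<Longrightarrow> R I I (\<lambda>x\<in>carrier (FA I). x) = (\<lambda>s\<in>Pow I. s)"
proof -
  assume I: "sm I"
  have "{j \<in> I. s \<in> extn I ((\<lambda>x\<in>carrier (FA I). x) (gen I j))} = s" if "s \<in> Pow I" for s
    using that extent_gen[OF I] gen_carrier[OF I] by auto
  then show ?thesis by (simp add: realize_def cong: restrict_cong)
qed

lemma power_proj: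
  assumes I: "sm I" and i: "i \<in> I"
  shows "power_proj A I i \<in> Hom A (FA one_point) (FA I)"
    and "R I one_point (power_proj A I i) = (\<lambda>s\<in>Pow I. {j \<in> one_point. i \<in> s})"
proof -
  have pt: "sm one_point" by (rule small_finite[OF universe]) simp
  have "\<exists>!h. h \<in> Hom A (FA one_point) (FA I) \<and> (\<forall>j\<in>one_point. h (gen one_point j) = gen I i)"
    by (rule is_free_on_ex1[OF free_alg_free[OF pt] free_alg_obj[OF I]]) (rule gen_carrier[OF I i])
  then have "\<exists>!h. h \<in> Hom (lawvere_theory A) I one_point \<and> h (gen one_point undefined) = gen I i"
    by (simp add: Hom_lawvere)
  then have *: "power_proj A I i \<in> Hom (lawvere_theory A) I one_point \<and>
      power_proj A I i (gen one_point undefined) = gen I i"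
    unfolding power_proj_def by (rule theI')
  then show "power_proj A I i \<in> Hom A (FA one_point) (FA I)" by (simp add: Hom_lawvere)
  show "R I one_point (power_proj A I i) = (\<lambda>s\<in>Pow I. {j \<in> one_point. i \<in> s})"
    using * i by (auto simp: realize_def extent_gen[OF I] fun_eq_iff)
qed

lemma to_terminal:
  assumes I: "sm I"
  shows "to_terminal (lawvere_theory A) I \<in> Hom A (FA {}) (FA I)"
proof -
  have pt: "sm {}" by (rule small_finite[OF universe]) simp
  have "\<exists>!h. h \<in> Hom A (FA {}) (FA I) \<and> (\<forall>j\<in>{}. h (gen {} j) = undefined)"
    by (rule is_free_on_ex1[OF free_alg_free[OF pt] free_alg_obj[OF I]]) simp
  then have "\<exists>!h. h \<in> Hom (lawvere_theory A) I {}" by (simp add: Hom_lawvere)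
  then have "to_terminal (lawvere_theory A) I \<in> Hom (lawvere_theory A) I {}"
    unfolding to_terminal_def by (rule theI')
  then show ?thesis by (simp add: Hom_lawvere)
qed

lemma realize_bij:
  assumes "sm I" "sm J"
  shows "bij_betw (R I J) (Hom (lawvere_theory A) I J) {u \<in> Pow I \<rightarrow>\<^sub>E Pow J. continuous_map (Sp I) (Sp J) u}"
  unfolding bij_betw_def Hom_lawvere
proof
  show "inj_on (R I J) (Hom A (FA J) (FA I))"
    by (rule inj_onI) (rule realize_inj[OF assms])
  show "R I J ` Hom A (FA J) (FA I) = {u \<in> Pow I \<rightarrow>\<^sub>E Pow J. continuous_map (Sp I) (Sp J) u}"
  proof (rule equalityI; rule subsetI)
    fix u assume "u \<in> {u \<in> Pow I \<rightarrow>\<^sub>E Pow J. continuous_map (Sp I) (Sp J) u}"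
    then have "u \<in> Pow I \<rightarrow>\<^sub>E Pow J" "continuous_map (Sp I) (Sp J) u" by simp_all
    then obtain h where "h \<in> Hom A (FA J) (FA I)" "R I J h = u"
      by (rule realize_surj[OF assms])
    then show "u \<in> R I J ` Hom A (FA J) (FA I)" by (metis imageI)
  next
    fix u assume "u \<in> R I J ` Hom A (FA J) (FA I)"
    then obtain h where "h \<in> Hom A (FA J) (FA I)" "u = R I J h" by blast
    then show "u \<in> {u \<in> Pow I \<rightarrow>\<^sub>E Pow J. continuous_map (Sp I) (Sp J) u}"
      using realize_continuous[OF assms, of h] by simp
  qed
qed

end

lemma free_theory_frame:
  assumes universe: "set_universe TYPE('u)"
  shows "free_theory (frm_cat :: ('u gorder, 'u \<Rightarrow> 'u) cat) sierp"
proof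
  show "set_universe TYPE('u)" by (rule universe)
  show "Hom frm_cat K L \<subseteq> carrier K \<rightarrow>\<^sub>E carrier L" for K L :: "'u gorder"
    by (auto simp: frm_cat_def frame_homs_def)
  show "compose (carrier K) g f \<in> Hom frm_cat K M" if "f \<in> Hom frm_cat K L" "g \<in> Hom frm_cat L M"
    for K L M :: "'u gorder" and f g
    using that frame_homs_compose by (auto simp: frm_cat_def)
  show "(\<lambda>x\<in>carrier L. x) \<in> Hom frm_cat L L" if "L \<in> Obj frm_cat" for L :: "'u gorder"
  proof -
    have cl: "complete_lattice L" using that by (simp add: frm_cat_def is_frame_def)
    interpret complete_lattice L by (rule cl)
    have "(\<lambda>x\<in>carrier L. x) ` A = A" if "A \<subseteq> carrier L" for A using that by auto
    then show ?thesis
      by (auto simp: frm_cat_def frame_homs_def sup_pres_def meet_pres_def cl lattice_axioms)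
  qed
  show "is_free_on frm_cat I (open_alg (sierp I)) (gen_in sierp I)" if "small TYPE('u) I" for I :: "'u set"
    by (rule free_frame[OF universe that])
  show "preimage_hom (sierp I) (sierp J) f \<in> Hom frm_cat (open_alg (sierp J) :: 'u gorder) (open_alg (sierp I))"
    if "small TYPE('u) I" "small TYPE('u) J" "continuous_map (sierp I) (sierp J) f" for I J :: "'u set" and f
    using preimage_hom_frame[OF small_opens_sierp[OF universe that(1)] small_opens_sierp[OF universe that(2)] that(3)]
    by (simp add: frm_cat_def)
qed (auto simp: small_opens_sierp[OF universe] openin_containing continuous_map_sierp frm_cat_def)

lemma free_theory_caba:
  assumes universe: "set_universe TYPE('u)"
  shows "free_theory (caba_cat :: ('u gorder, 'u \<Rightarrow> 'u) cat) (\<lambda>I. discrete_topology (Pow I))"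
proof
  show "set_universe TYPE('u)" by (rule universe)
  show "Hom caba_cat K L \<subseteq> carrier K \<rightarrow>\<^sub>E carrier L" for K L :: "'u gorder"
    by (auto simp: caba_cat_def caba_homs_def)
  show "compose (carrier K) g f \<in> Hom caba_cat K M" if "f \<in> Hom caba_cat K L" "g \<in> Hom caba_cat L M"
    for K L M :: "'u gorder" and f g
    using that caba_homs_compose by (auto simp: caba_cat_def)
  show "(\<lambda>x\<in>carrier L. x) \<in> Hom caba_cat L L" if "L \<in> Obj caba_cat" for L :: "'u gorder"
  proof -
    have cl: "complete_lattice L" using that by (simp add: caba_cat_def is_caba_def)
    interpret complete_lattice L by (rule cl)
    have "(\<lambda>x\<in>carrier L. x) ` A = A" if "A \<subseteq> carrier L" for A using that by auto
    then show ?thesis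
      by (auto simp: caba_cat_def caba_homs_def sup_pres_def inf_pres_def cl lattice_axioms)
  qed
  show "is_free_on caba_cat I (open_alg (discrete_topology (Pow I))) (gen_in (\<lambda>I. discrete_topology (Pow I)) I)"
    if "small TYPE('u) I" for I :: "'u set"
    by (rule free_caba[OF universe that])
  show "preimage_hom (discrete_topology (Pow I)) (discrete_topology (Pow J)) f
      \<in> Hom caba_cat (open_alg (discrete_topology (Pow J)) :: 'u gorder) (open_alg (discrete_topology (Pow I)))"
    if "small TYPE('u) I" "small TYPE('u) J"
      "continuous_map (discrete_topology (Pow I)) (discrete_topology (Pow J)) f" for I J :: "'u set" and f
  proof -
    have "f \<in> Pow I \<rightarrow> Pow J" using that(3) by simp
    from preimage_hom_caba[OF small_Pow[OF universe small_Pow[OF universe that(1)]]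
        small_Pow[OF universe small_Pow[OF universe that(2)]] this]
    show ?thesis by (simp add: caba_cat_def)
  qed
qed (auto simp: opens_discrete_topology small_Pow[OF universe] caba_cat_def)

section \<open>The category E as a category of spaces\<close>

definition indiscrete :: "'a set \<Rightarrow> 'a topology" where
  "indiscrete S = topology (\<lambda>U. U = {} \<or> U = S)"

lemma openin_indiscrete: "openin (indiscrete S) U \<longleftrightarrow> U = {} \<or> U = S"
proof -
  have "istopology (\<lambda>U. U = {} \<or> U = S)"
    unfolding istopology_def by blast
  then show ?thesis by (simp add: indiscrete_def)
qed

lemma topspace_indiscrete[simp]: "topspace (indiscrete S) = S"
  unfolding topspace_def by (auto simp: openin_indiscrete)

lemma continuous_map_into_indiscrete:
  "continuous_map X (indiscrete S) f \<longleftrightarrow> f \<in> topspace X \<rightarrow> S"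
proof
  assume f: "f \<in> topspace X \<rightarrow> S"
  then have "{x \<in> topspace X. f x \<in> S} = topspace X" by auto
  then show "continuous_map X (indiscrete S) f"
    using f by (auto simp: continuous_map_def openin_indiscrete)
qed (simp add: continuous_map_def)

text \<open>
  This is why the morphisms from a power of \<open>Y\<close> to a power of \<open>X\<close> have to be constants.
\<close>

lemma continuous_map_indiscrete_sierp:
  "continuous_map (indiscrete S) (sierp J) f \<longleftrightarrow>
    f \<in> S \<rightarrow> Pow J \<and> (\<forall>x\<in>S. \<forall>y\<in>S. f x = f y)"
proof -
  have "(\<forall>j\<in>J. {x \<in> S. j \<in> f x} = {} \<or> {x \<in> S. j \<in> f x} = S) \<longleftrightarrow> (\<forall>x\<in>S. \<forall>y\<in>S. f x = f y)"
    if "f \<in> S \<rightarrow> Pow J"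
  proof (intro iffI ballI)
    fix x y assume *: "\<forall>j\<in>J. {x \<in> S. j \<in> f x} = {} \<or> {x \<in> S. j \<in> f x} = S" and xy: "x \<in> S" "y \<in> S"
    have "f x \<subseteq> J" "f y \<subseteq> J" using that xy by auto
    moreover have "j \<in> f x \<longleftrightarrow> j \<in> f y" if "j \<in> J" for j using * that xy by blast
    ultimately show "f x = f y" by blast
  qed blast
  then show ?thesis
    unfolding continuous_map_sierp by (auto simp: openin_indiscrete)
qed

lemma (in free_theory) lawvere_compose:
  assumes "sm I" "sm J" "sm K" "f \<in> Hom (lawvere_theory A) I J" "g \<in> Hom (lawvere_theory A) J K"
  shows "Comp (lawvere_theory A) I J K g f \<in> Hom (lawvere_theory A) I K"
    and "R I K (Comp (lawvere_theory A) I J K g f) = compose (Pow I) (R J K g) (R I J f)"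
  using assms unfolding Hom_lawvere Comp_lawvere by (auto intro: Hom_compose realize_compose)

lemma (in free_theory) lawvere_iden:
  assumes "sm I"
  shows "Iden (lawvere_theory A) I \<in> Hom (lawvere_theory A) I I"
    and "R I I (Iden (lawvere_theory A) I) = (\<lambda>s\<in>Pow I. s)"
  using assms unfolding Hom_lawvere Iden_lawvere by (auto intro: Hom_id free_alg_obj realize_id)

lemma (in free_theory) lawvere_realize:
  assumes "sm I" "sm J" "f \<in> Hom (lawvere_theory A) I J"
  shows "R I J f \<in> Pow I \<rightarrow>\<^sub>E Pow J" "continuous_map (Sp I) (Sp J) (R I J f)"
  using assms unfolding Hom_lawvere by (auto dest: realize_continuous)

abbreviation disc_pow :: "'a set \<Rightarrow> 'a set topology" where
  "disc_pow I \<equiv> discrete_topology (Pow I)"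

abbreviation RF :: "'u set \<Rightarrow> 'u set \<Rightarrow> ('u \<Rightarrow> 'u) \<Rightarrow> 'u set \<Rightarrow> 'u set" where
  "RF \<equiv> realize frm_cat sierp"

abbreviation RB :: "'u set \<Rightarrow> 'u set \<Rightarrow> ('u \<Rightarrow> 'u) \<Rightarrow> 'u set \<Rightarrow> 'u set" where
  "RB \<equiv> realize caba_cat disc_pow"

text \<open>
  The space of an object of \<open>E\<close> has the power set of the exponent as its set of points. The
  objects \<open>XPow I\<close> and \<open>YPow I\<close> differ in the topology.
\<close>

fun expo :: "'u eobj \<Rightarrow> 'u set" where
  "expo (XPow I) = I"
| "expo (YPow I) = I"

abbreviation pts :: "'u eobj \<Rightarrow> 'u set set" where
  "pts a \<equiv> Pow (expo a)"

fun espace :: "'u eobj \<Rightarrow> 'u set topology" where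
  "espace (XPow I) = sierp I"
| "espace (YPow I) = indiscrete (Pow I)"

text \<open>
  A morphism \<open>f\<close> from \<open>YPow J\<close> to \<open>XPow I\<close> is given by a morphism of frames from the free frame on \<open>I\<close> to the
  initial frame, whose space has the empty set as its only point; the image of that point is the
  constant value.
\<close>

fun realizeE :: "'u eobj \<Rightarrow> 'u eobj \<Rightarrow> ('u \<Rightarrow> 'u) \<Rightarrow> 'u set \<Rightarrow> 'u set" where
  "realizeE (XPow I) (XPow J) f = RF I J f"
| "realizeE (YPow I) (YPow J) f = RB I J f"
| "realizeE (XPow I) (YPow J) f = RB I J f"
| "realizeE (YPow J) (XPow I) f = (\<lambda>s\<in>Pow J. RF {} I f {})"

lemma topspace_espace[simp]: "topspace (espace a) = pts a"
  by (cases a) simp_all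

text \<open>
  Extensional continuous maps, so that equality of maps means equality at all points.
\<close>

definition maps :: "'a topology \<Rightarrow> 'b topology \<Rightarrow> ('a \<Rightarrow> 'b) set" where
  "maps X Y = {u \<in> topspace X \<rightarrow>\<^sub>E topspace Y. continuous_map X Y u}"

lemma E_cat_simps[simp]:
  "Hom E_cat = E_hom" "Iden E_cat = E_iden" "Comp E_cat = E_comp"
  by (simp_all add: E_cat_def)

lemma Obj_E_cat: "a \<in> Obj (E_cat :: ('u eobj, 'u \<Rightarrow> 'u) cat) \<longleftrightarrow> small TYPE('u) (expo a)"
  unfolding E_cat_def lawvere_theory_def by (cases a) auto

context
  assumes universe: "set_universe TYPE('u)"
begin

interpretation F: free_theory "frm_cat :: ('u gorder, 'u \<Rightarrow> 'u) cat" sierp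
  by (rule free_theory_frame[OF universe])

interpretation B: free_theory "caba_cat :: ('u gorder, 'u \<Rightarrow> 'u) cat" disc_pow
  by (rule free_theory_caba[OF universe])

lemma small_empty: "small TYPE('u) ({} :: 'u set)"
  by (rule small_finite[OF universe]) simp

lemma free_caba_in_frm:
  assumes I: "small TYPE('u) (I :: 'u set)"
  shows "free_alg caba_cat I \<in> Obj (frm_cat :: ('u gorder, 'u \<Rightarrow> 'u) cat)"
  using B.free_alg_obj[OF I] by (simp add: caba_cat_def frm_cat_def is_frame_if_is_caba)

lemma comparison:
  fixes I :: "'u set"
  assumes I: "small TYPE('u) I"
  shows "comparison I \<in> frame_homs (free_alg frm_cat I) (free_alg caba_cat I)"
    and "i \<in> I \<Longrightarrow> comparison I (generator frm_cat I i) = generator caba_cat I i"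
proof -
  have "\<exists>!h. h \<in> frame_homs (free_alg frm_cat I) (free_alg caba_cat I) \<and>
     (\<forall>i\<in>I. h (generator frm_cat I i) = generator caba_cat I i)"
    using F.is_free_on_ex1[OF F.free_alg_free[OF I] free_caba_in_frm[OF I] B.gen_carrier[OF I]]
    by (simp add: frm_cat_def)
  then have "comparison I \<in> frame_homs (free_alg frm_cat I) (free_alg caba_cat I) \<and>
     (\<forall>i\<in>I. comparison I (generator frm_cat I i) = generator caba_cat I i)"
    unfolding comparison_def by (rule theI')
  then show "comparison I \<in> frame_homs (free_alg frm_cat I) (free_alg caba_cat I)"
    "i \<in> I \<Longrightarrow> comparison I (generator frm_cat I i) = generator caba_cat I i" by auto
qed

lemma comparison_carrier:
  "small TYPE('u) (I :: 'u set) \<Longrightarrow> x \<in> carrier (free_alg frm_cat I)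
    \<Longrightarrow> comparison I x \<in> carrier (free_alg caba_cat I)"
  using comparison(1)[of I] F.Hom_mem[of "comparison I" "free_alg frm_cat I" "free_alg caba_cat I" x]
  by (simp add: frm_cat_def)

text \<open>
  The comparison map from the free frame to the free CABA is the inclusion of the open sets into all
  sets: both are frame homomorphisms that respect the generators.
\<close>

lemma extent_comparison:
  fixes I :: "'u set"
  assumes I: "small TYPE('u) I" and x: "x \<in> carrier (free_alg frm_cat I)"
  shows "extent caba_cat disc_pow I (comparison I x) = extent frm_cat sierp I x"
proof -
  let ?FF = "free_alg frm_cat I" and ?FB = "free_alg caba_cat I"
  let ?D = "open_alg (disc_pow I) :: 'u gorder"
  let ?p = "preimage_hom (disc_pow I) (sierp I) (\<lambda>s. s) :: 'u \<Rightarrow> 'u"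
  have cont: "continuous_map (disc_pow I) (sierp I) (\<lambda>s. s)" by (simp add: Pi_iff)
  have D: "?D \<in> Obj frm_cat"
    using B.open_alg_obj[OF I] by (simp add: caba_cat_def frm_cat_def is_frame_if_is_caba)
  have k: "B.\<kappa> I \<in> frame_homs ?FB ?D"
    using B.to_concrete_hom[OF I] caba_homs_subset_frame_homs[of ?FB ?D] by (auto simp: caba_cat_def)
  have p: "?p \<in> frame_homs (open_alg (sierp I)) ?D"
    by (rule preimage_hom_frame[OF B.small_opens[OF I] F.small_opens[OF I] cont])
  have "compose (carrier ?FF) (B.\<kappa> I) (comparison I) = compose (carrier ?FF) ?p (F.\<kappa> I)"
  proof (rule F.free_hom_eqI[OF I D])
    show "compose (carrier ?FF) (B.\<kappa> I) (comparison I) \<in> Hom frm_cat ?FF ?D"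
      using frame_homs_compose[OF comparison(1)[OF I] k] by (simp add: frm_cat_def)
    show "compose (carrier ?FF) ?p (F.\<kappa> I) \<in> Hom frm_cat ?FF ?D"
      using F.to_concrete_hom[OF I] p by (intro F.Hom_compose) (auto simp: frm_cat_def)
    fix i assume i: "i \<in> I"
    have gi: "gen_in sierp I i \<in> carrier (open_alg (sierp I) :: 'u gorder)" by (intro enc_carrier openin_containing)
    have "{s. s \<subseteq> I \<and> s \<in> containing I i} = containing I i" by auto
    then have "?p (gen_in sierp I i) = gen_in disc_pow I i"
      unfolding preimage_hom_def using gi
      by (simp add: dec_enc[OF F.small_opens[OF I] openin_containing])
    then show "compose (carrier ?FF) (B.\<kappa> I) (comparison I) (F.gen I i) = compose (carrier ?FF) ?p (F.\<kappa> I) (F.gen I i)"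
      using i by (simp add: compose_def F.gen_carrier[OF I] comparison(2)[OF I] B.to_concrete_gen[OF I] F.to_concrete_gen[OF I])
  qed
  from fun_cong[OF this, of x] have k_eq: "B.\<kappa> I (comparison I x) = ?p (F.\<kappa> I x)"
    by (simp only: compose_eq[OF x])
  have "dec (disc_pow I) (?p (F.\<kappa> I x)) = {s \<in> topspace (disc_pow I). s \<in> F.extn I x}"
    unfolding extent_def
    by (rule dec_preimage_hom[OF B.small_opens[OF I] F.small_opens[OF I] cont F.Hom_mem[OF F.to_concrete_hom[OF I] x]])
  also have "\<dots> = F.extn I x" using F.extent_subset[OF I x] by auto
  finally show ?thesis by (simp only: extent_def[of caba_cat] k_eq)
qed

text \<open>
  The functor \<open>V\<close> does not change the underlying function. A homomorphism \<open>k\<close> of free CABAs satisfies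
  the equation that defines the value of \<open>V\<close> at \<open>h\<close> if and only if \<open>k\<close> and \<open>h\<close> have the same
  realization, and by \<open>realize_bij\<close> there is exactly one such \<open>k\<close>.
\<close>

lemma V_map:
  fixes I J :: "'u set"
  assumes I: "small TYPE('u) I" and J: "small TYPE('u) J" and h: "h \<in> Hom LF I J"
  shows "V_map I J h \<in> Hom LB I J" and "RB I J (V_map I J h) = RF I J h"
proof -
  have h': "h \<in> Hom frm_cat (F.FA J) (F.FA I)" using h by (simp add: F.Hom_lawvere)
  have cond: "(\<forall>x\<in>carrier (F.FA J). k (comparison J x) = comparison I (h x)) \<longleftrightarrow> RB I J k = RF I J h"
    if k: "k \<in> Hom LB I J" for k
  proof -
    have k': "k \<in> Hom caba_cat (B.FA J) (B.FA I)" using k by (simp add: B.Hom_lawvere)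
    have ek: "B.extn I (k (comparison J x)) = {s \<in> Pow I. RB I J k s \<in> F.extn J x}"
      if x: "x \<in> carrier (F.FA J)" for x
      using B.extent_hom[OF I J k' comparison_carrier[OF J x]] by (simp add: extent_comparison[OF J x])
    have eh: "B.extn I (comparison I (h x)) = {s \<in> Pow I. RF I J h s \<in> F.extn J x}"
      if x: "x \<in> carrier (F.FA J)" for x
      using F.extent_hom[OF I J h' x] by (simp add: extent_comparison[OF I F.Hom_mem[OF h' x]])
    show ?thesis
    proof
      assume eq: "\<forall>x\<in>carrier (F.FA J). k (comparison J x) = comparison I (h x)"
      have "RB I J k s = RF I J h s" if s: "s \<in> Pow I" for s
      proof -
        have sub: "RB I J k s \<subseteq> J" "RF I J h s \<subseteq> J"
          using PiE_mem[OF B.lawvere_realize(1)[OF I J k] s] PiE_mem[OF F.lawvere_realize(1)[OF I J h] s] by auto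
        have "j \<in> RB I J k s \<longleftrightarrow> j \<in> RF I J h s" if j: "j \<in> J" for j
          using ek[OF F.gen_carrier[OF J j]] eh[OF F.gen_carrier[OF J j]] eq F.gen_carrier[OF J j] s sub
          by (auto simp: F.extent_gen[OF J j] set_eq_iff)
        then show ?thesis using sub by blast
      qed
      then show "RB I J k = RF I J h"
        by (rule PiE_ext[OF B.lawvere_realize(1)[OF I J k] F.lawvere_realize(1)[OF I J h]])
    next
      assume eq: "RB I J k = RF I J h"
      show "\<forall>x\<in>carrier (F.FA J). k (comparison J x) = comparison I (h x)"
      proof
        fix x assume x: "x \<in> carrier (F.FA J)"
        show "k (comparison J x) = comparison I (h x)"
          using ek[OF x] eh[OF x] eq
          by (intro B.extent_inj[OF I] B.Hom_mem[OF k' comparison_carrier[OF J x]]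
              comparison_carrier[OF I F.Hom_mem[OF h' x]]) simp
      qed
    qed
  qed
  have "RF I J h \<in> Pow I \<rightarrow>\<^sub>E Pow J" by (rule F.lawvere_realize(1)[OF I J h])
  then have "RF I J h \<in> {u \<in> Pow I \<rightarrow>\<^sub>E Pow J. continuous_map (disc_pow I) (disc_pow J) u}" by auto
  then have "\<exists>!k. k \<in> Hom LB I J \<and> RB I J k = RF I J h"
    using B.realize_bij[OF I J] unfolding bij_betw_def inj_on_def by (smt (verit, best) imageE)
  then have "\<exists>!k. k \<in> Hom LB I J \<and> (\<forall>x\<in>carrier (F.FA J). k (comparison J x) = comparison I (h x))"
    using cond by metis
  then have "V_map I J h \<in> Hom LB I J \<and>
      (\<forall>x\<in>carrier (F.FA J). V_map I J h (comparison J x) = comparison I (h x))"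
    unfolding V_map_def by (rule theI')
  then show "V_map I J h \<in> Hom LB I J" "RB I J (V_map I J h) = RF I J h"
    using cond by auto
qed

text \<open>
  For maps into \<open>YPow J\<close> this is the case of the theory of CABAs, since continuity is no
  condition. For maps from \<open>YPow I\<close> to \<open>XPow J\<close> a function on the one-point space \<open>Pow {}\<close> is
  spread out to a constant function.
\<close>

lemma realizeE_bij:
  fixes a b :: "'u eobj"
  assumes a: "a \<in> Obj E_cat" and b: "b \<in> Obj E_cat"
  shows "bij_betw (realizeE a b) (E_hom a b) (maps (espace a) (espace b))"
proof -
  have sa: "small TYPE('u) (expo a)" and sb: "small TYPE('u) (expo b)"
    using a b by (simp_all add: Obj_E_cat)
  have Bmaps: "{u \<in> Pow I \<rightarrow>\<^sub>E Pow J. continuous_map (disc_pow I) (disc_pow J) u} = Pow I \<rightarrow>\<^sub>E Pow J"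
    for I J :: "'u set" by auto
  have into_Y: "maps (espace a) (indiscrete (Pow J)) = pts a \<rightarrow>\<^sub>E Pow J" for J :: "'u set"
    unfolding maps_def by (auto simp: continuous_map_into_indiscrete)
  show ?thesis
  proof (cases b)
    case (YPow J)
    have "bij_betw (RB (expo a) J) (Hom LB (expo a) J) (pts a \<rightarrow>\<^sub>E Pow J)"
      using B.realize_bij[OF sa, of J] sb Bmaps YPow by simp
    moreover have "realizeE a b = RB (expo a) J" "E_hom a b = Hom LB (expo a) J"
      unfolding YPow by (cases a; auto)+
    ultimately show ?thesis using into_Y YPow by simp
  next
    case X: (XPow J)
    show ?thesis
    proof (cases a)
      case (XPow I)
      have "realizeE (XPow I) (XPow J) = RF I J" by (rule HOL.ext) simp
      then show ?thesis
        using F.realize_bij[OF sa sb] X XPow by (simp add: maps_def)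
    next
      case (YPow I)
      let ?c = "\<lambda>v :: 'u set \<Rightarrow> 'u set. \<lambda>s\<in>Pow I. v {}"
      have J: "small TYPE('u) J" using sb X by simp
      have "bij_betw (RF {} J) (Hom LF {} J) {u \<in> Pow {} \<rightarrow>\<^sub>E Pow J. continuous_map (sierp {}) (sierp J) u}"
        by (rule F.realize_bij[OF small_empty J])
      moreover have "bij_betw ?c {u \<in> Pow {} \<rightarrow>\<^sub>E Pow J. continuous_map (sierp {}) (sierp J) u}
          (maps (indiscrete (Pow I)) (sierp J))"
      proof (rule bij_betw_byWitness[of _ "\<lambda>u. \<lambda>s\<in>Pow {}. u {}"])
        let ?A = "{u :: 'u set \<Rightarrow> 'u set. u \<in> Pow {} \<rightarrow>\<^sub>E Pow J \<and> continuous_map (sierp {}) (sierp J) u}"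
        show "\<forall>u\<in>?A. (\<lambda>s\<in>Pow {}. ?c u {}) = u"
          by (auto simp: fun_eq_iff PiE_iff extensional_def)
        show "\<forall>u\<in>maps (indiscrete (Pow I)) (sierp J). ?c (\<lambda>s\<in>Pow {}. u {}) = u"
        proof
          fix u assume u: "u \<in> maps (indiscrete (Pow I)) (sierp J)"
          then have "continuous_map (indiscrete (Pow I)) (sierp J) u" and uE: "u \<in> Pow I \<rightarrow>\<^sub>E Pow J"
            by (simp_all only: maps_def mem_Collect_eq topspace_indiscrete topspace_sierp)
          then have const: "\<And>s. s \<subseteq> I \<Longrightarrow> u s = u {}"
            unfolding continuous_map_indiscrete_sierp by blast
          have ext: "u \<in> extensional (Pow I)" using uE by (simp add: PiE_def)
          show "?c (\<lambda>s\<in>Pow {}. u {}) = u"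
          proof (rule HOL.ext)
            fix s show "?c (\<lambda>s\<in>Pow {}. u {}) s = u s"
            proof (cases "s \<in> Pow I")
              case True
              then show ?thesis using const[of s] by simp
            next
              case False
              then show ?thesis using extensional_arb[OF ext False] by simp
            qed
          qed
        qed
        show "?c ` ?A \<subseteq> maps (indiscrete (Pow I)) (sierp J)"
        proof (rule image_subsetI)
          fix u :: "'u set \<Rightarrow> 'u set" assume "u \<in> ?A"
          then have "u {} \<in> Pow J" by (intro PiE_mem[of u "Pow {}" "\<lambda>_. Pow J"]) simp_all
          then show "?c u \<in> maps (indiscrete (Pow I)) (sierp J)"
            unfolding maps_def continuous_map_indiscrete_sierp by (simp add: restrict_PiE_iff)
        qed
        have op: "openin (sierp {}) U" if "U \<subseteq> Pow {}" for U :: "'u set set"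
          using that unfolding openin_sierp by auto
        show "(\<lambda>u. \<lambda>s\<in>Pow {}. u {}) ` maps (indiscrete (Pow I)) (sierp J) \<subseteq> ?A"
        proof (rule image_subsetI)
          fix u :: "'u set \<Rightarrow> 'u set" assume "u \<in> maps (indiscrete (Pow I)) (sierp J)"
          then have "u {} \<in> Pow J"
            unfolding maps_def by (intro PiE_mem[of u "Pow I" "\<lambda>_. Pow J"]) simp_all
          moreover have "openin (sierp {}) {x \<in> Pow {}. j \<in> (\<lambda>s\<in>Pow {}. u {}) (x :: 'u set)}" for j
            by (rule op) auto
          ultimately show "(\<lambda>s\<in>Pow {}. u {}) \<in> ?A"
            unfolding continuous_map_sierp by (simp add: restrict_PiE_iff)
        qed
      qed
      ultimately have "bij_betw (?c \<circ> RF {} J) (Hom LF {} J) (maps (indiscrete (Pow I)) (sierp J))"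
        by (rule bij_betw_trans)
      moreover have "realizeE a b = ?c \<circ> RF {} J"
        unfolding X YPow by (auto simp: fun_eq_iff)
      ultimately show ?thesis using X YPow by simp
    qed
  qed
qed

lemma realizeE_in:
  fixes a b :: "'u eobj"
  assumes "a \<in> Obj E_cat" "b \<in> Obj E_cat" "f \<in> E_hom a b"
  shows "realizeE a b f \<in> maps (espace a) (espace b)"
  using realizeE_bij[OF assms(1,2)] assms(3) by (rule bij_betwE[rule_format])

lemma realizeE_iden:
  fixes a :: "'u eobj"
  assumes "a \<in> Obj E_cat"
  shows "E_iden a \<in> E_hom a a" "realizeE a a (E_iden a) = (\<lambda>s\<in>pts a. s)"
  using assms F.lawvere_iden B.lawvere_iden unfolding Obj_E_cat by (cases a; simp)+

text \<open>
  The eight cases of the definition of composition in \<open>E\<close> all describe composition of functions.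
  Powers with exponent \<open>{}\<close> have a single point, which disposes of the cases that involve morphisms to the terminal
  object.
\<close>

lemma realizeE_comp:
  fixes a b c :: "'u eobj"
  assumes a: "a \<in> Obj E_cat" and b: "b \<in> Obj E_cat" and c: "c \<in> Obj E_cat"
    and f: "f \<in> E_hom a b" and g: "g \<in> E_hom b c"
  shows "E_comp a b c g f \<in> E_hom a c \<and>
    realizeE a c (E_comp a b c g f) = compose (pts a) (realizeE b c g) (realizeE a b f)"
proof -
  have s: "small TYPE('u) (expo a)" "small TYPE('u) (expo b)" "small TYPE('u) (expo c)"
    using a b c by (simp_all add: Obj_E_cat)
  have pE: "realizeE a b f s \<in> pts b" if "s \<in> pts a" for s
    using realizeE_in[OF a b f] that by (auto simp: maps_def)
  have RB0: "RB I {} h s = {}" if "s \<subseteq> I" for I :: "'u set" and h s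
    using that by (auto simp: realize_def)
  have RF0: "RF I {} h s = {}" if "s \<subseteq> I" for I :: "'u set" and h s
    using that by (auto simp: realize_def)
  note termF = F.to_terminal[folded F.Hom_lawvere] and termB = B.to_terminal[folded B.Hom_lawvere]
  show ?thesis
  proof (cases a)
    case a: (XPow I)
    show ?thesis
    proof (cases b)
      case b: (XPow J)
      then show ?thesis
        using a s f g by (cases c) (auto simp: F.lawvere_compose B.lawvere_compose V_map)
    next
      case b: (YPow J)
      show ?thesis
      proof (cases c)
        case c: (XPow K)
        have t: "to_terminal LF I \<in> Hom LF I {}" using termF s a by simp
        have g': "g \<in> Hom LF {} K" using g b c by simp
        have "compose (Pow I) (RF {} K g) (RF I {} (to_terminal LF I)) =
            compose (Pow I) (\<lambda>s\<in>Pow J. RF {} K g {}) (RB I J f)"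
          using pE a b by (auto simp: compose_def fun_eq_iff RF0)
        then show ?thesis
          using a b c s F.lawvere_compose[OF _ small_empty _ t g'] by simp
      next
        case (YPow K)
        then show ?thesis using a b s f g by (auto simp: B.lawvere_compose)
      qed
    qed
  next
    case a: (YPow I)
    show ?thesis
    proof (cases b)
      case b: (XPow J)
      have f': "f \<in> Hom LF {} J" using a b f by simp
      show ?thesis
      proof (cases c)
        case c: (XPow K)
        have "RF {} J f {} \<in> Pow J"
          using PiE_mem[OF F.lawvere_realize(1)[OF small_empty _ f'], of "{}"] s b by simp
        then show ?thesis
          using a b c s f' g F.lawvere_compose[OF small_empty _ _ f', of K g]
          by (auto simp: compose_def fun_eq_iff)
      next
        case c: (YPow K)
        have J: "small TYPE('u) J" and K: "small TYPE('u) K" and I: "small TYPE('u) I" using s a b c by auto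
        have g': "g \<in> Hom LB J K" using g b c by simp
        have t: "to_terminal LB I \<in> Hom LB I {}" using termB I by simp
        note V = V_map[OF small_empty J f']
        note gV = B.lawvere_compose[OF small_empty J K V(1) g']
        note all = B.lawvere_compose[OF I small_empty K t gV(1)]
        have "RF {} J f {} \<in> Pow J"
          using PiE_mem[OF F.lawvere_realize(1)[OF small_empty _ f'], of "{}"] s b by simp
        then show ?thesis
          using a b c all by (auto simp: gV V compose_def fun_eq_iff RB0)
      qed
    next
      case b: (YPow J)
      show ?thesis
      proof (cases c)
        case c: (XPow K)
        then show ?thesis
          using a b g pE by (auto simp: compose_def fun_eq_iff)
      next
        case c: (YPow K)
        then show ?thesis
          using a b f g s by (auto simp: B.lawvere_compose)
      qed
    qed
  qed
qed

lemma realizeE_inj: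
  fixes a b :: "'u eobj"
  assumes "a \<in> Obj E_cat" "b \<in> Obj E_cat" "f \<in> E_hom a b" "f' \<in> E_hom a b"
    "realizeE a b f = realizeE a b f'"
  shows "f = f'"
  using realizeE_bij[OF assms(1,2)] assms(3-5) unfolding bij_betw_def inj_on_def by blast

text \<open>
  The realization is faithful and respects composition, so the axioms hold because they hold for functions.
\<close>

lemma category_E: "category (E_cat :: ('u eobj, 'u \<Rightarrow> 'u) cat)"
  unfolding category_def E_cat_simps
proof (intro conjI ballI)
  fix a b c :: "'u eobj" and f g assume *: "a \<in> Obj E_cat" "b \<in> Obj E_cat" "c \<in> Obj E_cat" "f \<in> E_hom a b" "g \<in> E_hom b c"
  show "E_comp a b c g f \<in> E_hom a c" using realizeE_comp[OF *] by blast
next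
  fix a :: "'u eobj" assume "a \<in> Obj E_cat"
  then show "E_iden a \<in> E_hom a a" by (rule realizeE_iden)
next
  fix a b :: "'u eobj" and f assume *: "a \<in> Obj E_cat" "b \<in> Obj E_cat" "f \<in> E_hom a b"
  have r: "realizeE a b f \<in> pts a \<rightarrow>\<^sub>E pts b" using realizeE_in[OF *] by (simp add: maps_def)
  have "compose (pts a) (realizeE a b f) (\<lambda>s\<in>pts a. s) = realizeE a b f"
    "compose (pts a) (\<lambda>s\<in>pts b. s) (realizeE a b f) = realizeE a b f"
    using r by (auto simp: compose_def fun_eq_iff PiE_iff extensional_def)
  then show "E_comp a a b f (E_iden a) = f" "E_comp a b b (E_iden b) f = f"
    using realizeE_comp[of a a b "E_iden a" f] realizeE_comp[of a b b f "E_iden b"] realizeE_iden[of a] realizeE_iden[of b] *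
    by (auto intro: realizeE_inj[of a b])
next
  fix a b c d :: "'u eobj" and f g h
  assume *: "a \<in> Obj E_cat" "b \<in> Obj E_cat" "c \<in> Obj E_cat" "d \<in> Obj E_cat"
    "f \<in> E_hom a b" "g \<in> E_hom b c" "h \<in> E_hom c d"
  have r: "realizeE a b f \<in> pts a \<rightarrow> pts b" using realizeE_in[OF *(1,2,5)] by (auto simp: maps_def)
  note gf = realizeE_comp[OF *(1,2,3,5,6)] and hg = realizeE_comp[OF *(2,3,4,6,7)]
  note h_gf = realizeE_comp[OF *(1,3,4) conjunct1[OF gf] *(7)]
  note hg_f = realizeE_comp[OF *(1,2,4,5) conjunct1[OF hg]]
  show "E_comp a c d h (E_comp a b c g f) = E_comp a b d (E_comp b c d h g) f"
  proof (rule realizeE_inj[OF *(1,4) conjunct1[OF h_gf] conjunct1[OF hg_f]])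
    show "realizeE a d (E_comp a c d h (E_comp a b c g f)) = realizeE a d (E_comp a b d (E_comp b c d h g) f)"
      using r gf hg h_gf hg_f by (auto simp: compose_def fun_eq_iff)
  qed
qed

end

section \<open>The sketch is realized\<close>

fun unit_obj :: "'u eobj \<Rightarrow> 'u eobj" where
  "unit_obj (XPow I) = XPow one_point"
| "unit_obj (YPow I) = YPow one_point"

fun proj_mor :: "'u eobj \<Rightarrow> 'u \<Rightarrow> 'u \<Rightarrow> 'u" where
  "proj_mor (XPow I) = power_proj frm_cat I"
| "proj_mor (YPow I) = power_proj caba_cat I"

text \<open>
  The \<open>i\<close>-th coordinate of a subset \<open>s\<close> of \<open>I\<close>, as a truth value, that is, as a subset of the
  one-element exponent: it is the whole exponent if \<open>i \<in> s\<close> and empty otherwise.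
\<close>

definition proj :: "'u set \<Rightarrow> 'u \<Rightarrow> 'u set \<Rightarrow> 'u set" where
  "proj I i = (\<lambda>s\<in>Pow I. {j \<in> one_point. i \<in> s})"

lemma expo_unit[simp]: "expo (unit_obj a) = one_point"
  by (cases a) auto

lemma E_cones_eq:
  "(E_cones :: ('u + cospan, unit, 'u eobj, 'u \<Rightarrow> 'u) cone set) =
     {power_cone E_cat (expo a) a (unit_obj a) (proj_mor a) | a. a \<in> Obj E_cat} \<union>
     {mono_cone E_cat (XPow one_point) (YPow one_point) phi}"
proof -
  have "(\<exists>a. P a) \<longleftrightarrow> (\<exists>I. P (XPow I)) \<or> (\<exists>I. P (YPow I))" for P :: "'u eobj \<Rightarrow> bool"
    by (metis eobj.exhaust)
  then show ?thesis unfolding E_cones_def by (auto simp: Obj_E_cat)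
qed

lemma maps_mem: "u \<in> maps X Y \<Longrightarrow> x \<in> topspace X \<Longrightarrow> u x \<in> topspace Y"
  unfolding maps_def by auto

lemma maps_ext: "u \<in> maps X Y \<Longrightarrow> v \<in> maps X Y \<Longrightarrow> (\<And>x. x \<in> topspace X \<Longrightarrow> u x = v x) \<Longrightarrow> u = v"
  unfolding maps_def by (blast intro: PiE_ext)

lemma maps_compose:
  "u \<in> maps X Y \<Longrightarrow> v \<in> maps Y Z \<Longrightarrow> compose (topspace X) v u \<in> maps X Z"
proof -
  assume u: "u \<in> maps X Y" and v: "v \<in> maps Y Z"
  then have "continuous_map X Z (v \<circ> u)"
    unfolding maps_def by (blast intro: continuous_map_compose)
  then have "continuous_map X Z (compose (topspace X) v u)"
    by (rule continuous_map_eq) (simp add: compose_def)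
  then show ?thesis
    using maps_mem[OF u] maps_mem[OF v] unfolding maps_def by (auto simp: compose_def)
qed

lemma maps_espace_iff:
  "u \<in> maps T (espace a) \<longleftrightarrow> u \<in> topspace T \<rightarrow>\<^sub>E pts a \<and>
    (\<forall>I. a = XPow I \<longrightarrow> (\<forall>i\<in>I. openin T {x \<in> topspace T. i \<in> u x}))"
  by (cases a) (auto simp: maps_def continuous_map_into_indiscrete continuous_map_sierp PiE_def)

text \<open>
  The space of an object is a product of copies of the space of the distinguished object. The
  map with coordinates \<open>v i\<close> collects the indices at which \<open>v i\<close> is true. The space \<open>T\<close>
  is arbitrary: for the space of an object of \<open>E\<close> this shows that the powers in \<open>E\<close> are limits, and
  in general it shows that maps out of \<open>T\<close> form a model.
\<close>

lemma maps_power_universal: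
  fixes a :: "'u eobj"
  assumes v: "\<And>i. i \<in> expo a \<Longrightarrow> v i \<in> maps T (espace (unit_obj a))"
  shows "\<exists>!w. w \<in> maps T (espace a) \<and> (\<forall>i\<in>expo a. compose (topspace T) (proj (expo a) i) w = v i)"
proof (rule ex1I)
  let ?w = "\<lambda>x\<in>topspace T. {i \<in> expo a. undefined \<in> v i x}"
  have sub: "v i x \<subseteq> one_point" if "i \<in> expo a" "x \<in> topspace T" for i x
    using maps_mem[OF v[OF that(1)] that(2)] by simp
  have "?w \<in> maps T (espace a)"
    unfolding maps_espace_iff
  proof (intro conjI allI impI ballI)
    show "?w \<in> topspace T \<rightarrow>\<^sub>E pts a" by (auto simp: restrict_PiE_iff)
    fix I i assume a: "a = XPow I" and i: "i \<in> I"
    have "openin T {x \<in> topspace T. undefined \<in> v i x}"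
      using v[of i] i unfolding maps_espace_iff a by simp
    moreover have "{x \<in> topspace T. i \<in> ?w x} = {x \<in> topspace T. undefined \<in> v i x}"
      using i a by auto
    ultimately show "openin T {x \<in> topspace T. i \<in> ?w x}" by simp
  qed
  moreover have "compose (topspace T) (proj (expo a) i) ?w = v i" if i: "i \<in> expo a" for i
  proof (rule extensionalityI[of _ "topspace T"])
    show "v i \<in> extensional (topspace T)" using v[OF i] by (auto simp: maps_def PiE_def)
    fix x assume x: "x \<in> topspace T"
    show "compose (topspace T) (proj (expo a) i) ?w x = v i x"
      using x i sub[OF i x] by (auto simp: compose_def proj_def)
  qed simp
  ultimately show "?w \<in> maps T (espace a) \<and> (\<forall>i\<in>expo a. compose (topspace T) (proj (expo a) i) ?w = v i)"
    by blast
  fix w assume w: "w \<in> maps T (espace a) \<and> (\<forall>i\<in>expo a. compose (topspace T) (proj (expo a) i) w = v i)"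
  show "w = ?w"
  proof (rule maps_ext[OF conjunct1[OF w] \<open>?w \<in> maps T (espace a)\<close>])
    fix x assume x: "x \<in> topspace T"
    have wx: "w x \<subseteq> expo a" using maps_mem[OF conjunct1[OF w] x] by simp
    have "i \<in> w x \<longleftrightarrow> undefined \<in> v i x" if i: "i \<in> expo a" for i
    proof -
      have "v i x = proj (expo a) i (w x)" using w i x by (metis compose_eq)
      then show ?thesis using wx by (simp add: proj_def)
    qed
    then show "w x = ?w x" using wx x by auto
  qed
qed

context
  assumes universe: "set_universe TYPE('u)"
begin

interpretation F: free_theory "frm_cat :: ('u gorder, 'u \<Rightarrow> 'u) cat" sierp
  by (rule free_theory_frame[OF universe])

interpretation B: free_theory "caba_cat :: ('u gorder, 'u \<Rightarrow> 'u) cat" disc_pow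
  by (rule free_theory_caba[OF universe])

lemma small_point: "small TYPE('u) {x :: 'v}"
  by (rule small_finite[OF universe]) simp

lemma unit_obj_Obj: "unit_obj a \<in> Obj (E_cat :: ('u eobj, 'u \<Rightarrow> 'u) cat)"
  by (simp add: Obj_E_cat small_point)

lemma proj_mor:
  fixes a :: "'u eobj"
  assumes "a \<in> Obj E_cat" "i \<in> expo a"
  shows "proj_mor a i \<in> E_hom a (unit_obj a)" "realizeE a (unit_obj a) (proj_mor a i) = proj (expo a) i"
  using assms F.power_proj B.power_proj unfolding Obj_E_cat proj_def
  by (cases a; simp add: F.Hom_lawvere B.Hom_lawvere)+

lemma phi: "phi \<in> E_hom (XPow one_point) (YPow (one_point :: 'u set))"
    "realizeE (XPow one_point) (YPow (one_point :: 'u set)) phi = (\<lambda>s\<in>Pow one_point. s)"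
  using B.lawvere_iden[OF small_point] by (simp_all add: phi_def)

lemma E_power_universal:
  fixes a c :: "'u eobj"
  assumes a: "a \<in> Obj E_cat" and c: "c \<in> Obj E_cat"
    and g: "\<And>i. i \<in> expo a \<Longrightarrow> g i \<in> E_hom c (unit_obj a)"
  shows "\<exists>!u. u \<in> E_hom c a \<and> (\<forall>i\<in>expo a. E_comp c a (unit_obj a) (proj_mor a i) u = g i)"
proof -
  note bij = realizeE_bij[OF universe c a]
  have *: "E_comp c a (unit_obj a) (proj_mor a i) u = g i \<longleftrightarrow>
      compose (pts c) (proj (expo a) i) (realizeE c a u) = realizeE c (unit_obj a) (g i)"
    if "u \<in> E_hom c a" "i \<in> expo a" for u i
    using realizeE_comp[OF universe c a unit_obj_Obj that(1) proj_mor(1)[OF a that(2)]] proj_mor(2)[OF a that(2)]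
      realizeE_inj[OF universe c unit_obj_Obj _ g[OF that(2)]] by metis
  have "\<exists>!w. w \<in> maps (espace c) (espace a) \<and>
      (\<forall>i\<in>expo a. compose (topspace (espace c)) (proj (expo a) i) w = realizeE c (unit_obj a) (g i))"
    by (rule maps_power_universal) (rule realizeE_in[OF universe c unit_obj_Obj g])
  then obtain w where w': "w \<in> maps (espace c) (espace a) \<and>
      (\<forall>i\<in>expo a. compose (topspace (espace c)) (proj (expo a) i) w = realizeE c (unit_obj a) (g i))"
    and uniq': "\<forall>w'. w' \<in> maps (espace c) (espace a) \<and>
      (\<forall>i\<in>expo a. compose (topspace (espace c)) (proj (expo a) i) w' = realizeE c (unit_obj a) (g i)) \<longrightarrow> w' = w"
    by (rule ex1E)
  have w: "w \<in> maps (espace c) (espace a)"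
      "\<And>i. i \<in> expo a \<Longrightarrow> compose (pts c) (proj (expo a) i) w = realizeE c (unit_obj a) (g i)"
    using w' by simp_all
  have uniq: "w' = w" if "w' \<in> maps (espace c) (espace a)"
      "\<And>i. i \<in> expo a \<Longrightarrow> compose (pts c) (proj (expo a) i) w' = realizeE c (unit_obj a) (g i)" for w'
    using uniq'[rule_format, of w'] that by simp
  obtain u where u: "u \<in> E_hom c a" "realizeE c a u = w"
    using bij w(1) by (metis bij_betw_def imageE)
  show ?thesis
  proof (rule ex1I[of _ u])
    show "u \<in> E_hom c a \<and> (\<forall>i\<in>expo a. E_comp c a (unit_obj a) (proj_mor a i) u = g i)"
      using u w(2) *[OF u(1)] by simp
    fix u' assume u': "u' \<in> E_hom c a \<and> (\<forall>i\<in>expo a. E_comp c a (unit_obj a) (proj_mor a i) u' = g i)"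
    then have "realizeE c a u' = w"
      using * by (intro uniq realizeE_in[OF universe c a]) auto
    then show "u' = u" using realizeE_inj[OF universe c a conjunct1[OF u'] u(1)] u(2) by simp
  qed
qed

lemma X_Obj: "XPow one_point \<in> Obj (E_cat :: ('u eobj, 'u \<Rightarrow> 'u) cat)"
  and Y_Obj: "YPow one_point \<in> Obj (E_cat :: ('u eobj, 'u \<Rightarrow> 'u) cat)"
  by (simp_all add: Obj_E_cat small_point)

text \<open>
  The realization of \<open>phi\<close> is an identity function, hence injective.
\<close>

lemma phi_mono: "is_mono E_cat (XPow one_point) (YPow (one_point :: 'u set)) phi"
  unfolding is_mono_def E_cat_simps
proof (intro ballI impI)
  fix c :: "'u eobj" and u v
  assume c: "c \<in> Obj E_cat" and u: "u \<in> E_hom c (XPow one_point)" and v: "v \<in> E_hom c (XPow one_point)"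
    and eq: "E_comp c (XPow one_point) (YPow one_point) phi u = E_comp c (XPow one_point) (YPow one_point) phi v"
  let ?r = "realizeE c (XPow one_point)"
  note ru = realizeE_in[OF universe c X_Obj u] and rv = realizeE_in[OF universe c X_Obj v]
  have "compose (pts c) (\<lambda>s\<in>Pow one_point. s) (?r u) = compose (pts c) (\<lambda>s\<in>Pow one_point. s) (?r v)"
    using realizeE_comp[OF universe c X_Obj Y_Obj u phi(1)] realizeE_comp[OF universe c X_Obj Y_Obj v phi(1)] eq phi(2)
    by metis
  then have *: "compose (pts c) (\<lambda>s\<in>Pow one_point. s) (?r u) s = compose (pts c) (\<lambda>s\<in>Pow one_point. s) (?r v) s" for s
    by (rule fun_cong)
  have "?r u s = ?r v s" if s: "s \<in> pts c" for s
    using *[of s] maps_mem[OF ru, of s] maps_mem[OF rv, of s] s by (simp add: compose_def del: Pow_insert)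
  then have "?r u = ?r v" using maps_ext[OF ru rv] by simp
  then show "u = v" by (rule realizeE_inj[OF universe c X_Obj u v])
qed

text \<open>
  The form in which models are used from now on, in terms of elements.
\<close>

lemma functor_E_model_iff:
  fixes M :: "('u eobj, 'u \<Rightarrow> 'u, 'v set, 'v \<Rightarrow> 'v) funct"
  assumes M: "is_functor E_cat (set_cat TYPE('u)) M"
  shows "is_model TYPE('u) E_cat E_cones M \<longleftrightarrow>
    (\<forall>a\<in>Obj E_cat. \<forall>g. (\<forall>i\<in>expo a. g i \<in> fobj M (unit_obj a)) \<longrightarrow>
       (\<exists>!z. z \<in> fobj M a \<and> (\<forall>i\<in>expo a. fmap M a (unit_obj a) (proj_mor a i) z = g i))) \<and>
    inj_on (fmap M (XPow one_point) (YPow one_point) phi) (fobj M (XPow one_point))"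
proof -
  have sm: "small TYPE('u) (fobj M a)" if "a \<in> Obj E_cat" for a
    using functor_obj[OF M that] by simp
  have power: "is_limit_cone (set_cat TYPE('u)) (map_cone M (power_cone E_cat (expo a) a (unit_obj a) (proj_mor a)
        :: ('u + cospan, unit, 'u eobj, 'u \<Rightarrow> 'u) cone))
      \<longleftrightarrow> (\<forall>g. (\<forall>i\<in>expo a. g i \<in> fobj M (unit_obj a)) \<longrightarrow>
       (\<exists>!z. z \<in> fobj M a \<and> (\<forall>i\<in>expo a. fmap M a (unit_obj a) (proj_mor a i) z = g i)))"
    if a: "a \<in> Obj E_cat" for a
  proof -
    let ?K = "map_cone M (power_cone E_cat (expo a) a (unit_obj a) (proj_mor a)) :: ('u + cospan, unit, 'v set, 'v \<Rightarrow> 'v) cone"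
    have iden: "fmap M (unit_obj a) (unit_obj a) (Iden E_cat (unit_obj a)) = Iden (set_cat TYPE('u)) (fobj M (unit_obj a))"
      by (rule functor_iden[OF M unit_obj_Obj])
    have "leg ?K (Inl i) \<in> apex ?K \<rightarrow>\<^sub>E fobj M (unit_obj a)" if i: "i \<in> expo a" for i
      using functor_map[OF M a unit_obj_Obj, of "proj_mor a i"] proj_mor(1)[OF a i]
      by (simp add: map_cone_def power_cone_def)
    then have "is_limit_cone (set_cat TYPE('u)) ?K \<longleftrightarrow>
      (\<forall>g. (\<forall>i\<in>expo a. g i \<in> fobj M (unit_obj a)) \<longrightarrow>
         (\<exists>!z. z \<in> apex ?K \<and> (\<forall>i\<in>expo a. leg ?K (Inl i) z = g i)))"
      using sm[OF a] sm[OF unit_obj_Obj] iden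
      by (intro is_limit_cone_set_power_iff small_point)
        (simp_all add: map_cone_def power_cone_def comp_functor_def)
    then show ?thesis by (simp add: map_cone_def power_cone_def)
  qed
  have mono: "is_limit_cone (set_cat TYPE('u)) (map_cone M (mono_cone E_cat (XPow one_point) (YPow one_point) phi
        :: ('u + cospan, unit, 'u eobj, 'u \<Rightarrow> 'u) cone))
      \<longleftrightarrow> inj_on (fmap M (XPow one_point) (YPow one_point) phi) (fobj M (XPow one_point))"
  proof -
    let ?K = "map_cone M (mono_cone E_cat (XPow one_point) (YPow one_point) phi) :: ('u + cospan, unit, 'v set, 'v \<Rightarrow> 'v) cone"
    have f: "fmap M (XPow one_point) (YPow one_point) phi \<in> fobj M (XPow one_point) \<rightarrow>\<^sub>E fobj M (YPow one_point)"
      using functor_map[OF M X_Obj Y_Obj, of phi] phi(1) by simp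
    have "is_limit_cone (set_cat TYPE('u)) ?K \<longleftrightarrow>
      is_mono (set_cat TYPE('u)) (fobj M (XPow one_point)) (fobj M (YPow one_point))
        (fmap M (XPow one_point) (YPow one_point) phi)"
      using sm[OF X_Obj] sm[OF Y_Obj] f functor_iden[OF M X_Obj] functor_iden[OF M Y_Obj]
      by (intro is_limit_cone_mono_iff category_set_cat)
        (auto simp: map_cone_def mono_cone_def comp_functor_def fun_eq_iff)
    also have "\<dots> \<longleftrightarrow> inj_on (fmap M (XPow one_point) (YPow one_point) phi) (fobj M (XPow one_point))"
      by (rule is_mono_set_cat_iff[OF small_point f])
    finally show ?thesis .
  qed
  have "(\<forall>K\<in>E_cones. P K) \<longleftrightarrow> (\<forall>a\<in>Obj E_cat. P (power_cone E_cat (expo a) a (unit_obj a) (proj_mor a))) \<and>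
      P (mono_cone E_cat (XPow one_point) (YPow one_point) phi)"
    for P :: "('u + cospan, unit, 'u eobj, 'u \<Rightarrow> 'u) cone \<Rightarrow> bool"
    unfolding E_cones_eq by (simp only: ball_Un) blast
  then show ?thesis
    unfolding is_model_def by (simp only: M power mono simp_thms cong: ball_cong)
qed

lemma E_cones_limits:
  assumes K: "K \<in> (E_cones :: ('u + cospan, unit, 'u eobj, 'u \<Rightarrow> 'u) cone set)"
  shows "is_limit_cone E_cat K"
  using K unfolding E_cones_eq
proof
  assume "K \<in> {power_cone E_cat (expo a) a (unit_obj a) (proj_mor a) |a. a \<in> Obj E_cat}"
  then obtain a where a: "a \<in> Obj E_cat" and K: "K = power_cone E_cat (expo a) a (unit_obj a) (proj_mor a)" by blast
  show ?thesis
  proof (rule is_limit_cone_powerI[OF category_E[OF universe] unit_obj_Obj])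
    show "apex K \<in> Obj E_cat" using a by (simp add: K power_cone_def)
    show "shape K = thin_cat (Inl ` expo a) (=)"
      "diagram K = \<lparr>fobj = \<lambda>_. unit_obj a, fmap = \<lambda>_ _ _. Iden E_cat (unit_obj a)\<rparr>"
      by (simp_all add: K power_cone_def)
    show "leg K (Inl i) \<in> Hom E_cat (apex K) (unit_obj a)" if "i \<in> expo a" for i
      using proj_mor(1)[OF a that] by (simp add: K power_cone_def)
    fix c g assume c: "c \<in> Obj E_cat" and g: "\<And>i. i \<in> expo a \<Longrightarrow> g i \<in> Hom E_cat c (unit_obj a)"
    have "\<exists>!u. u \<in> E_hom c a \<and> (\<forall>i\<in>expo a. E_comp c a (unit_obj a) (proj_mor a i) u = g i)"
      by (rule E_power_universal[OF a c]) (use g in simp)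
    then show "\<exists>!u. u \<in> Hom E_cat c (apex K) \<and>
        (\<forall>i\<in>expo a. Comp E_cat c (apex K) (unit_obj a) (leg K (Inl i)) u = g i)"
      by (simp add: K power_cone_def)
  qed
next
  assume "K \<in> {mono_cone E_cat (XPow one_point) (YPow one_point) phi}"
  then have K: "K = mono_cone E_cat (XPow one_point) (YPow one_point) phi" by simp
  have "is_limit_cone E_cat K \<longleftrightarrow> is_mono E_cat (XPow one_point) (YPow (one_point :: 'u set)) phi"
    using phi(1)
    by (intro is_limit_cone_mono_iff[OF category_E[OF universe] X_Obj Y_Obj])
      (simp_all add: K mono_cone_def)
  then show ?thesis using phi_mono by simp
qed

lemma small_E_hom:
  fixes a b :: "'u eobj"
  assumes a: "a \<in> Obj E_cat" and b: "b \<in> Obj E_cat"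
  shows "small TYPE('u) (E_hom a b)"
proof (rule small_inj)
  show "inj_on (realizeE a b) (E_hom a b)"
    using realizeE_bij[OF universe a b] by (simp add: bij_betw_def)
  have "realizeE a b ` E_hom a b \<subseteq> pts a \<rightarrow>\<^sub>E pts b"
    using realizeE_bij[OF universe a b] by (auto simp: bij_betw_def maps_def)
  then show "small TYPE('u) (realizeE a b ` E_hom a b)"
    using a b by (rule_tac small_subset) (auto simp: Obj_E_cat intro!: small_PiE[OF universe] small_Pow[OF universe])
qed

lemma hom_functor_functor:
  fixes a :: "'u eobj"
  assumes a: "a \<in> Obj E_cat"
  shows "is_functor E_cat (set_cat TYPE('u)) (hom_functor E_cat a)"
  unfolding is_functor_def hom_functor_def
proof (simp only: funct.simps, intro conjI ballI)
  note C = category_E[OF universe]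
  note [simp] = category_comp_in[OF C, simplified] category_idenI[OF C, simplified] category_unit[OF C, simplified]
  fix b :: "'u eobj" assume b: "b \<in> Obj E_cat"
  show "Hom E_cat a b \<in> Obj (set_cat TYPE('u))" using small_E_hom[OF a b] by simp
  show "(\<lambda>f\<in>Hom E_cat a b. Comp E_cat a b b (Iden E_cat b) f) = Iden (set_cat TYPE('u)) (Hom E_cat a b)"
    using a b by (auto simp: fun_eq_iff)
  fix c :: "'u eobj" and f assume c: "c \<in> Obj E_cat" and f: "f \<in> Hom E_cat b c"
  show "(\<lambda>g\<in>Hom E_cat a b. Comp E_cat a b c f g) \<in> Hom (set_cat TYPE('u)) (Hom E_cat a b) (Hom E_cat a c)"
    using a b c f by auto
  fix d :: "'u eobj" and g assume d: "d \<in> Obj E_cat" and g: "g \<in> Hom E_cat c d"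
  show "(\<lambda>h\<in>Hom E_cat a b. Comp E_cat a b d (Comp E_cat b c d g f) h) =
     Comp (set_cat TYPE('u)) (Hom E_cat a b) (Hom E_cat a c) (Hom E_cat a d)
       (\<lambda>h\<in>Hom E_cat a c. Comp E_cat a c d g h) (\<lambda>h\<in>Hom E_cat a b. Comp E_cat a b c f h)"
    using a b c d f g category_assoc[OF C a b c d] by (auto simp: fun_eq_iff compose_def)
qed

lemma hom_functor_model:
  fixes a :: "'u eobj"
  assumes a: "a \<in> Obj E_cat"
  shows "is_model TYPE('u) E_cat E_cones (hom_functor E_cat a)"
  unfolding functor_E_model_iff[OF hom_functor_functor[OF a]]
proof (intro conjI ballI allI impI)
  fix b :: "'u eobj" and g
  assume b: "b \<in> Obj E_cat" and g: "\<forall>i\<in>expo b. g i \<in> fobj (hom_functor E_cat a) (unit_obj b)"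
  have "\<exists>!u. u \<in> E_hom a b \<and> (\<forall>i\<in>expo b. E_comp a b (unit_obj b) (proj_mor b i) u = g i)"
    using g by (intro E_power_universal[OF b a]) (simp add: hom_functor_def)
  then show "\<exists>!z. z \<in> fobj (hom_functor E_cat a) b \<and>
      (\<forall>i\<in>expo b. fmap (hom_functor E_cat a) b (unit_obj b) (proj_mor b i) z = g i)"
    by (simp add: hom_functor_def cong: conj_cong)
next
  show "inj_on (fmap (hom_functor E_cat a) (XPow one_point) (YPow one_point) phi) (fobj (hom_functor E_cat a) (XPow one_point))"
    using phi_mono a unfolding is_mono_def by (auto simp: hom_functor_def inj_on_def)
qed

lemma realized_E: "realized_limit_sketch TYPE('u) (E_cat :: ('u eobj, 'u \<Rightarrow> 'u) cat) E_cones"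
  unfolding realized_limit_sketch_def limit_sketch_def
proof (intro conjI ballI category_E[OF universe] hom_functor_model E_cones_limits)
  fix K :: "('u + cospan, unit, 'u eobj, 'u \<Rightarrow> 'u) cone" assume K: "K \<in> E_cones"
  show "is_cone E_cat K" using E_cones_limits[OF K] by (simp add: is_limit_cone_def)
  have fin: "finite (UNIV :: cospan set)"
  proof -
    have "(UNIV :: cospan set) = {LeftEnd, RightEnd, Vertex}" by (auto intro: cospan.exhaust)
    then show ?thesis by (metis finite.emptyI finite_insert)
  qed
  have "(\<exists>a\<in>Obj E_cat. shape K = thin_cat (Inl ` expo a) (=)) \<or>
      shape K = thin_cat (range Inr) (\<lambda>i j. i = j \<or> j = Inr Vertex)"
    using K unfolding E_cones_eq by (auto simp: power_cone_def mono_cone_def)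
  then show "small TYPE('u) (Obj (shape K))"
    by (auto simp: Obj_E_cat intro: small_image small_finite[OF universe finite_imageI[OF fin]])
  fix i j
  have "finite (Hom (shape K) i j)"
    using K unfolding E_cones_eq power_cone_def mono_cone_def by auto
  then show "small TYPE('u) (Hom (shape K) i j)" by (rule small_finite[OF universe])
qed

end

section \<open>The categories of models and of spaces\<close>

lemma compose_eq_compose_iff:
  "compose A f g = compose A f' g' \<longleftrightarrow> (\<forall>z\<in>A. f (g z) = f' (g' z))"
  by (auto simp: compose_def fun_eq_iff)

lemma nat_trans_set_cat_iff:
  "\<eta> \<in> nat_trans C (set_cat U) M N \<longleftrightarrow> \<eta> \<in> extensional (Obj C) \<and>
    (\<forall>a\<in>Obj C. \<eta> a \<in> fobj M a \<rightarrow>\<^sub>E fobj N a) \<and>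
    (\<forall>a\<in>Obj C. \<forall>b\<in>Obj C. \<forall>f\<in>Hom C a b. \<forall>z\<in>fobj M a.
       \<eta> b (fmap M a b f z) = fmap N a b f (\<eta> a z))"
  unfolding nat_trans_def by (simp add: compose_eq_compose_iff)

lemma Mod_cat_simps[simp]:
  fixes C :: "('o, 'm) cat" and \<S> :: "('j, 'k, 'o, 'm) cone set"
  defines "MC \<equiv> (Mod_cat C \<S> :: (('o, 'm, 'u set, 'u \<Rightarrow> 'u) funct, 'o \<Rightarrow> 'u \<Rightarrow> 'u) cat)"
  shows "Obj MC = {M. is_model TYPE('u) C \<S> M}"
    and "Hom MC = nat_trans C (set_cat TYPE('u))"
    and "Iden MC M = (\<lambda>a\<in>Obj C. \<lambda>x\<in>fobj M a. x)"
    and "Comp MC L M N \<tau> \<sigma> = (\<lambda>a\<in>Obj C. compose (fobj L a) (\<tau> a) (\<sigma> a))"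
  by (simp_all add: Mod_cat_def MC_def)

lemma model_functor: "is_model U C \<S> M \<Longrightarrow> is_functor C (set_cat U) M"
  by (simp add: is_model_def)

lemma model_map_in:
  "is_model U C \<S> M \<Longrightarrow> a \<in> Obj C \<Longrightarrow> b \<in> Obj C \<Longrightarrow> f \<in> Hom C a b \<Longrightarrow> z \<in> fobj M a \<Longrightarrow> fmap M a b f z \<in> fobj M b"
  using functor_map[OF model_functor, of U C \<S> M a b f] by auto

lemma category_Mod_cat:
  fixes C :: "('o, 'm) cat" and \<S> :: "('j, 'k, 'o, 'm) cone set"
  assumes C: "category C"
  shows "category (Mod_cat C \<S> :: (('o, 'm, 'u set, 'u \<Rightarrow> 'u) funct, 'o \<Rightarrow> 'u \<Rightarrow> 'u) cat)"
proof -
  note iff = nat_trans_set_cat_iff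
  show ?thesis
    unfolding category_def
  proof (simp only: Mod_cat_simps mem_Collect_eq, intro conjI ballI)
    fix M :: "('o, 'm, 'u set, 'u \<Rightarrow> 'u) funct" assume "M \<in> {M. is_model TYPE('u) C \<S> M}"
    then have M: "is_model TYPE('u) C \<S> M" by simp
    show "(\<lambda>a\<in>Obj C. \<lambda>x\<in>fobj M a. x) \<in> nat_trans C (set_cat TYPE('u)) M M"
      unfolding iff using model_map_in[OF M] by auto
  next
    fix L M N :: "('o, 'm, 'u set, 'u \<Rightarrow> 'u) funct" and f g
    assume "L \<in> {M. is_model TYPE('u) C \<S> M}" "M \<in> {M. is_model TYPE('u) C \<S> M}" "N \<in> {M. is_model TYPE('u) C \<S> M}"
    then have L: "is_model TYPE('u) C \<S> L" and M: "is_model TYPE('u) C \<S> M" and N: "is_model TYPE('u) C \<S> N" by simp_all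
    assume f: "f \<in> nat_trans C (set_cat TYPE('u)) L M" and g: "g \<in> nat_trans C (set_cat TYPE('u)) M N"
    note f = f[unfolded iff] and g = g[unfolded iff]
    have fm: "f a z \<in> fobj M a" if "a \<in> Obj C" "z \<in> fobj L a" for a z using f that by blast
    have gm: "g a z \<in> fobj N a" if "a \<in> Obj C" "z \<in> fobj M a" for a z using g that by blast
    show "(\<lambda>a\<in>Obj C. compose (fobj L a) (g a) (f a)) \<in> nat_trans C (set_cat TYPE('u)) L N"
      unfolding iff
    proof (intro conjI ballI)
      fix a assume a: "a \<in> Obj C"
      show "(\<lambda>a\<in>Obj C. compose (fobj L a) (g a) (f a)) a \<in> fobj L a \<rightarrow>\<^sub>E fobj N a"
        using a fm gm by (auto simp: compose_def)
      fix b h z assume b: "b \<in> Obj C" and h: "h \<in> Hom C a b" and z: "z \<in> fobj L a"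
      have "g b (f b (fmap L a b h z)) = fmap N a b h (g a (f a z))"
        using f g a b h z fm by metis
      then show "(\<lambda>a\<in>Obj C. compose (fobj L a) (g a) (f a)) b (fmap L a b h z) =
          fmap N a b h ((\<lambda>a\<in>Obj C. compose (fobj L a) (g a) (f a)) a z)"
        using a b z model_map_in[OF L a b h z] by (simp add: compose_def)
    qed simp
  next
    fix L M :: "('o, 'm, 'u set, 'u \<Rightarrow> 'u) funct" and f
    assume "L \<in> {M. is_model TYPE('u) C \<S> M}" "M \<in> {M. is_model TYPE('u) C \<S> M}"
    then have L: "is_model TYPE('u) C \<S> L" and M: "is_model TYPE('u) C \<S> M" by simp_all
    assume f: "f \<in> nat_trans C (set_cat TYPE('u)) L M"
    have e: "f \<in> extensional (Obj C)" and fa: "\<And>a. a \<in> Obj C \<Longrightarrow> f a \<in> fobj L a \<rightarrow>\<^sub>E fobj M a"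
      using f unfolding iff by blast+
    have 1: "compose (fobj L a) (f a) (\<lambda>x\<in>fobj L a. x) = f a" if "a \<in> Obj C" for a
      using fa[OF that] by (intro extensionalityI[of _ "fobj L a"]) (auto simp: compose_def PiE_def)
    have 2: "compose (fobj L a) (\<lambda>x\<in>fobj M a. x) (f a) = f a" if "a \<in> Obj C" for a
      using fa[OF that] by (intro extensionalityI[of _ "fobj L a"]) (auto simp: compose_def PiE_def)
    show "(\<lambda>a\<in>Obj C. compose (fobj L a) (f a) ((\<lambda>a\<in>Obj C. \<lambda>x\<in>fobj L a. x) a)) = f"
      by (rule extensionalityI[OF _ e]) (simp_all add: 1)
    show "(\<lambda>a\<in>Obj C. compose (fobj L a) ((\<lambda>a\<in>Obj C. \<lambda>x\<in>fobj M a. x) a) (f a)) = f"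
      by (rule extensionalityI[OF _ e]) (simp_all add: 2)
  next
    fix K L M N :: "('o, 'm, 'u set, 'u \<Rightarrow> 'u) funct" and f g h
    assume "K \<in> {M. is_model TYPE('u) C \<S> M}" "L \<in> {M. is_model TYPE('u) C \<S> M}"
    then have K: "is_model TYPE('u) C \<S> K" and L: "is_model TYPE('u) C \<S> L" by simp_all
    assume f: "f \<in> nat_trans C (set_cat TYPE('u)) K L"
    have fm: "f a z \<in> fobj L a" if "a \<in> Obj C" "z \<in> fobj K a" for a z
      using f that unfolding iff by blast
    have "compose (fobj K a) (h a) (compose (fobj K a) (g a) (f a)) =
        compose (fobj K a) (compose (fobj L a) (h a) (g a)) (f a)" if "a \<in> Obj C" for a
      using fm[OF that] by (auto simp: compose_def fun_eq_iff)
    then show "(\<lambda>a\<in>Obj C. compose (fobj K a) (h a) ((\<lambda>a\<in>Obj C. compose (fobj K a) (g a) (f a)) a)) =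
        (\<lambda>a\<in>Obj C. compose (fobj K a) ((\<lambda>a\<in>Obj C. compose (fobj L a) (h a) (g a)) a) (f a))"
      by (auto simp: fun_eq_iff)
  qed
qed

lemma is_iso_Mod_cat:
  fixes C :: "('o, 'm) cat" and \<S> :: "('j, 'k, 'o, 'm) cone set" and M N :: "('o, 'm, 'u set, 'u \<Rightarrow> 'u) funct"
  assumes M: "is_model TYPE('u) C \<S> M" and N: "is_model TYPE('u) C \<S> N"
    and \<eta>: "\<eta> \<in> nat_trans C (set_cat TYPE('u)) M N"
    and bij: "\<And>a. a \<in> Obj C \<Longrightarrow> bij_betw (\<eta> a) (fobj M a) (fobj N a)"
  shows "is_iso (Mod_cat C \<S>) M N \<eta>"
proof -
  note iff = nat_trans_set_cat_iff
  define \<theta> where "\<theta> = (\<lambda>a\<in>Obj C. \<lambda>z\<in>fobj N a. inv_into (fobj M a) (\<eta> a) z)"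
  have \<theta>_in: "\<theta> a z \<in> fobj M a" and \<eta>\<theta>: "\<eta> a (\<theta> a z) = z" if "a \<in> Obj C" "z \<in> fobj N a" for a z
  proof -
    have z: "z \<in> \<eta> a ` fobj M a" using bij[OF that(1)] that(2) by (simp add: bij_betw_def)
    show "\<theta> a z \<in> fobj M a" "\<eta> a (\<theta> a z) = z"
      using that inv_into_into[OF z] f_inv_into_f[OF z] by (simp_all add: \<theta>_def)
  qed
  have \<eta>_in: "\<eta> a z \<in> fobj N a" if "a \<in> Obj C" "z \<in> fobj M a" for a z
    using bij[OF that(1)] that(2) by (auto simp: bij_betw_def)
  have \<theta>\<eta>: "\<theta> a (\<eta> a z) = z" if "a \<in> Obj C" "z \<in> fobj M a" for a z
    using bij[OF that(1)] that \<eta>_in[OF that] by (simp add: \<theta>_def bij_betw_def)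
  have nat: "\<eta> b (fmap M a b f z) = fmap N a b f (\<eta> a z)"
    if "a \<in> Obj C" "b \<in> Obj C" "f \<in> Hom C a b" "z \<in> fobj M a" for a b f z
    using \<eta> that unfolding iff by blast
  have "\<theta> \<in> nat_trans C (set_cat TYPE('u)) N M"
    unfolding iff
  proof (intro conjI ballI)
    show "\<theta> \<in> extensional (Obj C)" by (simp add: \<theta>_def)
    fix a assume a: "a \<in> Obj C"
    show "\<theta> a \<in> fobj N a \<rightarrow>\<^sub>E fobj M a" using \<theta>_in[OF a] a by (auto simp: \<theta>_def)
    fix b f z assume b: "b \<in> Obj C" and f: "f \<in> Hom C a b" and z: "z \<in> fobj N a"
    have "\<theta> b (fmap N a b f z) = \<theta> b (fmap N a b f (\<eta> a (\<theta> a z)))" by (simp add: \<eta>\<theta>[OF a z])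
    also have "\<dots> = \<theta> b (\<eta> b (fmap M a b f (\<theta> a z)))" by (simp add: nat[OF a b f \<theta>_in[OF a z]])
    also have "\<dots> = fmap M a b f (\<theta> a z)" by (rule \<theta>\<eta>[OF b model_map_in[OF M a b f \<theta>_in[OF a z]]])
    finally show "\<theta> b (fmap N a b f z) = fmap M a b f (\<theta> a z)" .
  qed
  moreover have "(\<lambda>a\<in>Obj C. compose (fobj M a) (\<theta> a) (\<eta> a)) = (\<lambda>a\<in>Obj C. \<lambda>x\<in>fobj M a. x)"
    using \<theta>\<eta> by (auto simp: fun_eq_iff compose_def)
  moreover have "(\<lambda>a\<in>Obj C. compose (fobj N a) (\<eta> a) (\<theta> a)) = (\<lambda>a\<in>Obj C. \<lambda>x\<in>fobj N a. x)"
    using \<eta>\<theta> by (auto simp: fun_eq_iff compose_def)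
  ultimately show ?thesis
    unfolding is_iso_def using \<eta> by auto
qed

lemma top_cat_simps[simp]:
  "Obj top_cat = {T :: 'u topology. small TYPE('u) (topspace T)}"
  "Hom top_cat S T = maps S T"
  "Iden top_cat S = (\<lambda>x\<in>topspace S. x)"
  "Comp top_cat R S T g f = compose (topspace R) g f"
  by (simp_all add: top_cat_def maps_def)

lemma maps_id: "(\<lambda>x\<in>topspace S. x) \<in> maps S S"
  unfolding maps_def by (auto intro: continuous_map_eq[OF continuous_map_id])

lemma category_top_cat: "category (top_cat :: ('u topology, 'u \<Rightarrow> 'u) cat)"
  unfolding category_def top_cat_simps
proof (intro conjI ballI)
  fix S T :: "'u topology" and f assume f: "f \<in> maps S T"
  show "compose (topspace S) f (\<lambda>x\<in>topspace S. x) = f" "compose (topspace S) (\<lambda>x\<in>topspace T. x) f = f"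
    using f maps_mem[OF f] by (auto simp: compose_def maps_def fun_eq_iff PiE_def extensional_def)
next
  fix R S T V :: "'u topology" and f g h assume f: "f \<in> maps R S"
  show "compose (topspace R) h (compose (topspace R) g f) = compose (topspace R) (compose (topspace S) h g) f"
    using maps_mem[OF f] by (auto simp: compose_def fun_eq_iff)
qed (auto intro: maps_id maps_compose)

section \<open>The model of continuous maps out of a space\<close>

abbreviation enc_map :: "'a topology \<Rightarrow> 'u eobj \<Rightarrow> ('a \<Rightarrow> 'u set) \<Rightarrow> 'u" where
  "enc_map T a \<equiv> code (maps T (espace a))"

abbreviation dec_map :: "'a topology \<Rightarrow> 'u eobj \<Rightarrow> 'u \<Rightarrow> 'a \<Rightarrow> 'u set" where
  "dec_map T a \<equiv> decode (maps T (espace a))"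

definition top_model :: "'u topology \<Rightarrow> ('u eobj, 'u \<Rightarrow> 'u, 'u set, 'u \<Rightarrow> 'u) funct" where
  "top_model T = \<lparr>fobj = (\<lambda>a. enc_map T a ` maps T (espace a)),
     fmap = (\<lambda>a b f. \<lambda>z\<in>enc_map T a ` maps T (espace a).
       enc_map T b (compose (topspace T) (realizeE a b f) (dec_map T a z)))\<rparr>"

text \<open>
  Precomposition with \<open>f\<close>; the direction is reversed, so this is a functor on the opposite of the
  category of spaces.
\<close>

definition top_model_map :: "'u topology \<Rightarrow> 'u topology \<Rightarrow> ('u \<Rightarrow> 'u) \<Rightarrow> 'u eobj \<Rightarrow> 'u \<Rightarrow> 'u" where
  "top_model_map T S f = (\<lambda>a\<in>Obj E_cat. \<lambda>z\<in>fobj (top_model T) a.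
     enc_map S a (compose (topspace S) (dec_map T a z) f))"

lemma maps_Y_from_X:
  assumes "w \<in> maps T (espace (XPow I))"
  shows "w \<in> maps T (espace (YPow I))"
  using assms unfolding maps_espace_iff by simp

text \<open>
  The transformation \<open>t\<close> is determined by its value \<open>D\<close> at the map \<open>x \<mapsto> {x}\<close> into the indiscrete space
  on \<open>Pow T\<close>, since every function on \<open>T\<close> factors through that map. The two functions
  "is a singleton" and "true" on \<open>Pow T\<close> agree on singletons, so by naturality they agree on the values
  of \<open>D\<close>, which are therefore singletons \<open>{f y}\<close>. For a map into a Sierpinski power the claim follows by
  composing with the identity function into the indiscrete space with the same points.
  Applied to indicator functions of open sets it shows that \<open>f\<close> is continuous.
\<close>

lemma natural_maps_representable:
  fixes T S :: "'u topology" and t :: "'u eobj \<Rightarrow> ('u \<Rightarrow> 'u set) \<Rightarrow> 'u \<Rightarrow> 'u set"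
  assumes smT: "small TYPE('u) (topspace T)" and pt: "small TYPE('u) (one_point :: 'u set)"
    and t: "\<And>a w. a \<in> Obj E_cat \<Longrightarrow> w \<in> maps T (espace a) \<Longrightarrow> t a w \<in> maps S (espace a)"
    and nat: "\<And>a b r w. a \<in> Obj E_cat \<Longrightarrow> b \<in> Obj E_cat \<Longrightarrow> r \<in> maps (espace a) (espace b) \<Longrightarrow>
      w \<in> maps T (espace a) \<Longrightarrow> t b (compose (topspace T) r w) = compose (topspace S) r (t a w)"
  obtains f where "f \<in> maps S T"
    and "\<And>a w. a \<in> Obj E_cat \<Longrightarrow> w \<in> maps T (espace a) \<Longrightarrow> t a w = compose (topspace S) w f"
proof -
  let ?K = "topspace T"
  let ?Y = "YPow ?K" and ?Y1 = "YPow one_point :: 'u eobj" and ?X1 = "XPow one_point :: 'u eobj"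
  have K: "?Y \<in> Obj E_cat" and Y1: "?Y1 \<in> Obj E_cat" and X1: "?X1 \<in> Obj E_cat"
    using smT pt by (simp_all add: Obj_E_cat)
  let ?d = "\<lambda>x\<in>?K. {x}"
  have d: "?d \<in> maps T (espace ?Y)" unfolding maps_espace_iff by auto
  define D where "D = t ?Y ?d"
  have D: "D \<in> maps S (espace ?Y)" unfolding D_def by (rule t[OF K d])
  have into_Y: "r \<in> maps (espace ?Y) (espace (YPow J))" if "r \<in> Pow ?K \<rightarrow>\<^sub>E Pow J"
    for r :: "'u set \<Rightarrow> 'u set" and J
    using that unfolding maps_espace_iff by simp
  have sing: "\<exists>x\<in>?K. D y = {x}" if y: "y \<in> topspace S" for y
  proof -
    let ?r = "\<lambda>s\<in>Pow ?K. if \<exists>x. s = {x} then one_point else {} :: 'u set"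
    let ?r' = "\<lambda>s\<in>Pow ?K. one_point :: 'u set"
    have r: "?r \<in> maps (espace ?Y) (espace ?Y1)" "?r' \<in> maps (espace ?Y) (espace ?Y1)"
      by (intro into_Y; auto)+
    have rd: "compose ?K ?r ?d = compose ?K ?r' ?d" by (auto simp: compose_def fun_eq_iff)
    have "compose (topspace S) ?r D = t ?Y1 (compose ?K ?r ?d)"
      unfolding D_def by (rule nat[OF K Y1 r(1) d, symmetric])
    also have "\<dots> = t ?Y1 (compose ?K ?r' ?d)" by (rule arg_cong[OF rd])
    also have "\<dots> = compose (topspace S) ?r' D"
      unfolding D_def by (rule nat[OF K Y1 r(2) d])
    finally have "compose (topspace S) ?r D = compose (topspace S) ?r' D" .
    from fun_cong[OF this, of y] have "?r (D y) = ?r' (D y)" by (simp only: compose_eq[OF y])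
    moreover have Dy: "D y \<in> Pow ?K" using maps_mem[OF D y] by simp
    ultimately have "\<exists>x. D y = {x}" by (auto split: if_splits)
    then show ?thesis using Dy by auto
  qed
  define f where "f = (\<lambda>y\<in>topspace S. the_elem (D y))"
  have f: "f y \<in> ?K \<and> D y = {f y}" if "y \<in> topspace S" for y
  proof -
    obtain x where x: "x \<in> ?K" "D y = {x}" using sing[OF \<open>y \<in> topspace S\<close>] by blast
    have "f y = x" using \<open>y \<in> topspace S\<close> unfolding f_def by (simp only: restrict_apply' x(2) the_elem_eq)
    then show ?thesis using x by (simp only: simp_thms)
  qed
  have tY: "t (YPow J) w = compose (topspace S) w f"
    if J: "YPow J \<in> Obj E_cat" and w: "w \<in> maps T (espace (YPow J))" for J w
  proof -
    \<comment> \<open>an extension of \<open>w\<close> from singletons to all subsets; its values elsewhere are arbitrary\<close>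
    let ?r = "\<lambda>s\<in>Pow ?K. if \<exists>x\<in>?K. s = {x} then w (the_elem s) else {}"
    have wJ: "w x \<subseteq> J" if "x \<in> ?K" for x using maps_mem[OF w that] by simp
    have r: "?r \<in> maps (espace ?Y) (espace (YPow J))"
    proof (rule into_Y, unfold restrict_PiE_iff, rule ballI)
      fix s
      show "(if \<exists>x\<in>?K. s = {x} then w (the_elem s) else {}) \<in> Pow J"
        by (cases "\<exists>x\<in>?K. s = {x}") (auto dest: wJ[THEN subsetD])
    qed
    have rd: "compose ?K ?r ?d = w"
    proof (rule extensionalityI[of _ ?K])
      show "w \<in> extensional ?K" using w by (simp add: maps_def PiE_def)
    qed (auto simp: compose_def)
    have "t (YPow J) w = t (YPow J) (compose ?K ?r ?d)" by (rule arg_cong[OF rd[symmetric]])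
    also have "\<dots> = compose (topspace S) ?r D"
      unfolding D_def by (rule nat[OF K J r d])
    also have "\<dots> = compose (topspace S) w f"
    proof (rule extensionalityI[of _ "topspace S"])
      fix y assume y: "y \<in> topspace S"
      have "f y \<in> ?K" and Dy: "D y = {f y}" using f[OF y] by blast+
      then have "?r {f y} = w (f y)" by auto
      then show "compose (topspace S) ?r D y = compose (topspace S) w f y"
        by (simp only: compose_eq[OF y] Dy)
    qed simp_all
    finally show ?thesis .
  qed
  have tX: "t (XPow J) w = compose (topspace S) w f"
    if J: "XPow J \<in> Obj E_cat" and w: "w \<in> maps T (espace (XPow J))" for J w
  proof -
    let ?j = "\<lambda>s\<in>Pow J. s"
    have JY: "YPow J \<in> Obj E_cat" using J by (simp add: Obj_E_cat)
    have j: "?j \<in> maps (espace (XPow J)) (espace (YPow J))" unfolding maps_espace_iff by auto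
    have wY: "w \<in> maps T (espace (YPow J))" by (rule maps_Y_from_X[OF w])
    have jw: "compose (topspace R) ?j v = v" if "v \<in> maps R (espace (XPow J))" for v and R :: "'u topology"
    proof (rule extensionalityI[of _ "topspace R"])
      show "v \<in> extensional (topspace R)" using that by (simp add: maps_def PiE_def)
      show "compose (topspace R) ?j v x = v x" if "x \<in> topspace R" for x
        using that maps_mem[OF \<open>v \<in> maps R (espace (XPow J))\<close> that] by (simp add: compose_def)
    qed simp
    have "t (XPow J) w = compose (topspace S) ?j (t (XPow J) w)"
      by (rule jw[OF t[OF J w], symmetric])
    also have "\<dots> = t (YPow J) (compose ?K ?j w)" by (rule nat[OF J JY j w, symmetric])
    also have "\<dots> = compose (topspace S) w f" unfolding jw[OF w] by (rule tY[OF JY wY])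
    finally show ?thesis .
  qed
  have "f \<in> maps S T"
    unfolding maps_def continuous_map_def
  proof (intro CollectI conjI allI impI)
    show "f \<in> topspace S \<rightarrow>\<^sub>E topspace T"
    proof (rule PiE_I)
      show "f y \<in> topspace T" if "y \<in> topspace S" for y using f[OF that] by blast
    qed (simp add: f_def)
    then show "f \<in> topspace S \<rightarrow> topspace T" by (simp add: PiE_def)
    fix U assume U: "openin T U"
    let ?w = "\<lambda>x\<in>?K. if x \<in> U then one_point else {} :: 'u set"
    have "{x \<in> ?K. undefined \<in> ?w x} = U" using openin_subset[OF U] by auto
    then have w: "?w \<in> maps T (espace ?X1)" unfolding maps_espace_iff using U by auto
    have "compose (topspace S) ?w f \<in> maps S (espace ?X1)"
      using t[OF X1 w] tX[OF X1 w] by simp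
    then have "openin S {y \<in> topspace S. undefined \<in> compose (topspace S) ?w f y}"
      unfolding maps_espace_iff by simp
    moreover have "{y \<in> topspace S. undefined \<in> compose (topspace S) ?w f y} = {y \<in> topspace S. f y \<in> U}"
    proof (rule Collect_cong, rule conj_cong[OF refl])
      fix y assume y: "y \<in> topspace S"
      have "f y \<in> ?K" using f[OF y] by blast
      then show "undefined \<in> compose (topspace S) ?w f y \<longleftrightarrow> f y \<in> U"
        by (simp add: compose_eq[OF y])
    qed
    ultimately show "openin S {y \<in> topspace S. f y \<in> U}" by simp
  qed
  moreover have "t a w = compose (topspace S) w f" if "a \<in> Obj E_cat" "w \<in> maps T (espace a)" for a w
    using that tX tY by (cases a) auto
  ultimately show ?thesis using that by blast
qed

context
  assumes universe: "set_universe TYPE('u)"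
begin

lemma small_maps:
  fixes T :: "'u topology" and a :: "'u eobj"
  assumes "small TYPE('u) (topspace T)" "a \<in> Obj E_cat"
  shows "small TYPE('u) (maps T (espace a))"
proof (rule small_subset)
  show "maps T (espace a) \<subseteq> topspace T \<rightarrow>\<^sub>E pts a" by (auto simp: maps_def)
  show "small TYPE('u) (topspace T \<rightarrow>\<^sub>E pts a)"
    using assms by (intro small_PiE[OF universe] small_Pow[OF universe]) (simp_all add: Obj_E_cat)
qed

lemma fobj_top_model: "fobj (top_model T) a = enc_map T a ` maps T (espace a)"
  by (simp add: top_model_def)

context
  fixes T :: "'u topology"
  assumes smT: "small TYPE('u) (topspace T)"
begin

lemma dec_enc_map:
  "a \<in> Obj E_cat \<Longrightarrow> w \<in> maps T (espace a) \<Longrightarrow> dec_map T a (enc_map T a w :: 'u) = w"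
  by (rule decode_code[OF small_maps[OF smT]])

lemma enc_map_eq_iff:
  "a \<in> Obj E_cat \<Longrightarrow> w \<in> maps T (espace a) \<Longrightarrow> w' \<in> maps T (espace a) \<Longrightarrow>
    (enc_map T a w :: 'u) = enc_map T a w' \<longleftrightarrow> w = w'"
  by (rule code_eq_iff[OF small_maps[OF smT]])

lemma fmap_top_model:
  "a \<in> Obj E_cat \<Longrightarrow> w \<in> maps T (espace a) \<Longrightarrow>
    fmap (top_model T) a b f (enc_map T a w) = enc_map T b (compose (topspace T) (realizeE a b f) w)"
  by (simp add: top_model_def dec_enc_map)

lemma top_model_ext:
  assumes "h \<in> extensional (fobj (top_model T) a)" "h' \<in> extensional (fobj (top_model T) a)"
    and "\<And>w. w \<in> maps T (espace a) \<Longrightarrow> h (enc_map T a w) = h' (enc_map T a w)"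
  shows "h = h'"
  using assms by (intro extensionalityI[of h "fobj (top_model T) a" h']) (auto simp: fobj_top_model)

lemma compose_realizeE:
  fixes a b :: "'u eobj"
  assumes "a \<in> Obj E_cat" "b \<in> Obj E_cat" "f \<in> E_hom a b" "w \<in> maps T (espace a)"
  shows "compose (topspace T) (realizeE a b f) w \<in> maps T (espace b)"
  by (rule maps_compose[OF assms(4) realizeE_in[OF universe assms(1-3)]])

lemma compose_id_maps:
  "w \<in> maps T (espace a) \<Longrightarrow> compose (topspace T) (\<lambda>s\<in>pts a. s) w = w"
proof (rule extensionalityI[of _ "topspace T"])
  assume w: "w \<in> maps T (espace a)"
  show "w \<in> extensional (topspace T)" using w by (simp add: maps_def PiE_def)
  show "compose (topspace T) (\<lambda>s\<in>pts a. s) w x = w x" if "x \<in> topspace T" for x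
    using that maps_mem[OF w that] by (simp add: compose_def)
qed simp

lemma top_model_functor: "is_functor E_cat (set_cat TYPE('u)) (top_model T)"
  unfolding is_functor_def set_cat_simps
proof (intro conjI ballI)
  fix a :: "'u eobj" assume a: "a \<in> Obj E_cat"
  show "fobj (top_model T) a \<in> {A. small TYPE('u) A}"
    unfolding fobj_top_model using small_image[OF small_maps[OF smT a]] by simp
  show "fmap (top_model T) a a (Iden E_cat a) = (\<lambda>z\<in>fobj (top_model T) a. z)"
  proof (rule top_model_ext)
    show "fmap (top_model T) a a (Iden E_cat a) \<in> extensional (fobj (top_model T) a)"
      by (simp add: top_model_def)
    fix w assume w: "w \<in> maps T (espace a)"
    show "fmap (top_model T) a a (Iden E_cat a) (enc_map T a w) = (\<lambda>z\<in>fobj (top_model T) a. z) (enc_map T a w)"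
      using w by (simp add: fmap_top_model[OF a w] fobj_top_model realizeE_iden[OF universe a] compose_id_maps)
  qed simp
  fix b :: "'u eobj" and f assume b: "b \<in> Obj E_cat" and f: "f \<in> Hom E_cat a b"
  show "fmap (top_model T) a b f \<in> fobj (top_model T) a \<rightarrow>\<^sub>E fobj (top_model T) b"
  proof (rule PiE_I)
    fix z assume "z \<in> fobj (top_model T) a"
    then obtain w where w: "w \<in> maps T (espace a)" "z = enc_map T a w" by (auto simp: fobj_top_model)
    then show "fmap (top_model T) a b f z \<in> fobj (top_model T) b"
      using compose_realizeE[OF a b _ w(1), of f] f by (simp add: fmap_top_model[OF a w(1)]) (simp add: fobj_top_model)
  qed (simp add: top_model_def)
  fix c :: "'u eobj" and g assume c: "c \<in> Obj E_cat" and g: "g \<in> Hom E_cat b c"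
  have f': "f \<in> E_hom a b" and g': "g \<in> E_hom b c" using f g by simp_all
  show "fmap (top_model T) a c (Comp E_cat a b c g f) =
      compose (fobj (top_model T) a) (fmap (top_model T) b c g) (fmap (top_model T) a b f)"
  proof (rule top_model_ext)
    show "fmap (top_model T) a c (Comp E_cat a b c g f) \<in> extensional (fobj (top_model T) a)"
      by (simp add: top_model_def)
    fix w assume w: "w \<in> maps T (espace a)"
    have "compose (topspace T) (compose (pts a) (realizeE b c g) (realizeE a b f)) w =
        compose (topspace T) (realizeE b c g) (compose (topspace T) (realizeE a b f) w)"
      using maps_mem[OF w] by (auto simp: compose_def fun_eq_iff)
    then show "fmap (top_model T) a c (Comp E_cat a b c g f) (enc_map T a w) =
      compose (fobj (top_model T) a) (fmap (top_model T) b c g) (fmap (top_model T) a b f) (enc_map T a w)"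
      using w by (simp add: compose_eq fobj_top_model fmap_top_model[OF a w] realizeE_comp[OF universe a b c f' g']
          fmap_top_model[OF b compose_realizeE[OF a b f' w]])
  qed simp
qed

lemma top_model_model: "is_model TYPE('u) E_cat E_cones (top_model T)"
  unfolding functor_E_model_iff[OF universe top_model_functor]
proof (intro conjI ballI allI impI)
  fix a :: "'u eobj" and g assume a: "a \<in> Obj E_cat" and g: "\<forall>i\<in>expo a. g i \<in> fobj (top_model T) (unit_obj a)"
  note u = unit_obj_Obj[OF universe, of a]
  define v where "v i = dec_map T (unit_obj a) (g i)" for i
  have v: "v i \<in> maps T (espace (unit_obj a)) \<and> g i = enc_map T (unit_obj a) (v i)" if "i \<in> expo a" for i
    using g that code_decode[of "g i" "maps T (espace (unit_obj a))"] decode_in[of "g i" "maps T (espace (unit_obj a))"]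
    unfolding v_def fobj_top_model by auto
  have *: "fmap (top_model T) a (unit_obj a) (proj_mor a i) (enc_map T a w) = g i \<longleftrightarrow>
      compose (topspace T) (proj (expo a) i) w = v i"
    if i: "i \<in> expo a" and w: "w \<in> maps T (espace a)" for i w
    using v[OF i] compose_realizeE[OF a u proj_mor(1)[OF universe a i] w]
    by (simp add: fmap_top_model[OF a w] proj_mor(2)[OF universe a i] enc_map_eq_iff[OF u])
  have ex1: "\<exists>!w. w \<in> maps T (espace a) \<and> (\<forall>i\<in>expo a. compose (topspace T) (proj (expo a) i) w = v i)"
    by (rule maps_power_universal) (use v in blast)
  show "\<exists>!z. z \<in> fobj (top_model T) a \<and> (\<forall>i\<in>expo a. fmap (top_model T) a (unit_obj a) (proj_mor a i) z = g i)"
  proof (rule ex_ex1I)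
    obtain w where "w \<in> maps T (espace a)" "\<forall>i\<in>expo a. compose (topspace T) (proj (expo a) i) w = v i"
      using ex1_implies_ex[OF ex1] by blast
    then show "\<exists>z. z \<in> fobj (top_model T) a \<and> (\<forall>i\<in>expo a. fmap (top_model T) a (unit_obj a) (proj_mor a i) z = g i)"
      using * unfolding fobj_top_model by (intro exI[of _ "enc_map T a w"]) simp
    fix z z' assume z: "z \<in> fobj (top_model T) a \<and> (\<forall>i\<in>expo a. fmap (top_model T) a (unit_obj a) (proj_mor a i) z = g i)"
      and z': "z' \<in> fobj (top_model T) a \<and> (\<forall>i\<in>expo a. fmap (top_model T) a (unit_obj a) (proj_mor a i) z' = g i)"
    obtain w w' where w: "w \<in> maps T (espace a)" "z = enc_map T a w" and w': "w' \<in> maps T (espace a)" "z' = enc_map T a w'"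
      using z z' unfolding fobj_top_model by auto
    have "\<forall>i\<in>expo a. compose (topspace T) (proj (expo a) i) w = v i"
      "\<forall>i\<in>expo a. compose (topspace T) (proj (expo a) i) w' = v i"
      using z z' * w w' by auto
    then have "w = w'" using ex1 w(1) w'(1) by blast
    then show "z = z'" using w w' by simp
  qed
next
  show "inj_on (fmap (top_model T) (XPow one_point) (YPow one_point) phi) (fobj (top_model T) (XPow one_point))"
  proof (rule inj_onI)
    let ?X = "XPow one_point :: 'u eobj" and ?Y = "YPow one_point :: 'u eobj"
    note X = X_Obj[OF universe] and Y = Y_Obj[OF universe] and ph = phi[OF universe]
    fix z z' assume "z \<in> fobj (top_model T) ?X" "z' \<in> fobj (top_model T) ?X"
      and eq: "fmap (top_model T) ?X ?Y phi z = fmap (top_model T) ?X ?Y phi z'"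
    then obtain w w' where w: "w \<in> maps T (espace ?X)" "z = enc_map T ?X w"
        and w': "w' \<in> maps T (espace ?X)" "z' = enc_map T ?X w'"
      unfolding fobj_top_model by auto
    have id: "compose (topspace T) (realizeE ?X ?Y phi) v = v" if "v \<in> maps T (espace ?X)" for v
      using compose_id_maps[OF that] unfolding ph(2) expo.simps .
    have "enc_map T ?Y w = enc_map T ?Y w'"
      using eq unfolding w(2) w'(2) fmap_top_model[OF X w(1)] fmap_top_model[OF X w'(1)] id[OF w(1)] id[OF w'(1)] .
    then have "w = w'" using enc_map_eq_iff[OF Y maps_Y_from_X[OF w(1)] maps_Y_from_X[OF w'(1)]] by simp
    then show "z = z'" using w w' by simp
  qed
qed

end

lemma top_model_map_eval:
  fixes S T :: "'u topology"
  assumes T: "small TYPE('u) (topspace T)" and a: "a \<in> Obj E_cat" and w: "w \<in> maps T (espace a)"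
  shows "top_model_map T S f a (enc_map T a w) = enc_map S a (compose (topspace S) w f)"
  using assms by (simp add: top_model_map_def fobj_top_model dec_enc_map[OF T a w])

lemma top_model_map_nat:
  fixes S T :: "'u topology"
  assumes T: "small TYPE('u) (topspace T)" and S: "small TYPE('u) (topspace S)" and f: "f \<in> maps S T"
  shows "top_model_map T S f \<in> nat_trans E_cat (set_cat TYPE('u)) (top_model T) (top_model S)"
  unfolding nat_trans_set_cat_iff
proof (intro conjI ballI)
  show "top_model_map T S f \<in> extensional (Obj E_cat)" by (simp add: top_model_map_def)
  fix a :: "'u eobj" assume a: "a \<in> Obj E_cat"
  have wf: "compose (topspace S) w f \<in> maps S (espace a)" if "w \<in> maps T (espace a)" for w and a :: "'u eobj"
    by (rule maps_compose[OF f that])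
  show "top_model_map T S f a \<in> fobj (top_model T) a \<rightarrow>\<^sub>E fobj (top_model S) a"
  proof (rule PiE_I)
    fix z assume "z \<in> fobj (top_model T) a"
    then obtain w where w: "w \<in> maps T (espace a)" "z = enc_map T a w" by (auto simp: fobj_top_model)
    show "top_model_map T S f a z \<in> fobj (top_model S) a"
      unfolding w(2) top_model_map_eval[OF T a w(1)] fobj_top_model by (rule imageI[OF wf[OF w(1)]])
  qed (use a in \<open>simp add: top_model_map_def\<close>)
  fix b :: "'u eobj" and h z assume b: "b \<in> Obj E_cat" and h: "h \<in> Hom E_cat a b" and "z \<in> fobj (top_model T) a"
  then obtain w where w: "w \<in> maps T (espace a)" "z = enc_map T a w" by (auto simp: fobj_top_model)
  have h': "h \<in> E_hom a b" using h by simp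
  have "compose (topspace S) (compose (topspace T) (realizeE a b h) w) f =
      compose (topspace S) (realizeE a b h) (compose (topspace S) w f)"
    using maps_mem[OF f] by (auto simp: compose_def fun_eq_iff)
  then show "top_model_map T S f b (fmap (top_model T) a b h z) = fmap (top_model S) a b h (top_model_map T S f a z)"
    unfolding w(2) fmap_top_model[OF T a w(1)] top_model_map_eval[OF T a w(1)]
      fmap_top_model[OF S a wf[OF w(1)]] top_model_map_eval[OF T b compose_realizeE[OF T a b h' w(1)]]
    by simp
qed

abbreviation "top_functor \<equiv> \<lparr>fobj = top_model, fmap = top_model_map\<rparr>"

lemma top_functor:
  "is_functor (op_cat top_cat) (Mod_cat E_cat (E_cones :: ('u + cospan, unit, 'u eobj, 'u \<Rightarrow> 'u) cone set))
    (top_functor :: ('u topology, 'u \<Rightarrow> 'u, ('u eobj, 'u \<Rightarrow> 'u, 'u set, 'u \<Rightarrow> 'u) funct, 'u eobj \<Rightarrow> 'u \<Rightarrow> 'u) funct)"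
  unfolding is_functor_def Mod_cat_simps op_cat_def cat.simps funct.simps top_cat_simps mem_Collect_eq
proof (intro conjI ballI)
  fix T S R :: "'u topology" and f g
  assume "T \<in> {T. small TYPE('u) (topspace T)}"
  then have T: "small TYPE('u) (topspace T)" by simp
  show "is_model TYPE('u) E_cat E_cones (top_model T)" by (rule top_model_model[OF T])
  have ext: "top_model_map T S f a \<in> extensional (fobj (top_model T) a)" if "a \<in> Obj E_cat" for S a f
    using that by (simp add: top_model_map_def)
  show "top_model_map T T (\<lambda>x\<in>topspace T. x) = (\<lambda>a\<in>Obj E_cat. \<lambda>x\<in>fobj (top_model T) a. x)"
  proof (rule extensionalityI[of _ "Obj E_cat"])
    fix a :: "'u eobj" assume a: "a \<in> Obj E_cat"
    show "top_model_map T T (\<lambda>x\<in>topspace T. x) a = (\<lambda>a\<in>Obj E_cat. \<lambda>x\<in>fobj (top_model T) a. x) a"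
    proof (rule top_model_ext[OF T ext[OF a]])
      show "(\<lambda>a\<in>Obj E_cat. \<lambda>x\<in>fobj (top_model T) a. x) a \<in> extensional (fobj (top_model T) a)"
        using a by simp
      fix w assume w: "w \<in> maps T (espace a)"
      have "compose (topspace T) w (\<lambda>x\<in>topspace T. x) = w"
      proof (rule extensionalityI[of _ "topspace T"])
        show "w \<in> extensional (topspace T)" using w by (simp add: maps_def PiE_def)
      qed (simp_all add: compose_def)
      then show "top_model_map T T (\<lambda>x\<in>topspace T. x) a (enc_map T a w) =
          (\<lambda>a\<in>Obj E_cat. \<lambda>x\<in>fobj (top_model T) a. x) a (enc_map T a w)"
        using a w by (simp add: top_model_map_eval[OF T a w] fobj_top_model)
    qed
  qed (simp_all add: top_model_map_def)
  assume "S \<in> {T. small TYPE('u) (topspace T)}" and f: "f \<in> maps S T"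
  then have S: "small TYPE('u) (topspace S)" by simp
  show "top_model_map T S f \<in> nat_trans E_cat (set_cat TYPE('u)) (top_model T) (top_model S)"
    by (rule top_model_map_nat[OF T S f])
  assume "R \<in> {T. small TYPE('u) (topspace T)}" and g: "g \<in> maps R S"
  then have R: "small TYPE('u) (topspace R)" by simp
  show "top_model_map T R (compose (topspace R) f g) =
      (\<lambda>a\<in>Obj E_cat. compose (fobj (top_model T) a) (top_model_map S R g a) (top_model_map T S f a))"
  proof (rule extensionalityI[of _ "Obj E_cat"])
    fix a :: "'u eobj" assume a: "a \<in> Obj E_cat"
    show "top_model_map T R (compose (topspace R) f g) a =
        (\<lambda>a\<in>Obj E_cat. compose (fobj (top_model T) a) (top_model_map S R g a) (top_model_map T S f a)) a"
    proof (rule top_model_ext[OF T ext[OF a]])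
      show "(\<lambda>a\<in>Obj E_cat. compose (fobj (top_model T) a) (top_model_map S R g a) (top_model_map T S f a)) a
          \<in> extensional (fobj (top_model T) a)" using a by simp
      fix w assume w: "w \<in> maps T (espace a)"
      have "compose (topspace R) w (compose (topspace R) f g) = compose (topspace R) (compose (topspace S) w f) g"
        using maps_mem[OF g] by (auto simp: compose_def fun_eq_iff)
      then show "top_model_map T R (compose (topspace R) f g) a (enc_map T a w) =
          (\<lambda>a\<in>Obj E_cat. compose (fobj (top_model T) a) (top_model_map S R g a) (top_model_map T S f a)) a (enc_map T a w)"
        using a w by (simp add: top_model_map_eval[OF T a w] compose_eq fobj_top_model
            top_model_map_eval[OF S a maps_compose[OF f w]])
    qed
  qed (simp_all add: top_model_map_def)
qed

lemma top_functor_fully_faithful: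
  fixes S T :: "'u topology"
  assumes T: "small TYPE('u) (topspace T)" and S: "small TYPE('u) (topspace S)"
  shows "bij_betw (top_model_map T S) (maps S T) (nat_trans E_cat (set_cat TYPE('u)) (top_model T) (top_model S))"
  unfolding bij_betw_def
proof
  have pt: "small TYPE('u) (one_point :: 'u set)" by (rule small_point[OF universe])
  show "inj_on (top_model_map T S) (maps S T)"
  proof (rule inj_onI)
    fix f g assume f: "f \<in> maps S T" and g: "g \<in> maps S T" and eq: "top_model_map T S f = top_model_map T S g"
    let ?Y = "YPow (topspace T)" and ?d = "\<lambda>x\<in>topspace T. {x}"
    have Y: "?Y \<in> Obj E_cat" using T by (simp add: Obj_E_cat)
    have d: "?d \<in> maps T (espace ?Y)" unfolding maps_espace_iff by auto
    have "enc_map S ?Y (compose (topspace S) ?d f) = (enc_map S ?Y (compose (topspace S) ?d g) :: 'u)"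
      using eq top_model_map_eval[OF T Y d, of S] by metis
    then have deq: "compose (topspace S) ?d f = compose (topspace S) ?d g"
      using enc_map_eq_iff[OF S Y maps_compose[OF f d] maps_compose[OF g d]] by simp
    show "f = g"
    proof (rule maps_ext[OF f g])
      fix y assume y: "y \<in> topspace S"
      from fun_cong[OF deq, of y] have "?d (f y) = ?d (g y)" by (simp only: compose_eq[OF y])
      then show "f y = g y" using maps_mem[OF f y] maps_mem[OF g y] by simp
    qed
  qed
  show "top_model_map T S ` maps S T = nat_trans E_cat (set_cat TYPE('u)) (top_model T) (top_model S)"
  proof (rule equalityI; rule subsetI)
    fix \<tau> assume \<tau>: "\<tau> \<in> nat_trans E_cat (set_cat TYPE('u)) (top_model T) (top_model S)"
    define t where "t a w = dec_map S a (\<tau> a (enc_map T a w))" for a w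
    have t: "t a w \<in> maps S (espace a) \<and> \<tau> a (enc_map T a w) = enc_map S a (t a w)"
      if a: "a \<in> Obj E_cat" and w: "w \<in> maps T (espace a)" for a w
    proof -
      have "\<tau> a \<in> fobj (top_model T) a \<rightarrow>\<^sub>E fobj (top_model S) a"
        using \<tau> a unfolding nat_trans_set_cat_iff by blast
      then have "\<tau> a (enc_map T a w) \<in> fobj (top_model S) a"
        by (rule PiE_mem) (simp add: fobj_top_model w)
      then show ?thesis
        unfolding t_def fobj_top_model by (metis code_decode decode_in)
    qed
    have nat: "t b (compose (topspace T) r w) = compose (topspace S) r (t a w)"
      if a: "a \<in> Obj E_cat" and b: "b \<in> Obj E_cat" and r: "r \<in> maps (espace a) (espace b)"
        and w: "w \<in> maps T (espace a)" for a b r w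
    proof -
      have "r \<in> realizeE a b ` E_hom a b"
        using realizeE_bij[OF universe a b] r by (simp add: bij_betw_def)
      then obtain h where h: "h \<in> E_hom a b" and rh: "r = realizeE a b h" by blast
      have rw: "compose (topspace T) r w \<in> maps T (espace b)" by (rule maps_compose[OF w r])
      have "\<tau> b (fmap (top_model T) a b h (enc_map T a w)) = fmap (top_model S) a b h (\<tau> a (enc_map T a w))"
        using \<tau> a b h w unfolding nat_trans_set_cat_iff fobj_top_model by auto
      then have "enc_map S b (t b (compose (topspace T) r w)) = (enc_map S b (compose (topspace S) r (t a w)) :: 'u)"
        using t[OF a w] t[OF b rw] by (simp add: fmap_top_model[OF T a w] fmap_top_model[OF S a] rh)
      then show ?thesis
        using enc_map_eq_iff[OF S b conjunct1[OF t[OF b rw]] maps_compose[OF conjunct1[OF t[OF a w]] r]] by simp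
    qed
    obtain f where f: "f \<in> maps S T" and tf: "\<And>a w. a \<in> Obj E_cat \<Longrightarrow> w \<in> maps T (espace a) \<Longrightarrow> t a w = compose (topspace S) w f"
      using natural_maps_representable[OF T pt, of t S] t nat by blast
    have "\<tau> = top_model_map T S f"
    proof (rule extensionalityI[of _ "Obj E_cat"])
      show "\<tau> \<in> extensional (Obj E_cat)" using \<tau> unfolding nat_trans_set_cat_iff by blast
      fix a :: "'u eobj" assume a: "a \<in> Obj E_cat"
      show "\<tau> a = top_model_map T S f a"
      proof (rule top_model_ext[OF T])
        show "\<tau> a \<in> extensional (fobj (top_model T) a)"
          using \<tau> a unfolding nat_trans_set_cat_iff by (simp add: PiE_def)
        show "top_model_map T S f a \<in> extensional (fobj (top_model T) a)"
          using a by (simp add: top_model_map_def)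
        fix w assume w: "w \<in> maps T (espace a)"
        show "\<tau> a (enc_map T a w) = top_model_map T S f a (enc_map T a w)"
          using t[OF a w] tf[OF a w] by (simp add: top_model_map_eval[OF T a w])
      qed
    qed (simp add: top_model_map_def)
    then show "\<tau> \<in> top_model_map T S ` maps S T" using f by blast
  next
    fix \<tau> assume "\<tau> \<in> top_model_map T S ` maps S T"
    then show "\<tau> \<in> nat_trans E_cat (set_cat TYPE('u)) (top_model T) (top_model S)"
      using top_model_map_nat[OF T S] by blast
  qed
qed

end

section \<open>The space of points of a model\<close>

abbreviation X1 :: "'u eobj" where "X1 \<equiv> XPow one_point"
abbreviation Y1 :: "'u eobj" where "Y1 \<equiv> YPow one_point"

lemma maps_into_YPow: "r \<in> maps T (espace (YPow J)) \<longleftrightarrow> r \<in> topspace T \<rightarrow>\<^sub>E Pow J"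
  unfolding maps_espace_iff by simp

lemma PiE_restrict_ext: "f \<in> A \<rightarrow>\<^sub>E C \<Longrightarrow> (\<And>x. x \<in> A \<Longrightarrow> f x = g x) \<Longrightarrow> f = restrict g A"
  by (rule extensionalityI[of _ A]) (auto simp: PiE_def)

lemma proj_apply: "s \<in> Pow I \<Longrightarrow> proj I i s = {j \<in> one_point. i \<in> s}"
  by (simp add: proj_def)

lemma undefined_in_proj: "s \<in> Pow I \<Longrightarrow> undefined \<in> proj I i s \<longleftrightarrow> i \<in> s"
  by (simp add: proj_def)

lemma proj_maps_Y1: "proj (expo a) i \<in> maps (espace a) (espace Y1)"
  unfolding maps_into_YPow by (auto simp: proj_def)

lemma proj_maps_X1: "proj (I :: 'a set) i \<in> maps (sierp I) (espace X1)"
proof -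
  have gen: "{s \<in> Pow I. undefined \<in> proj I i s} = containing I i" by (auto simp: proj_def)
  show ?thesis
    unfolding maps_espace_iff
  proof (intro conjI allI impI ballI)
    show "proj I i \<in> topspace (sierp I) \<rightarrow>\<^sub>E pts X1"
      unfolding proj_def by (auto simp: restrict_PiE_iff)
    fix J :: "'a set" and j assume "X1 = XPow J" "j \<in> J"
    then have "j = undefined" by auto
    then show "openin (sierp I) {s \<in> topspace (sierp I). j \<in> proj I i s}"
      using openin_containing[of I i] by (simp only: gen topspace_sierp)
  qed
qed

lemma proj_maps_unit: "i \<in> expo a \<Longrightarrow> proj (expo a) i \<in> maps (espace a) (espace (unit_obj a))"
  using proj_maps_X1[of "expo a" i] proj_maps_Y1[of a i] by (cases a) simp_all

text \<open>
  A model, with morphisms of \<open>E\<close> replaced by the continuous maps that they stand for: \<open>act a b r\<close> is the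
  value of the model at the morphism realized by \<open>r\<close>.
\<close>

locale space_model =
  fixes M :: "'u eobj \<Rightarrow> 'u set" and act :: "'u eobj \<Rightarrow> 'u eobj \<Rightarrow> ('u set \<Rightarrow> 'u set) \<Rightarrow> 'u \<Rightarrow> 'u"
  assumes universe: "set_universe TYPE('u)"
    and small_M: "a \<in> Obj E_cat \<Longrightarrow> small TYPE('u) (M a)"
    and act_in: "a \<in> Obj E_cat \<Longrightarrow> b \<in> Obj E_cat \<Longrightarrow> r \<in> maps (espace a) (espace b) \<Longrightarrow> z \<in> M a
      \<Longrightarrow> act a b r z \<in> M b"
    and act_compose: "a \<in> Obj E_cat \<Longrightarrow> b \<in> Obj E_cat \<Longrightarrow> c \<in> Obj E_cat \<Longrightarrow>
      r \<in> maps (espace a) (espace b) \<Longrightarrow> r' \<in> maps (espace b) (espace c) \<Longrightarrow> z \<in> M a \<Longrightarrow>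
      act b c r' (act a b r z) = act a c (compose (pts a) r' r) z"
    and power: "a \<in> Obj E_cat \<Longrightarrow> (\<And>i. i \<in> expo a \<Longrightarrow> g i \<in> M (unit_obj a)) \<Longrightarrow>
      \<exists>!z. z \<in> M a \<and> (\<forall>i\<in>expo a. act a (unit_obj a) (proj (expo a) i) z = g i)"
    and mono: "inj_on (act X1 Y1 (\<lambda>s\<in>Pow one_point. s)) (M X1)"
begin

abbreviation B :: "'u set" where "B \<equiv> M Y1"
abbreviation YB :: "'u eobj" where "YB \<equiv> YPow B"

lemma Y1: "(Y1 :: 'u eobj) \<in> Obj E_cat" and X1: "(X1 :: 'u eobj) \<in> Obj E_cat"
  by (rule Y_Obj[OF universe], rule X_Obj[OF universe])

lemma YPow_Obj: "small TYPE('u) (J :: 'u set) \<Longrightarrow> YPow J \<in> Obj E_cat" by (simp add: Obj_E_cat)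
lemma XPow_Obj: "small TYPE('u) (J :: 'u set) \<Longrightarrow> XPow J \<in> Obj E_cat" by (simp add: Obj_E_cat)

lemma YB: "YB \<in> Obj E_cat" by (intro YPow_Obj small_M Y1)

lemma tuple:
  assumes "a \<in> Obj E_cat" "\<And>i. i \<in> expo a \<Longrightarrow> g i \<in> M (unit_obj a)"
  obtains z where "z \<in> M a" "\<And>i. i \<in> expo a \<Longrightarrow> act a (unit_obj a) (proj (expo a) i) z = g i"
  using ex1_implies_ex[OF power[of a g, OF assms]] by blast

lemma M_eqI:
  assumes a: "a \<in> Obj E_cat" and z: "z \<in> M a" "z' \<in> M a"
    and eq: "\<And>i. i \<in> expo a \<Longrightarrow> act a (unit_obj a) (proj (expo a) i) z = act a (unit_obj a) (proj (expo a) i) z'"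
  shows "z = z'"
proof -
  have "act a (unit_obj a) (proj (expo a) i) z' \<in> M (unit_obj a)" if "i \<in> expo a" for i
    by (rule act_in[OF a unit_obj_Obj[OF universe] proj_maps_unit[OF that] z(2)])
  from power[of a "\<lambda>i. act a (unit_obj a) (proj (expo a) i) z'", OF a this] have "\<exists>!y. y \<in> M a \<and> (\<forall>i\<in>expo a. act a (unit_obj a) (proj (expo a) i) y = act a (unit_obj a) (proj (expo a) i) z')" .
  then show ?thesis using z eq by (elim ex1E) metis
qed

text \<open>
  The tuple of all elements of \<open>B\<close>. It is an element of the power of \<open>M Y1\<close> with exponent \<open>B\<close>, and it
  generates the restriction of the model to the powers of \<open>Y\<close>.
\<close>

definition univ_el :: 'u where
  "univ_el = (SOME z. z \<in> M YB \<and> (\<forall>b\<in>B. act YB Y1 (proj B b) z = b))"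

lemma univ_el: "univ_el \<in> M YB" and univ_el_proj: "b \<in> B \<Longrightarrow> act YB Y1 (proj B b) univ_el = b"
proof -
  obtain z where "z \<in> M YB" "\<And>i. i \<in> B \<Longrightarrow> act YB Y1 (proj B i) z = i"
    using tuple[OF YB, of "\<lambda>i. i"] by auto
  then have "\<exists>z. z \<in> M YB \<and> (\<forall>b\<in>B. act YB Y1 (proj B b) z = b)" by blast
  from someI_ex[OF this] have "univ_el \<in> M YB \<and> (\<forall>b\<in>B. act YB Y1 (proj B b) univ_el = b)"
    unfolding univ_el_def .
  then show "univ_el \<in> M YB" "b \<in> B \<Longrightarrow> act YB Y1 (proj B b) univ_el = b" by simp_all
qed

text \<open>
  The value of a function \<open>u\<close> at the universal element. Elements of powers of \<open>M Y1\<close> are studied through the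
  functions that yield them.
\<close>

abbreviation ev :: "'u set \<Rightarrow> ('u set \<Rightarrow> 'u set) \<Rightarrow> 'u" where
  "ev K u \<equiv> act YB (YPow K) u univ_el"

lemma Y_maps: "(u :: 'u set \<Rightarrow> 'u set) \<in> Pow I \<rightarrow>\<^sub>E Pow K \<Longrightarrow> u \<in> maps (espace (YPow I)) (espace (YPow K))"
  unfolding maps_into_YPow by simp

lemma ev_in: "small TYPE('u) K \<Longrightarrow> u \<in> Pow B \<rightarrow>\<^sub>E Pow K \<Longrightarrow> ev K u \<in> M (YPow K)"
  by (intro act_in YB YPow_Obj Y_maps univ_el)

lemma act_ev:
  assumes "small TYPE('u) K" "u \<in> Pow B \<rightarrow>\<^sub>E Pow K" "b \<in> Obj E_cat" "r \<in> maps (espace (YPow K)) (espace b)"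
  shows "act (YPow K) b r (ev K u) = act YB b (compose (Pow B) r u) univ_el"
  using act_compose[OF YB YPow_Obj[OF assms(1)] assms(3) Y_maps[OF assms(2)] assms(4) univ_el] by simp

lemma act_ev_YPow:
  assumes "small TYPE('u) K" "u \<in> Pow B \<rightarrow>\<^sub>E Pow K" "small TYPE('u) J" "r \<in> Pow K \<rightarrow>\<^sub>E Pow J"
  shows "act (YPow K) (YPow J) r (ev K u) = ev J (compose (Pow B) r u)"
  by (rule act_ev[OF assms(1,2) YPow_Obj[OF assms(3)] Y_maps[OF assms(4)]])

lemma proj_PiE: "proj (K :: 'u set) k \<in> Pow K \<rightarrow>\<^sub>E Pow one_point"
  by (auto simp: proj_def)

lemma small_one: "small TYPE('u) (one_point :: 'u set)" by (rule small_point[OF universe])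

lemma ev_eqI:
  assumes K: "small TYPE('u) K" and u: "u \<in> Pow B \<rightarrow>\<^sub>E Pow K" and v: "v \<in> Pow B \<rightarrow>\<^sub>E Pow K"
    and eq: "\<And>k. k \<in> K \<Longrightarrow> ev one_point (compose (Pow B) (proj K k) u) = ev one_point (compose (Pow B) (proj K k) v)"
  shows "ev K u = ev K v"
proof (rule M_eqI[OF YPow_Obj[OF K] ev_in[OF K u] ev_in[OF K v]])
  fix i assume "i \<in> expo (YPow K)"
  then have i: "i \<in> K" by simp
  show "act (YPow K) (unit_obj (YPow K)) (proj (expo (YPow K)) i) (ev K u) =
      act (YPow K) (unit_obj (YPow K)) (proj (expo (YPow K)) i) (ev K v)"
    using eq[OF i] act_ev_YPow[OF K u small_one proj_PiE[of K i]] act_ev_YPow[OF K v small_one proj_PiE[of K i]] by simp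
qed

lemma ev_proj_eq:
  assumes K: "small TYPE('u) K" and u: "u \<in> Pow B \<rightarrow>\<^sub>E Pow K" and v: "v \<in> Pow B \<rightarrow>\<^sub>E Pow K"
    and eq: "ev K u = ev K v"
  shows "ev one_point (compose (Pow B) (proj K k) u) = ev one_point (compose (Pow B) (proj K k) v)"
  using act_ev_YPow[OF K u small_one proj_PiE[of K k]] act_ev_YPow[OF K v small_one proj_PiE[of K k]] eq by simp

text \<open>
  Definition of a function by cases, with the truth value \<open>q s\<close> as the condition.
\<close>

definition switch :: "('u set \<Rightarrow> 'u set) \<Rightarrow> ('u set \<Rightarrow> 'u set) \<Rightarrow> ('u set \<Rightarrow> 'u set) \<Rightarrow> 'u set \<Rightarrow> 'u set" where
  "switch q u v = (\<lambda>s\<in>Pow B. if undefined \<in> q s then u s else v s)"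

text \<open>
  Definition by cases is itself an operation of the model: the pair of the universal element and the
  value of \<open>q\<close> is an element of the power with exponent \<open>insert c B\<close> for some \<open>c\<close> outside \<open>B\<close>, and the function \<open>w\<close> on \<open>Pow (insert c B)\<close>
  chooses between \<open>u\<close> and \<open>v\<close> according to the coordinate \<open>c\<close>. So the result depends only on
  the value of \<open>q\<close> at the universal element.
\<close>

lemma ev_switch:
  assumes K: "small TYPE('u) K" and u: "u \<in> Pow B \<rightarrow>\<^sub>E Pow K" and v: "v \<in> Pow B \<rightarrow>\<^sub>E Pow K"
    and q: "q \<in> Pow B \<rightarrow>\<^sub>E Pow one_point" and q': "q' \<in> Pow B \<rightarrow>\<^sub>E Pow one_point"
    and eq: "ev one_point q = ev one_point q'"
  shows "ev K (switch q u v) = ev K (switch q' u v)"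
proof -
  have smB: "small TYPE('u) B" by (rule small_M[OF Y1])
  then have "B \<noteq> UNIV" using small_UNIV by metis
  then obtain c where c: "c \<notin> B" by blast
  let ?J = "insert c B"
  have J: "small TYPE('u) ?J" by (rule small_insert[OF universe smB])
  define p where "p q = (\<lambda>s\<in>Pow B. s \<union> (if undefined \<in> q s then {c} else {}))" for q :: "'u set \<Rightarrow> 'u set"
  have p: "p q \<in> Pow B \<rightarrow>\<^sub>E Pow ?J" for q by (auto simp: p_def split: if_splits)
  have p_c: "compose (Pow B) (proj ?J c) (p q) = q" if q: "q \<in> Pow B \<rightarrow>\<^sub>E Pow one_point" for q
  proof (rule extensionalityI[of _ "Pow B"])
    show "q \<in> extensional (Pow B)" using q by (simp add: PiE_def)
    fix s assume s: "s \<in> Pow B"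
    have qs: "q s \<in> Pow one_point" by (rule PiE_mem[OF q s])
    have cs: "c \<notin> s" using c s by blast
    have "proj ?J c (p q s) = {j \<in> one_point. c \<in> p q s}"
      by (rule proj_apply) (rule PiE_mem[OF p s])
    also have "\<dots> = q s" using qs s cs by (auto simp: p_def split: if_splits)
    finally show "compose (Pow B) (proj ?J c) (p q) s = q s" by (simp only: compose_eq[OF s])
  qed simp
  have p_b: "compose (Pow B) (proj ?J b) (p q) = proj B b" if b: "b \<in> B" for b q
  proof (rule extensionalityI[of _ "Pow B"])
    fix s assume s: "s \<in> Pow B"
    have bc: "b \<noteq> c" using b c by blast
    have "proj ?J b (p q s) = {j \<in> one_point. b \<in> p q s}"
      by (rule proj_apply) (rule PiE_mem[OF p s])
    also have "\<dots> = proj B b s" using s bc by (auto simp: p_def proj_def)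
    finally show "compose (Pow B) (proj ?J b) (p q) s = proj B b s" by (simp only: compose_eq[OF s])
  qed (simp_all add: proj_def)
  have evp: "ev ?J (p q) = ev ?J (p q')"
  proof (rule ev_eqI[OF J p p])
    fix k assume "k \<in> ?J"
    then show "ev one_point (compose (Pow B) (proj ?J k) (p q)) = ev one_point (compose (Pow B) (proj ?J k) (p q'))"
    proof
      assume k: "k = c"
      show ?thesis unfolding k p_c[OF q] p_c[OF q'] by (rule eq)
    next
      assume k: "k \<in> B"
      show ?thesis unfolding p_b[OF k] by (rule refl)
    qed
  qed
  define w where "w = (\<lambda>t\<in>Pow ?J. if c \<in> t then u (t \<inter> B) else v (t \<inter> B))"
  have w: "w \<in> Pow ?J \<rightarrow>\<^sub>E Pow K"
    unfolding w_def restrict_PiE_iff using PiE_mem[OF u] PiE_mem[OF v] by simp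
  have wp: "compose (Pow B) w (p q) = switch q u v" for q
  proof (rule extensionalityI[of _ "Pow B"])
    fix s assume s: "s \<in> Pow B"
    have "c \<in> p q s \<longleftrightarrow> undefined \<in> q s" "p q s \<inter> B = s" using s c by (auto simp: p_def split: if_splits)
    then have "w (p q s) = switch q u v s"
      using PiE_mem[OF p s, of q] s by (simp add: w_def switch_def)
    then show "compose (Pow B) w (p q) s = switch q u v s" by (simp only: compose_eq[OF s])
  qed (simp_all add: switch_def)
  have "ev K (switch q u v) = act (YPow ?J) (YPow K) w (ev ?J (p q))"
    unfolding act_ev_YPow[OF J p K w] wp by (rule refl)
  also have "\<dots> = ev K (switch q' u v)"
    unfolding evp unfolding act_ev_YPow[OF J p K w] wp by (rule refl)
  finally show ?thesis .
qed

definition indic :: "'u set set \<Rightarrow> 'u set \<Rightarrow> 'u set" where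
  "indic Q = (\<lambda>s\<in>Pow B. if s \<in> Q then one_point else {})"

lemma indic: "indic Q \<in> Pow B \<rightarrow>\<^sub>E Pow one_point" by (auto simp: indic_def)

text \<open>
  The properties of subsets of \<open>B\<close> that the universal element satisfies.
\<close>

definition true_sets :: "'u set set set" where
  "true_sets = {Q. Q \<subseteq> Pow B \<and> ev one_point (indic Q) = ev one_point (indic (Pow B))}"

definition points :: "'u set set" where "points = Pow B \<inter> \<Inter>true_sets"

lemma points_subset: "points \<subseteq> Pow B" by (auto simp: points_def)

lemma small_PB: "small TYPE('u) (Pow B)" by (intro small_Pow[OF universe] small_M Y1)

text \<open>
  All members of \<open>true_sets\<close> together, indexed by their codes, define a function into a power, and
  the universal element has the same value under it as under the function that is true at
  every index. Infinite conjunction is a function on that power, so it preserves this equality.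
\<close>

lemma points_true: "ev one_point (indic points) = ev one_point (indic (Pow B))"
proof -
  have smF: "small TYPE('u) true_sets"
    by (rule small_subset[OF _ small_Pow[OF universe small_PB]]) (auto simp: true_sets_def)
  let ?J = "code true_sets ` true_sets :: 'u set"
  have J: "small TYPE('u) ?J" by (rule small_image[OF smF])
  let ?p = "\<lambda>s\<in>Pow B. {j \<in> ?J. s \<in> decode true_sets j}" and ?t = "\<lambda>s\<in>Pow B. ?J"
  have p: "?p \<in> Pow B \<rightarrow>\<^sub>E Pow ?J" "?t \<in> Pow B \<rightarrow>\<^sub>E Pow ?J" by (auto simp: restrict_PiE_iff)
  have evp: "ev ?J ?p = ev ?J ?t"
  proof (rule ev_eqI[OF J p])
    fix j assume j: "j \<in> ?J"
    have "compose (Pow B) (proj ?J j) ?p = indic (decode true_sets j)"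
    proof (rule extensionalityI[of _ "Pow B"])
      fix s assume s: "s \<in> Pow B"
      have "proj ?J j (?p s) = {i \<in> one_point. j \<in> ?p s}" by (rule proj_apply) (rule PiE_mem[OF p(1) s])
      also have "\<dots> = indic (decode true_sets j) s" using s j by (simp add: indic_def)
      finally show "compose (Pow B) (proj ?J j) ?p s = indic (decode true_sets j) s" by (simp only: compose_eq[OF s])
    qed (simp_all add: indic_def)
    moreover have "compose (Pow B) (proj ?J j) ?t = indic (Pow B)"
    proof (rule extensionalityI[of _ "Pow B"])
      fix s assume s: "s \<in> Pow B"
      have "proj ?J j (?t s) = {i \<in> one_point. j \<in> ?t s}" by (rule proj_apply) (rule PiE_mem[OF p(2) s])
      also have "\<dots> = indic (Pow B) s" using s j by (simp add: indic_def)
      finally show "compose (Pow B) (proj ?J j) ?t s = indic (Pow B) s" by (simp only: compose_eq[OF s])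
    qed (simp_all add: indic_def)
    moreover have "ev one_point (indic (decode true_sets j)) = ev one_point (indic (Pow B))"
      using decode_in[OF j] by (simp add: true_sets_def)
    ultimately show "ev one_point (compose (Pow B) (proj ?J j) ?p) = ev one_point (compose (Pow B) (proj ?J j) ?t)"
      by (simp only:)
  qed
  define w where "w = (\<lambda>t\<in>Pow ?J. if t = ?J then one_point else {} :: 'u set)"
  have w: "w \<in> Pow ?J \<rightarrow>\<^sub>E Pow one_point" unfolding w_def by (auto simp: restrict_PiE_iff)
  have wp: "compose (Pow B) w ?p = indic points"
  proof (rule extensionalityI[of _ "Pow B"])
    fix s assume s: "s \<in> Pow B"
    have "?p s = ?J \<longleftrightarrow> (\<forall>j\<in>?J. s \<in> decode true_sets j)" using s by auto
    also have "\<dots> \<longleftrightarrow> (\<forall>Q\<in>true_sets. s \<in> Q)" using decode_code[OF smF] by auto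
    also have "\<dots> \<longleftrightarrow> s \<in> points" using s by (auto simp: points_def)
    finally have "w (?p s) = indic points s"
      using s PiE_mem[OF p(1) s] by (simp only: w_def indic_def restrict_apply')
    then show "compose (Pow B) w ?p s = indic points s" by (simp only: compose_eq[OF s])
  qed (simp_all add: indic_def)
  have wt: "compose (Pow B) w ?t = indic (Pow B)"
  proof (rule extensionalityI[of _ "Pow B"])
    fix s assume s: "s \<in> Pow B"
    have "w (?t s) = indic (Pow B) s" using s by (simp add: w_def indic_def)
    then show "compose (Pow B) w ?t s = indic (Pow B) s" by (simp only: compose_eq[OF s])
  qed (simp_all add: indic_def)
  have "ev one_point (indic points) = act (YPow ?J) Y1 w (ev ?J ?p)"
    unfolding act_ev_YPow[OF J p(1) small_one w] wp by (rule refl)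
  also have "\<dots> = act (YPow ?J) Y1 w (ev ?J ?t)" unfolding evp by (rule refl)
  also have "\<dots> = ev one_point (indic (Pow B))"
    unfolding act_ev_YPow[OF J p(2) small_one w] wt by (rule refl)
  finally show ?thesis .
qed

text \<open>
  If \<open>u\<close> and \<open>v\<close> agree on the points, then "\<open>u\<close> if the argument is a point, else \<open>v\<close>" is \<open>v\<close>, while
  "\<open>u\<close> if true, else \<open>v\<close>" is \<open>u\<close>; being a point and being true have the same value, so \<open>ev_switch\<close>
  applies. Conversely, if \<open>u\<close> and \<open>v\<close> have the same value, then the truth values "\<open>k \<in> u s\<close>" and "\<open>k \<in> v s\<close>" have the same
  value. Replacing one by the other in their equivalence turns it into true, so the set where they are
  equivalent belongs to \<open>true_sets\<close> and contains all points.
\<close>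

lemma ev_eq_iff:
  assumes K: "small TYPE('u) K" and u: "u \<in> Pow B \<rightarrow>\<^sub>E Pow K" and v: "v \<in> Pow B \<rightarrow>\<^sub>E Pow K"
  shows "ev K u = ev K v \<longleftrightarrow> (\<forall>s\<in>points. u s = v s)"
proof
  assume eq: "\<forall>s\<in>points. u s = v s"
  have "u = switch (indic (Pow B)) u v"
    unfolding switch_def by (rule PiE_restrict_ext[OF u]) (simp add: indic_def)
  moreover have "v = switch (indic points) u v"
    unfolding switch_def by (rule PiE_restrict_ext[OF v]) (use eq in \<open>auto simp: indic_def\<close>)
  ultimately show "ev K u = ev K v"
    using ev_switch[OF K u v indic indic points_true] by metis
next
  assume eq: "ev K u = ev K v"
  have "k \<in> u s \<longleftrightarrow> k \<in> v s" if s: "s \<in> points" and k: "k \<in> K" for k s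
  proof -
    let ?u = "compose (Pow B) (proj K k) u" and ?v = "compose (Pow B) (proj K k) v"
    let ?n = "\<lambda>s\<in>Pow B. one_point - ?v s"
    let ?Q = "{s \<in> Pow B. k \<in> u s \<longleftrightarrow> k \<in> v s}"
    have us: "?u s = {j \<in> one_point. k \<in> u s}" "?v s = {j \<in> one_point. k \<in> v s}" if "s \<in> Pow B" for s
      using proj_apply[OF PiE_mem[OF u that]] proj_apply[OF PiE_mem[OF v that]] by (simp_all only: compose_eq[OF that])
    have um: "?u \<in> Pow B \<rightarrow>\<^sub>E Pow one_point" "?v \<in> Pow B \<rightarrow>\<^sub>E Pow one_point"
      by (rule PiE_I; use us in \<open>auto simp: compose_def\<close>)+
    have nm: "?n \<in> Pow B \<rightarrow>\<^sub>E Pow one_point" by (auto simp: restrict_PiE_iff)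
    \<comment> \<open>the equivalence of two truth values as a definition by cases: \<open>v\<close> if \<open>u\<close>, else not \<open>v\<close>\<close>
    have chiQ: "switch ?u ?v ?n = indic ?Q"
      unfolding switch_def indic_def by (rule restrict_ext) (use us in auto)
    have chiT: "switch ?v ?v ?n = indic (Pow B)"
      unfolding switch_def indic_def by (rule restrict_ext) (use us in auto)
    have "ev one_point (switch ?u ?v ?n) = ev one_point (switch ?v ?v ?n)"
      by (rule ev_switch[OF small_one um(2) nm um]) (rule ev_proj_eq[OF K u v eq])
    then have "?Q \<in> true_sets" unfolding chiQ chiT true_sets_def by blast
    then have "s \<in> ?Q" using s by (auto simp: points_def)
    then show ?thesis by blast
  qed
  moreover have "u s \<subseteq> K" "v s \<subseteq> K" if "s \<in> points" for s
    using PiE_mem[OF u, of s] PiE_mem[OF v, of s] points_subset that by auto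
  ultimately show "\<forall>s\<in>points. u s = v s" by blast
qed

text \<open>
  The value of an element \<open>z\<close> at a point \<open>s\<close>. The coordinates of \<open>z\<close>, sent to \<open>B = M Y1\<close>, are compared with
  the set \<open>s\<close> of those elements of \<open>B\<close> that are true at the point.
\<close>

definition val_at :: "'u eobj \<Rightarrow> 'u \<Rightarrow> 'u set \<Rightarrow> 'u set" where
  "val_at a z = (\<lambda>s\<in>Pow B. {k \<in> expo a. act a Y1 (proj (expo a) k) z \<in> s})"

lemma val_at_in: "val_at a z \<in> Pow B \<rightarrow>\<^sub>E pts a" by (auto simp: val_at_def)

text \<open>
  The space of \<open>under a\<close> is that of \<open>a\<close> with the indiscrete topology, and \<open>under_map a\<close> is the identity function
  between the two.
\<close>

abbreviation under :: "'u eobj \<Rightarrow> 'u eobj" where "under a \<equiv> YPow (expo a)"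
abbreviation under_map :: "'u eobj \<Rightarrow> 'u set \<Rightarrow> 'u set" where "under_map a \<equiv> (\<lambda>s\<in>pts a. s)"

lemma under: "a \<in> Obj (E_cat :: ('u eobj, 'u \<Rightarrow> 'u) cat) \<Longrightarrow> under a \<in> Obj E_cat" by (simp add: Obj_E_cat)

lemma small_expo: "a \<in> Obj (E_cat :: ('u eobj, 'u \<Rightarrow> 'u) cat) \<Longrightarrow> small TYPE('u) (expo a)"
  by (simp add: Obj_E_cat)

lemma under_map: "under_map a \<in> maps (espace a) (espace (under a))"
  unfolding maps_into_YPow by (simp add: restrict_PiE_iff)

lemma compose_under_map: "r \<in> A \<rightarrow>\<^sub>E pts a \<Longrightarrow> compose A (under_map a) r = r"
proof (rule extensionalityI[of _ A])
  assume r: "r \<in> A \<rightarrow>\<^sub>E pts a"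
  show "r \<in> extensional A" using r by (simp add: PiE_def)
  show "compose A (under_map a) r x = r x" if x: "x \<in> A" for x
    using PiE_mem[OF r x] by (simp add: compose_eq[OF x])
qed simp

lemma compose_under_map': "r \<in> pts a \<rightarrow>\<^sub>E C \<Longrightarrow> compose (pts a) r (under_map a) = r"
proof (rule extensionalityI[of _ "pts a"])
  assume r: "r \<in> pts a \<rightarrow>\<^sub>E C"
  show "r \<in> extensional (pts a)" using r by (simp add: PiE_def)
qed (simp_all add: compose_def)

text \<open>
  Every element is the value of a function at the universal element, up to the passage to the indiscrete space:
  both sides have the same coordinates, since the coordinate with index \<open>k\<close> is the value of the projection of \<open>Pow B\<close> to
  that coordinate, by the defining property of the universal element.
\<close>

lemma act_underlying:
  assumes a: "a \<in> Obj E_cat" and z: "z \<in> M a"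
  shows "act a (under a) (under_map a) z = ev (expo a) (val_at a z)"
proof (rule M_eqI[OF under[OF a] act_in[OF a under[OF a] under_map z] ev_in[OF small_expo[OF a] val_at_in]])
  fix k assume "k \<in> expo (under a)"
  then have k: "k \<in> expo a" by simp
  let ?b = "act a Y1 (proj (expo a) k) z"
  have b: "?b \<in> B" by (rule act_in[OF a Y1 proj_maps_Y1 z])
  have "act (under a) Y1 (proj (expo a) k) (act a (under a) (under_map a) z) = act a Y1 (compose (pts a) (proj (expo a) k) (under_map a)) z"
    by (rule act_compose[OF a under[OF a] Y1 under_map Y_maps[OF proj_PiE] z])
  also have "\<dots> = ?b" by (simp only: compose_under_map'[OF proj_PiE])
  also have "\<dots> = act YB Y1 (proj B ?b) univ_el" by (rule univ_el_proj[OF b, symmetric])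
  also have "proj B ?b = compose (Pow B) (proj (expo a) k) (val_at a z)"
  proof (rule extensionalityI[of _ "Pow B"])
    fix s assume s: "s \<in> Pow B"
    have "proj (expo a) k (val_at a z s) = {j \<in> one_point. k \<in> val_at a z s}"
      by (rule proj_apply) (rule PiE_mem[OF val_at_in s])
    also have "\<dots> = proj B ?b s" using s k by (simp add: val_at_def proj_def)
    finally show "proj B ?b s = compose (Pow B) (proj (expo a) k) (val_at a z) s" by (simp only: compose_eq[OF s])
  qed (simp_all add: proj_def)
  also have "act YB Y1 \<dots> univ_el = act (under a) Y1 (proj (expo a) k) (ev (expo a) (val_at a z))"
    by (rule act_ev_YPow[OF small_expo[OF a] val_at_in small_one proj_PiE, symmetric])
  finally show "act (under a) (unit_obj (under a)) (proj (expo (under a)) k) (act a (under a) (under_map a) z) =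
      act (under a) (unit_obj (under a)) (proj (expo (under a)) k) (ev (expo a) (val_at a z))"
    by (simp only: unit_obj.simps expo.simps)
qed

text \<open>
  After the passage to indiscrete spaces both sides are values of functions at the universal element,
  so \<open>ev_eq_iff\<close> applies.
\<close>

lemma val_at_natural:
  assumes a: "a \<in> Obj E_cat" and b: "b \<in> Obj E_cat" and r: "r \<in> maps (espace a) (espace b)"
    and z: "z \<in> M a" and s: "s \<in> points"
  shows "val_at b (act a b r z) s = r (val_at a z s)"
proof -
  have rE: "r \<in> pts a \<rightarrow>\<^sub>E pts b" using r by (simp add: maps_def)
  have rY: "r \<in> maps (espace (under a)) (espace (under b))" by (rule Y_maps[OF rE])
  have rrp: "compose (Pow B) r (val_at a z) \<in> Pow B \<rightarrow>\<^sub>E pts b"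
  proof (rule PiE_I)
    fix s assume s: "s \<in> Pow B"
    show "compose (Pow B) r (val_at a z) s \<in> pts b"
      unfolding compose_eq[OF s] by (rule PiE_mem[OF rE PiE_mem[OF val_at_in s]])
  qed (simp add: compose_def)
  have "ev (expo b) (val_at b (act a b r z)) = act b (under b) (under_map b) (act a b r z)"
    by (rule act_underlying[OF b act_in[OF a b r z], symmetric])
  also have "\<dots> = act a (under b) (compose (pts a) (under_map b) r) z"
    by (rule act_compose[OF a b under[OF b] r under_map z])
  also have "compose (pts a) (under_map b) r = compose (pts a) r (under_map a)"
    unfolding compose_under_map[OF rE] compose_under_map'[OF rE] by (rule refl)
  also have "act a (under b) \<dots> z = act (under a) (under b) r (act a (under a) (under_map a) z)"
    by (rule act_compose[OF a under[OF a] under[OF b] under_map rY z, symmetric])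
  also have "\<dots> = act (under a) (under b) r (ev (expo a) (val_at a z))"
    unfolding act_underlying[OF a z] by (rule refl)
  also have "\<dots> = ev (expo b) (compose (Pow B) r (val_at a z))"
    by (rule act_ev_YPow[OF small_expo[OF a] val_at_in small_expo[OF b] rE])
  finally have "val_at b (act a b r z) s = compose (Pow B) r (val_at a z) s"
    using s unfolding ev_eq_iff[OF small_expo[OF b] val_at_in rrp] by blast
  moreover have "s \<in> Pow B" using s points_subset by blast
  ultimately show ?thesis by (simp only: compose_eq)
qed

text \<open>
  Equal values at all points give equal coordinates in \<open>M Y1\<close>. Coordinates in \<open>M X1\<close> are determined
  by their images in \<open>M Y1\<close> since \<open>phi\<close> acts injectively.
\<close>

lemma val_at_inj:
  assumes a: "a \<in> Obj E_cat" and z: "z \<in> M a" and z': "z' \<in> M a"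
    and eq: "\<And>s. s \<in> points \<Longrightarrow> val_at a z s = val_at a z' s"
  shows "z = z'"
proof -
  have eveq: "act a (under a) (under_map a) z = act a (under a) (under_map a) z'"
    unfolding act_underlying[OF a z] act_underlying[OF a z'] ev_eq_iff[OF small_expo[OF a] val_at_in val_at_in]
    using eq by blast
  have "act (under a) Y1 (proj (expo a) k) (act a (under a) (under_map a) y) = act a Y1 (proj (expo a) k) y" if "y \<in> M a" for k y
    using act_compose[OF a under[OF a] Y1 under_map Y_maps[OF proj_PiE] that] by (simp only: compose_under_map'[OF proj_PiE])
  then have coord: "act a Y1 (proj (expo a) k) z = act a Y1 (proj (expo a) k) z'" for k
    using eveq z z' by metis
  show ?thesis
  proof (rule M_eqI[OF a z z'])
    fix k assume k: "k \<in> expo a"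
    show "act a (unit_obj a) (proj (expo a) k) z = act a (unit_obj a) (proj (expo a) k) z'"
    proof (cases a)
      case (YPow K)
      then show ?thesis using coord[of k] by simp
    next
      case (XPow K)
      have p: "proj (expo a) k \<in> maps (espace a) (espace X1)"
        using proj_maps_unit[OF k] XPow by simp
      have i1: "under_map X1 \<in> maps (espace X1) (espace Y1)" using under_map[of X1] by simp
      have "act X1 Y1 (under_map X1) (act a X1 (proj (expo a) k) y) = act a Y1 (proj (expo a) k) y" if "y \<in> M a" for y
        using act_compose[OF a X1 Y1 p i1 that] compose_under_map[of "proj (expo a) k" "pts a" X1] proj_PiE[of "expo a" k]
        by (simp only: expo.simps)
      then have "act X1 Y1 (under_map X1) (act a X1 (proj (expo a) k) z) = act X1 Y1 (under_map X1) (act a X1 (proj (expo a) k) z')"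
        using coord[of k] z z' by metis
      then have "act a X1 (proj (expo a) k) z = act a X1 (proj (expo a) k) z'"
        using inj_onD[OF mono _ act_in[OF a X1 p z] act_in[OF a X1 p z']] by (simp only: expo.simps)
      then show ?thesis using XPow by simp
    qed
  qed
qed

abbreviation pcode :: "'u set \<Rightarrow> 'u" where "pcode \<equiv> code (Pow B)"
abbreviation pdecode :: "'u \<Rightarrow> 'u set" where "pdecode \<equiv> decode (Pow B)"

lemma pdecode: "s \<in> points \<Longrightarrow> pdecode (pcode s) = s"
  using decode_code[OF small_PB] points_subset by blast

definition open_of :: "'u \<Rightarrow> 'u set" where
  "open_of z = {x \<in> pcode ` points. undefined \<in> val_at X1 z (pdecode x)}"

text \<open>
  A continuous operation on truth values with small arity acts on the elements of \<open>M X1\<close>, and it does so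
  pointwise. The arity is a set \<open>K\<close> of elements of \<open>M X1\<close>, and the operation is applied to the tuple of all members
  of \<open>K\<close>.
\<close>

lemma open_operation:
  assumes K: "K \<subseteq> M X1" and w: "w \<in> maps (sierp K) (espace X1)"
  obtains z where "z \<in> M X1" "\<And>s. s \<in> points \<Longrightarrow> val_at X1 z s = w {k \<in> K. undefined \<in> val_at X1 k s}"
proof -
  have smK: "small TYPE('u) K" by (rule small_subset[OF K small_M[OF X1]])
  note XK = XPow_Obj[OF smK]
  obtain zz where zz: "zz \<in> M (XPow K)" and coord: "\<And>k. k \<in> K \<Longrightarrow> act (XPow K) X1 (proj K k) zz = k"
    using tuple[OF XK, of "\<lambda>k. k"] K by auto
  have w': "w \<in> maps (espace (XPow K)) (espace X1)" using w by simp
  have val_zz: "val_at (XPow K) zz s = {k \<in> K. undefined \<in> val_at X1 k s}" if s: "s \<in> points" for s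
  proof -
    have sub: "val_at (XPow K) zz s \<in> Pow K" using PiE_mem[OF val_at_in, of s "XPow K" zz] s points_subset by auto
    have "k \<in> val_at (XPow K) zz s \<longleftrightarrow> undefined \<in> val_at X1 k s" if k: "k \<in> K" for k
      using val_at_natural[OF XK X1 _ zz s, of "proj K k"] proj_maps_X1[of K k] coord[OF k] undefined_in_proj[OF sub, of k]
      by simp
    then show ?thesis using sub by blast
  qed
  show ?thesis
  proof (rule that)
    show "act (XPow K) X1 w zz \<in> M X1" by (rule act_in[OF XK X1 w' zz])
    show "val_at X1 (act (XPow K) X1 w zz) s = w {k \<in> K. undefined \<in> val_at X1 k s}" if "s \<in> points" for s
      using val_at_natural[OF XK X1 w' zz that] val_zz[OF that] by simp
  qed
qed

text \<open>
  Binary intersection, arbitrary union and the whole space are the instances in which \<open>W\<close> consists of the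
  full subset of \<open>{y, z}\<close>, of the nonempty subsets of \<open>K\<close>, and of the only subset of \<open>{}\<close>.
\<close>

lemma open_operation':
  assumes K: "K \<subseteq> M X1" and W: "openin (sierp K) W"
  obtains z where "z \<in> M X1" "open_of z = {x \<in> pcode ` points. {k \<in> K. x \<in> open_of k} \<in> W}"
proof -
  let ?w = "\<lambda>t\<in>Pow K. if t \<in> W then one_point else {} :: 'u set"
  have sub: "W \<subseteq> Pow K" using openin_subset[OF W] by simp
  have "{t \<in> Pow K. undefined \<in> ?w t} = W" using sub by auto
  then have w: "?w \<in> maps (sierp K) (espace X1)"
    unfolding maps_espace_iff using W by auto
  obtain z where z: "z \<in> M X1" "\<And>s. s \<in> points \<Longrightarrow> val_at X1 z s = ?w {k \<in> K. undefined \<in> val_at X1 k s}"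
    using open_operation[OF K w] by blast
  have "undefined \<in> val_at X1 z (pdecode x) \<longleftrightarrow> {k \<in> K. x \<in> open_of k} \<in> W" if x: "x \<in> pcode ` points" for x
  proof -
    have s: "pdecode x \<in> points" using x pdecode by auto
    have "{k \<in> K. undefined \<in> val_at X1 k (pdecode x)} = {k \<in> K. x \<in> open_of k}" using x by (auto simp: open_of_def)
    then show ?thesis using z(2)[OF s] by auto
  qed
  then have "open_of z = {x \<in> pcode ` points. {k \<in> K. x \<in> open_of k} \<in> W}" unfolding open_of_def[of z] by blast
  then show ?thesis using that z(1) by blast
qed

definition pt_space :: "'u topology" where
  "pt_space = topology (\<lambda>U. \<exists>z\<in>M X1. U = open_of z)"

lemma open_of_subset: "open_of z \<subseteq> pcode ` points" by (auto simp: open_of_def)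

lemma openin_pt_space: "openin pt_space U \<longleftrightarrow> (\<exists>z\<in>M X1. U = open_of z)"
proof -
  have "istopology (\<lambda>U. \<exists>z\<in>M X1. U = open_of z)"
    unfolding istopology_def
  proof (intro conjI allI impI)
    fix S T assume "\<exists>z\<in>M X1. S = open_of z" "\<exists>z\<in>M X1. T = open_of z"
    then obtain y z where y: "y \<in> M X1" "S = open_of y" and z: "z \<in> M X1" "T = open_of z" by blast
    have "openin (sierp {y, z}) {{y, z}}" unfolding openin_sierp by auto
    then obtain u where u: "u \<in> M X1" "open_of u = {x \<in> pcode ` points. {k \<in> {y, z}. x \<in> open_of k} \<in> {{y, z}}}"
      using open_operation'[of "{y, z}" "{{y, z}}"] y z by auto
    have "open_of u = S \<inter> T" unfolding u(2) y(2) z(2) using open_of_subset by blast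
    then show "\<exists>z\<in>M X1. S \<inter> T = open_of z" using u(1) by blast
  next
    fix \<K> assume \<K>: "\<forall>S\<in>\<K>. \<exists>z\<in>M X1. S = open_of z"
    let ?K = "{z \<in> M X1. open_of z \<in> \<K>}"
    have "openin (sierp ?K) {t. t \<subseteq> ?K \<and> t \<noteq> {}}"
      unfolding openin_sierp
    proof (intro conjI ballI)
      fix t assume "t \<in> {t. t \<subseteq> ?K \<and> t \<noteq> {}}"
      then obtain k where k: "k \<in> t" by blast
      show "\<exists>F\<subseteq>t. finite F \<and> (\<forall>t. F \<subseteq> t \<and> t \<subseteq> ?K \<longrightarrow> t \<in> {t. t \<subseteq> ?K \<and> t \<noteq> {}})"
        by (rule exI[of _ "{k}"]) (use k in blast)
    qed blast
    then obtain u where u: "u \<in> M X1" "open_of u = {x \<in> pcode ` points. {k \<in> ?K. x \<in> open_of k} \<in> {t. t \<subseteq> ?K \<and> t \<noteq> {}}}"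
      using open_operation'[of ?K] by blast
    have "open_of u = (\<Union>k\<in>?K. open_of k)" unfolding u(2) using open_of_subset by blast
    also have "\<dots> = \<Union>\<K>"
    proof -
      have "open_of ` ?K = \<K>"
      proof (rule equalityI; rule subsetI)
        fix S assume S: "S \<in> \<K>"
        then obtain z where "z \<in> M X1" "S = open_of z" using \<K> by (meson bspec)
        then show "S \<in> open_of ` ?K" using S by simp
      qed auto
      then show ?thesis by simp
    qed
    finally show "\<exists>z\<in>M X1. \<Union>\<K> = open_of z" using u(1) by metis
  qed
  then show ?thesis by (simp add: pt_space_def)
qed

lemma topspace_pt_space: "topspace pt_space = pcode ` points"
proof
  show "topspace pt_space \<subseteq> pcode ` points"
    unfolding topspace_def openin_pt_space using open_of_subset by blast
  have "openin (sierp ({} :: 'u set)) {{}}" unfolding openin_sierp by auto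
  then obtain u where u: "u \<in> M X1" "open_of u = {x \<in> pcode ` points. {k \<in> {}. x \<in> open_of k} \<in> {{}}}"
    using open_operation'[of "{}" "{{}}"] by auto
  then have "openin pt_space (pcode ` points)" unfolding openin_pt_space by auto
  then show "pcode ` points \<subseteq> topspace pt_space" by (rule openin_subset)
qed

definition rep :: "'u eobj \<Rightarrow> 'u \<Rightarrow> 'u \<Rightarrow> 'u set" where
  "rep a z = (\<lambda>x\<in>topspace pt_space. val_at a z (pdecode x))"

lemma pdecode_points: "x \<in> topspace pt_space \<Longrightarrow> pdecode x \<in> points"
  unfolding topspace_pt_space using pdecode by auto

lemma rep_natural:
  assumes a: "a \<in> Obj E_cat" and b: "b \<in> Obj E_cat" and r: "r \<in> maps (espace a) (espace b)" and z: "z \<in> M a"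
  shows "rep b (act a b r z) = compose (topspace pt_space) r (rep a z)"
proof (rule extensionalityI[of _ "topspace pt_space"])
  fix x assume x: "x \<in> topspace pt_space"
  show "rep b (act a b r z) x = compose (topspace pt_space) r (rep a z) x"
    using val_at_natural[OF a b r z pdecode_points[OF x]] x by (simp add: rep_def compose_def)
qed (simp_all add: rep_def)

lemma rep_pts: "x \<in> topspace pt_space \<Longrightarrow> rep a z x \<in> pts a"
proof -
  assume x: "x \<in> topspace pt_space"
  have "pdecode x \<in> Pow B" using pdecode_points[OF x] points_subset by blast
  from PiE_mem[OF val_at_in[of a z] this] show ?thesis using x by (simp add: rep_def)
qed

lemma mem_rep_XPow:
  assumes a: "XPow I \<in> Obj E_cat" and z: "z \<in> M (XPow I)" and i: "i \<in> I" and x: "x \<in> topspace pt_space"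
  shows "i \<in> rep (XPow I) z x \<longleftrightarrow> x \<in> open_of (act (XPow I) X1 (proj I i) z)"
proof -
  have p: "proj I i \<in> maps (espace (XPow I)) (espace X1)" using proj_maps_X1[of I i] by simp
  have sub: "rep (XPow I) z x \<in> Pow I" using rep_pts[OF x, of "XPow I"] by simp
  have "rep X1 (act (XPow I) X1 (proj I i) z) x = proj I i (rep (XPow I) z x)"
    using fun_cong[OF rep_natural[OF a X1 p z], of x] by (simp only: compose_eq[OF x])
  then have "undefined \<in> rep X1 (act (XPow I) X1 (proj I i) z) x \<longleftrightarrow> i \<in> rep (XPow I) z x"
    using undefined_in_proj[OF sub] by simp
  then show ?thesis using x by (simp add: open_of_def rep_def topspace_pt_space)
qed

lemma rep_maps:
  assumes a: "a \<in> Obj E_cat" and z: "z \<in> M a"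
  shows "rep a z \<in> maps pt_space (espace a)"
  unfolding maps_espace_iff
proof (intro conjI allI impI ballI)
  show "rep a z \<in> topspace pt_space \<rightarrow>\<^sub>E pts a"
    by (rule PiE_I) (use rep_pts in \<open>simp_all add: rep_def\<close>)
  fix I i assume aI: "a = XPow I" and i: "i \<in> I"
  have p: "proj I i \<in> maps (espace (XPow I)) (espace X1)" using proj_maps_X1[of I i] by simp
  let ?y = "act (XPow I) X1 (proj I i) z"
  have y: "?y \<in> M X1" using act_in[OF a[unfolded aI] X1 p z[unfolded aI]] .
  have "{x \<in> topspace pt_space. i \<in> rep a z x} = open_of ?y"
    using mem_rep_XPow[OF a[unfolded aI] z[unfolded aI] i] open_of_subset[of ?y] unfolding aI topspace_pt_space by blast
  then show "openin pt_space {x \<in> topspace pt_space. i \<in> rep a z x}"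
    unfolding openin_pt_space using y by blast
qed

text \<open>
  For \<open>YPow K\<close> a function on the points is extended to \<open>Pow B\<close> in an arbitrary way and evaluated at the universal
  element. For \<open>XPow I\<close> a continuous map is a family of open sets, hence a family of elements of \<open>M X1\<close>, and these are the
  coordinates of an element.
\<close>

lemma rep_surj:
  assumes a: "a \<in> Obj E_cat" and w: "w \<in> maps pt_space (espace a)"
  shows "\<exists>z\<in>M a. rep a z = w"
proof -
  have wE: "w \<in> topspace pt_space \<rightarrow>\<^sub>E pts a" using w by (simp add: maps_def)
  show ?thesis
  proof (cases a)
    case (YPow K)
    have K: "small TYPE('u) K" using small_expo[OF a] YPow by simp
    let ?u = "\<lambda>s\<in>Pow B. if s \<in> points then w (pcode s) else {}"
    have u: "?u \<in> Pow B \<rightarrow>\<^sub>E Pow K"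
      unfolding restrict_PiE_iff using PiE_mem[OF wE] YPow by (auto simp: topspace_pt_space)
    have z: "ev K ?u \<in> M a" using ev_in[OF K u] YPow by simp
    have eK: "expo a = K" and aK: "under a = YPow K" using YPow by simp_all
    have "ev K (val_at a (ev K ?u)) = act a (under a) (under_map a) (ev K ?u)"
      using act_underlying[OF a z] unfolding eK by (rule sym)
    also have "\<dots> = ev K (compose (Pow B) (under_map a) ?u)"
      using act_ev_YPow[OF K u K, of "under_map a"] unfolding YPow by (simp add: restrict_PiE_iff)
    also have "compose (Pow B) (under_map a) ?u = ?u"
      using compose_under_map[of ?u "Pow B" a] u unfolding eK by blast
    finally have eq: "\<forall>s\<in>points. val_at a (ev K ?u) s = ?u s"
      using ev_eq_iff[OF K _ u, of "val_at a (ev K ?u)"] val_at_in[of a "ev K ?u"] unfolding eK by blast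
    have "rep a (ev K ?u) = w"
    proof (rule extensionalityI[of _ "topspace pt_space"])
      show "w \<in> extensional (topspace pt_space)" using wE by (simp add: PiE_def)
      fix x assume x: "x \<in> topspace pt_space"
      have s: "pdecode x \<in> points" by (rule pdecode_points[OF x])
      have px: "pcode (pdecode x) = x" using x pdecode unfolding topspace_pt_space by auto
      have "rep a (ev K ?u) x = ?u (pdecode x)" using eq s x by (simp add: rep_def)
      also have "\<dots> = w x" using s points_subset px by auto
      finally show "rep a (ev K ?u) x = w x" .
    qed (simp add: rep_def)
    then show ?thesis using z by blast
  next
    case (XPow I)
    have "\<exists>y\<in>M X1. {x \<in> topspace pt_space. i \<in> w x} = open_of y" if "i \<in> I" for i
      using w that unfolding maps_espace_iff XPow openin_pt_space by blast
    then obtain y where y: "\<And>i. i \<in> I \<Longrightarrow> y i \<in> M X1"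
      and yw: "\<And>i. i \<in> I \<Longrightarrow> {x \<in> topspace pt_space. i \<in> w x} = open_of (y i)" by metis
    obtain z where z: "z \<in> M (XPow I)" and zy: "\<And>i. i \<in> I \<Longrightarrow> act (XPow I) X1 (proj I i) z = y i"
      using tuple[OF a, of y] y unfolding XPow by auto
    have "rep a z = w"
    proof (rule extensionalityI[of _ "topspace pt_space"])
      show "w \<in> extensional (topspace pt_space)" using wE by (simp add: PiE_def)
      fix x assume x: "x \<in> topspace pt_space"
      have "i \<in> rep a z x \<longleftrightarrow> i \<in> w x" if i: "i \<in> I" for i
        using mem_rep_XPow[OF a[unfolded XPow] z i x] zy[OF i] yw[OF i] x unfolding XPow by auto
      moreover have "rep a z x \<subseteq> I" "w x \<subseteq> I" using rep_pts[OF x, of a z] PiE_mem[OF wE x] XPow by simp_all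
      ultimately show "rep a z x = w x" by blast
    qed (simp add: rep_def)
    then show ?thesis using z XPow by blast
  qed
qed

lemma rep_bij:
  assumes a: "a \<in> Obj E_cat"
  shows "bij_betw (rep a) (M a) (maps pt_space (espace a))"
  unfolding bij_betw_def
proof
  show "inj_on (rep a) (M a)"
  proof (rule inj_onI)
    fix z z' assume z: "z \<in> M a" "z' \<in> M a" and eq: "rep a z = rep a z'"
    show "z = z'"
    proof (rule val_at_inj[OF a z])
      fix s assume s: "s \<in> points"
      then have x: "pcode s \<in> topspace pt_space" by (simp add: topspace_pt_space)
      show "val_at a z s = val_at a z' s"
        using fun_cong[OF eq, of "pcode s"] x by (simp add: rep_def pdecode[OF s])
    qed
  qed
  show "rep a ` M a = maps pt_space (espace a)"
    using rep_maps[OF a] rep_surj[OF a] by blast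
qed

lemma small_pt_space: "small TYPE('u) (topspace pt_space)"
  unfolding topspace_pt_space by (rule small_image[OF small_subset[OF points_subset small_PB]])

end

section \<open>The equivalence of categories\<close>

definition mor_of :: "'u eobj \<Rightarrow> 'u eobj \<Rightarrow> ('u set \<Rightarrow> 'u set) \<Rightarrow> 'u \<Rightarrow> 'u" where
  "mor_of a b = inv_into (E_hom a b) (realizeE a b)"

context
  assumes universe: "set_universe TYPE('u)"
begin

lemma mor_of:
  fixes a b :: "'u eobj"
  assumes "a \<in> Obj E_cat" "b \<in> Obj E_cat" "r \<in> maps (espace a) (espace b)"
  shows "mor_of a b r \<in> E_hom a b" "realizeE a b (mor_of a b r) = r"
proof -
  have r: "r \<in> realizeE a b ` E_hom a b"
    using realizeE_bij[OF universe assms(1,2)] assms(3) by (simp add: bij_betw_def)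
  show "mor_of a b r \<in> E_hom a b" "realizeE a b (mor_of a b r) = r"
    unfolding mor_of_def by (rule inv_into_into[OF r], rule f_inv_into_f[OF r])
qed

lemma mor_of_eqI:
  fixes a b :: "'u eobj"
  assumes a: "a \<in> Obj E_cat" and b: "b \<in> Obj E_cat" and f: "f \<in> E_hom a b" and r: "realizeE a b f = r"
  shows "mor_of a b r = f"
proof -
  have "r \<in> maps (espace a) (espace b)" using realizeE_in[OF universe a b f] r by simp
  from mor_of[OF a b this] show ?thesis
    by (intro realizeE_inj[OF universe a b _ f]) (simp_all add: r)
qed

lemma model_space_model:
  fixes M :: "('u eobj, 'u \<Rightarrow> 'u, 'u set, 'u \<Rightarrow> 'u) funct"
  assumes M: "is_model TYPE('u) E_cat E_cones M"
  shows "space_model (fobj M) (\<lambda>a b r. fmap M a b (mor_of a b r))"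
proof
  note fct = model_functor[OF M]
  note crit = M[unfolded functor_E_model_iff[OF universe fct]]
  show "set_universe TYPE('u)" by (rule universe)
  fix a :: "'u eobj" assume a: "a \<in> Obj E_cat"
  show "small TYPE('u) (fobj M a)" using functor_obj[OF fct a] by simp
  {
    fix g assume g: "\<And>i. i \<in> expo a \<Longrightarrow> g i \<in> fobj M (unit_obj a)"
    have "\<exists>!z. z \<in> fobj M a \<and> (\<forall>i\<in>expo a. fmap M a (unit_obj a) (proj_mor a i) z = g i)"
      using crit a g by blast
    moreover have "mor_of a (unit_obj a) (proj (expo a) i) = proj_mor a i" if "i \<in> expo a" for i
      using proj_mor[OF universe a that] by (rule mor_of_eqI[OF a unit_obj_Obj[OF universe]])
    ultimately show "\<exists>!z. z \<in> fobj M a \<and>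
        (\<forall>i\<in>expo a. fmap M a (unit_obj a) (mor_of a (unit_obj a) (proj (expo a) i)) z = g i)"
      by (simp cong: conj_cong ball_cong)
  }
  fix b :: "'u eobj" and r z assume b: "b \<in> Obj E_cat" and r: "r \<in> maps (espace a) (espace b)" and z: "z \<in> fobj M a"
  show "fmap M a b (mor_of a b r) z \<in> fobj M b"
    using mor_of(1)[OF a b r] by (intro model_map_in[OF M a b _ z]) simp
  fix c :: "'u eobj" and r' assume c: "c \<in> Obj E_cat" and r': "r' \<in> maps (espace b) (espace c)"
  let ?f = "mor_of a b r" and ?g = "mor_of b c r'"
  have f: "?f \<in> E_hom a b" and g: "?g \<in> E_hom b c" using mor_of(1)[OF a b r] mor_of(1)[OF b c r'] .
  have gf: "mor_of a c (compose (pts a) r' r) = E_comp a b c ?g ?f"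
    using realizeE_comp[OF universe a b c f g] mor_of(2)[OF a b r] mor_of(2)[OF b c r']
    by (intro mor_of_eqI[OF a c]) simp_all
  have "fmap M a c (Comp E_cat a b c ?g ?f) = compose (fobj M a) (fmap M b c ?g) (fmap M a b ?f)"
    using functor_comp[OF fct a b c, of ?f ?g] f g by simp
  from fun_cong[OF this, of z]
  show "fmap M b c ?g (fmap M a b ?f z) = fmap M a c (mor_of a c (compose (pts a) r' r)) z"
    unfolding gf by (simp add: compose_eq[OF z])
next
  have "mor_of X1 Y1 (\<lambda>s\<in>Pow one_point. s) = (phi :: 'u \<Rightarrow> 'u)"
    by (rule mor_of_eqI[OF X_Obj[OF universe] Y_Obj[OF universe] phi[OF universe]])
  then show "inj_on (fmap M X1 Y1 (mor_of X1 Y1 (\<lambda>s\<in>Pow one_point. s))) (fobj M X1)"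
    using M[unfolded functor_E_model_iff[OF universe model_functor[OF M]]] by simp
qed

lemma top_functor_essentially_surjective:
  fixes M :: "('u eobj, 'u \<Rightarrow> 'u, 'u set, 'u \<Rightarrow> 'u) funct"
  assumes M: "is_model TYPE('u) E_cat (E_cones :: ('u + cospan, unit, 'u eobj, 'u \<Rightarrow> 'u) cone set) M"
  shows "\<exists>T :: 'u topology. small TYPE('u) (topspace T) \<and>
    (\<exists>\<eta>. is_iso (Mod_cat E_cat (E_cones :: ('u + cospan, unit, 'u eobj, 'u \<Rightarrow> 'u) cone set)) M (top_model T) \<eta>)"
proof -
  interpret space_model "fobj M" "\<lambda>a b r. fmap M a b (mor_of a b r)"
    by (rule model_space_model[OF M])
  let ?T = pt_space
  note T = small_pt_space
  define \<eta> where "\<eta> = (\<lambda>a\<in>Obj E_cat. \<lambda>z\<in>fobj M a. enc_map ?T a (rep a z) :: 'u)"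
  have bij: "bij_betw (\<eta> a) (fobj M a) (fobj (top_model ?T) a)" if a: "a \<in> Obj E_cat" for a
  proof -
    have "bij_betw (enc_map ?T a :: _ \<Rightarrow> 'u) (maps ?T (espace a)) (fobj (top_model ?T) a)"
      unfolding bij_betw_def fobj_top_model[OF universe] using inj_code[OF small_maps[OF universe T a]] by simp
    from bij_betw_trans[OF rep_bij[OF a] this] have "bij_betw (enc_map ?T a \<circ> rep a) (fobj M a) (fobj (top_model ?T) a)" .
    moreover have "\<eta> a z = (enc_map ?T a \<circ> rep a) z" if "z \<in> fobj M a" for z
      using that a by (simp add: \<eta>_def)
    ultimately show ?thesis by (simp cong: bij_betw_cong)
  qed
  have "\<eta> \<in> nat_trans E_cat (set_cat TYPE('u)) M (top_model ?T)"
    unfolding nat_trans_set_cat_iff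
  proof (intro conjI ballI)
    show "\<eta> \<in> extensional (Obj E_cat)" by (simp add: \<eta>_def)
    fix a :: "'u eobj" assume a: "a \<in> Obj E_cat"
    show "\<eta> a \<in> fobj M a \<rightarrow>\<^sub>E fobj (top_model ?T) a"
    proof (rule PiE_I)
      show "\<eta> a z \<in> fobj (top_model ?T) a" if "z \<in> fobj M a" for z
        using bij_betwE[OF bij[OF a]] that by blast
    qed (use a in \<open>simp add: \<eta>_def\<close>)
    fix b :: "'u eobj" and f z assume b: "b \<in> Obj E_cat" and "f \<in> Hom E_cat a b" and z: "z \<in> fobj M a"
    then have f: "f \<in> E_hom a b" by simp
    have mf: "mor_of a b (realizeE a b f) = f" by (rule mor_of_eqI[OF a b f refl])
    note r = realizeE_in[OF universe a b f]
    have fz: "fmap M a b f z \<in> fobj M b" using model_map_in[OF M a b _ z, of f] f by simp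
    have "rep b (fmap M a b f z) = compose (topspace ?T) (realizeE a b f) (rep a z)"
      using rep_natural[OF a b r z] unfolding mf .
    then show "\<eta> b (fmap M a b f z) = fmap (top_model ?T) a b f (\<eta> a z)"
      using a b z fz by (simp add: \<eta>_def fmap_top_model[OF universe T a rep_maps[OF a z]])
  qed
  from is_iso_Mod_cat[OF M top_model_model[OF universe T] this bij]
  show ?thesis using T by blast
qed

end

theorem proposition9p3:
  assumes "set_universe TYPE('u)"
  shows "realized_limit_sketch TYPE('u) (E_cat :: ('u eobj, 'u \<Rightarrow> 'u) cat) E_cones \<and>
    equivalent_categories
      (Mod_cat (E_cat :: ('u eobj, 'u \<Rightarrow> 'u) cat) E_cones
        :: (('u eobj, 'u \<Rightarrow> 'u, 'u set, 'u \<Rightarrow> 'u) funct, 'u eobj \<Rightarrow> 'u \<Rightarrow> 'u) cat)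
      (op_cat (top_cat :: ('u topology, 'u \<Rightarrow> 'u) cat))"
proof
  show "realized_limit_sketch TYPE('u) (E_cat :: ('u eobj, 'u \<Rightarrow> 'u) cat) E_cones"
    by (rule realized_E[OF assms])
  show "equivalent_categories
      (Mod_cat (E_cat :: ('u eobj, 'u \<Rightarrow> 'u) cat) E_cones
        :: (('u eobj, 'u \<Rightarrow> 'u, 'u set, 'u \<Rightarrow> 'u) funct, 'u eobj \<Rightarrow> 'u \<Rightarrow> 'u) cat)
      (op_cat (top_cat :: ('u topology, 'u \<Rightarrow> 'u) cat))"
  proof (rule equivalence_if_fully_faithful_essentially_surjective)
    show "category (Mod_cat (E_cat :: ('u eobj, 'u \<Rightarrow> 'u) cat) E_cones
        :: (('u eobj, 'u \<Rightarrow> 'u, 'u set, 'u \<Rightarrow> 'u) funct, 'u eobj \<Rightarrow> 'u \<Rightarrow> 'u) cat)"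
      by (rule category_Mod_cat[OF category_E[OF assms]])
    show "category (op_cat (top_cat :: ('u topology, 'u \<Rightarrow> 'u) cat))"
      by (rule category_op[OF category_top_cat])
    show "is_functor (op_cat top_cat) (Mod_cat (E_cat :: ('u eobj, 'u \<Rightarrow> 'u) cat) E_cones) top_functor"
      by (rule top_functor[OF assms])
    show "bij_betw (fmap top_functor T S) (Hom (op_cat top_cat) T S)
        (Hom (Mod_cat E_cat E_cones) (fobj top_functor T) (fobj top_functor S))"
      if "T \<in> Obj (op_cat top_cat)" "S \<in> Obj (op_cat top_cat)" for T S :: "'u topology"
      using top_functor_fully_faithful[OF assms, of T S] that by (simp add: op_cat_def)
    show "\<exists>T\<in>Obj (op_cat top_cat). \<exists>\<eta>. is_iso (Mod_cat E_cat E_cones) M (fobj top_functor T) \<eta>"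
      if "M \<in> Obj (Mod_cat E_cat E_cones)" for M :: "('u eobj, 'u \<Rightarrow> 'u, 'u set, 'u \<Rightarrow> 'u) funct"
      using top_functor_essentially_surjective[OF assms, of M] that by (simp add: op_cat_def)
  qed
qed


end
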